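(* Consider the port-Hamiltonian system \begin{align*} \frac{\partial x}{\partial t}(\zeta,t) &= \left(P_1\frac{\partial}{\partial\zeta}+G_0\right)(\mathcal H(\zeta)x(\zeta,t)),\qquad x(\zeta,0)=x_0(\zeta),\\ 0&=\begin{bmatrix}W_{B,1}&W_{B,0}\end{bmatrix}\begin{bmatrix}(\mathcal Hx)(1,t)\\(\mathcal Hx)(0,t)\end{bmatrix},\qquad y(t)=\begin{bmatrix}W_{C,1}&W_{C,0}\end{bmatrix}\begin{bmatrix}(\mathcal Hx)(1,t)\\(\mathcal Hx)(0,t)\end{bmatrix}, \end{align*} with $\zeta\in[0,1]$, $t\ge 0$, satisfying the standing assumptions listed in the context, and let $A$ be its associated operator. Suppose that the $2n\times 2n$ matrix $$\mathcal W_{BC}:=\begin{bmatrix}W_{B,1}&W_{B,0}\\ W_{C,1}&W_{C,0}\end{bmatrix}$$ is invertible, that the $C_0$-semigroup generated by $A$ is strongly stable, and that $\mathrm{Re}\,G_0=0$. Then the system is exactly observable in finite time, that is, there exist a time $t_0>0$ and a constant $\delta>0$ such that for every $x_0\in\mathbf D(A)$ the output $y$ of the classical solution with initial condition $x_0$ satisfies $$\int_0^{t_0}\|y(t)\|^2\,dt\ \ge\ \delta\,\|x_0\|_X^2 .$$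
   Context: Standing assumptions: $P_1$ is an invertible Hermitian $n\times n$ matrix; $G_0$ is a (complex) $n\times n$ matrix; $\begin{bmatrix}W_{B,1}&W_{B,0}\end{bmatrix}$ and $\begin{bmatrix}W_{C,1}&W_{C,0}\end{bmatrix}$ are $n\times 2n$ matrices of full row rank; $\mathcal H(\zeta)$ is a positive Hermitian $n\times n$ matrix for almost all $\zeta\in[0,1]$ with $\mathcal H,\mathcal H^{-1}\in L^\infty(0,1;\mathbb C^{n\times n})$. Write $P_1\mathcal H(\zeta)=S^{-1}(\zeta)\Delta(\zeta)S(\zeta)$ with $\Delta(\zeta)$ diagonal and $S(\zeta)$ invertible for almost all $\zeta$; it is assumed that $S^{-1},S,\Delta:[0,1]\to\mathbb C^{n\times n}$ are continuously differentiable. The state space is $X:=L^2(0,1;\mathbb C^n)$ with the energy norm $\|x\|_X=\sqrt{\langle x,\mathcal Hx\rangle}$, where $\langle\cdot,\cdot\rangle$ is the standard $L^2$ inner product; this norm is equivalent to the standard $L^2$ norm. The operator $A:\mathbf D(A)\subset X\to X$ is $Ax:=\left(P_1\frac{d}{d\zeta}+G_0\right)(\mathcal Hx)$ with $$\mathbf D(A):=\left\{x\in X\ \middle|\ \mathcal Hx\in H^1(0,1;\mathbb C^n),\ \begin{bmatrix}W_{B,1}&W_{B,0}\end{bmatrix}\begin{bmatrix}(\mathcal Hx)(1)\\(\mathcal Hx)(0)\end{bmatrix}=0\right\}.$$ It is assumed that $A$ generates a $C_0$-semigroup $(T(t))_{t\ge0}$ on $X$. For $x_0\in\mathbf D(A)$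 the unique classical solution is $x(\cdot,t)=T(t)x_0\in\mathbf D(A)$. $\mathrm{Re}\,G_0:=\frac12(G_0+G_0^* )$. A $C_0$-semigroup $(T(t))_{t\ge0}$ on $X$ is strongly stable if $\lim_{t\to\infty}\|T(t)x\|=0$ for all $x\in X$. *)

theory Defs
  imports "HOL-Analysis.Analysis"
begin

section \<open>Complex matrices\<close>

definition adjoint_matrix :: "complex^'n^'m \<Rightarrow> complex^'m^'n" where
  "adjoint_matrix M = (\<chi> i j. cnj (M $ j $ i))"

definition hermitian :: "complex^'n^'n \<Rightarrow> bool" where
  "hermitian M \<longleftrightarrow> adjoint_matrix M = M"

definition re_part :: "complex^'n^'n \<Rightarrow> complex^'n^'n" where
  "re_part M = (1/2) *\<^sub>R (M + adjoint_matrix M)"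

definition diagonal :: "complex^'n^'n \<Rightarrow> bool" where
  "diagonal M \<longleftrightarrow> (\<forall>i j. i \<noteq> j \<longrightarrow> M $ i $ j = 0)"

text \<open>The inner product of \<open>\<complex>\<^sup>n\<close>, linear in the first argument.\<close>

definition cinner :: "complex^'n \<Rightarrow> complex^'n \<Rightarrow> complex" where
  "cinner u v = (\<Sum>i\<in>UNIV. u $ i * cnj (v $ i))"

definition positive_hermitian :: "complex^'n^'n \<Rightarrow> bool" where
  "positive_hermitian M \<longleftrightarrow> hermitian M \<and> (\<forall>v. v \<noteq> 0 \<longrightarrow> 0 < Re (cinner (M *v v) v))"

text \<open>Block vectors and block matrices, with the sum type \<open>'n + 'n\<close> as index type of size \<open>2n\<close>.\<close>

definition stack_vec :: "'a^'n \<Rightarrow> 'a^'m \<Rightarrow> 'a^('n + 'm)" where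
  "stack_vec u v = (\<chi> i. case i of Inl k \<Rightarrow> u $ k | Inr k \<Rightarrow> v $ k)"

definition row_block :: "'a^'n^'k \<Rightarrow> 'a^'m^'k \<Rightarrow> 'a^('n + 'm)^'k" where
  "row_block M N = (\<chi> i. stack_vec (M $ i) (N $ i))"

definition column_block :: "'a^'k^'n \<Rightarrow> 'a^'k^'m \<Rightarrow> 'a^'k^('n + 'm)" where
  "column_block M N = stack_vec M N"

definition full_row_rank :: "complex^'k^'m \<Rightarrow> bool" where
  "full_row_rank M \<longleftrightarrow> rank M = CARD('m)"


section \<open>Function spaces on the unit interval\<close>

text \<open>
  Elements of \<open>L\<^sup>2\<close>, \<open>L\<^sup>\<infinity>\<close> and \<open>H\<^sup>1\<close> are represented by functions \<open>real \<Rightarrow> _\<close>; equality in these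
  spaces is equality almost everywhere on \<open>[0,1]\<close>, and values outside \<open>[0,1]\<close> are irrelevant.
\<close>

abbreviation unit_measure :: "real measure" where
  "unit_measure \<equiv> lebesgue_on {0..1}"

definition L2 :: "(real \<Rightarrow> complex^'n) set" where
  "L2 = {x \<in> borel_measurable unit_measure. integrable unit_measure (\<lambda>\<zeta>. (norm (x \<zeta>))\<^sup>2)}"

definition L2_inner :: "(real \<Rightarrow> complex^'n) \<Rightarrow> (real \<Rightarrow> complex^'n) \<Rightarrow> complex" where
  "L2_inner x y = (LINT \<zeta>|unit_measure. cinner (x \<zeta>) (y \<zeta>))"

definition Linfty :: "(real \<Rightarrow> complex^'n^'m) set" where
  "Linfty = {M \<in> borel_measurable unit_measure. \<exists>C. AE \<zeta> in unit_measure. norm (M \<zeta>) \<le> C}"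

text \<open>The library's \<open>C1_differentiable_on\<close> would use two-sided derivatives at the end points.\<close>

definition C1_unit :: "(real \<Rightarrow> complex^'n^'m) \<Rightarrow> bool" where
  "C1_unit M \<longleftrightarrow> (\<exists>M'. continuous_on {0..1} M' \<and>
     (\<forall>\<zeta>\<in>{0..1}. (M has_vector_derivative M' \<zeta>) (at \<zeta> within {0..1})))"

text \<open>
  \<open>H1_rep f g g'\<close>: \<open>g\<close> is the absolutely continuous representative of \<open>f\<close> and \<open>g' \<in> L\<^sup>2\<close> is its
  derivative. The representative \<open>g\<close> is unique on \<open>[0,1]\<close> and \<open>g'\<close> is unique almost everywhere, so
  that the choices below are harmless.
\<close>

definition H1_rep ::
  "(real \<Rightarrow> complex^'n) \<Rightarrow> (real \<Rightarrow> complex^'n) \<Rightarrow> (real \<Rightarrow> complex^'n) \<Rightarrow> bool" where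
  "H1_rep f g g' \<longleftrightarrow>
     (AE \<zeta> in unit_measure. f \<zeta> = g \<zeta>) \<and> g' \<in> L2 \<and>
     (\<forall>\<zeta>\<in>{0..1}. g \<zeta> = g 0 + (LINT s|lebesgue_on {0..\<zeta>}. g' s))"

definition H1 :: "(real \<Rightarrow> complex^'n) set" where
  "H1 = {f. \<exists>g g'. H1_rep f g g'}"

definition ac_rep :: "(real \<Rightarrow> complex^'n) \<Rightarrow> real \<Rightarrow> complex^'n" where
  "ac_rep f = (SOME g. \<exists>g'. H1_rep f g g')"

definition H1_deriv :: "(real \<Rightarrow> complex^'n) \<Rightarrow> real \<Rightarrow> complex^'n" where
  "H1_deriv f = (SOME g'. \<exists>g. H1_rep f g g')"


section \<open>Strongly continuous semigroups\<close>

text \<open>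
  Semigroups on the space \<open>L2\<close> with a norm \<open>N\<close> (a seminorm on representatives). Linearity and
  boundedness make \<open>T t\<close> compatible with equality almost everywhere.
\<close>

definition C0_semigroup ::
  "((real \<Rightarrow> complex^'n) \<Rightarrow> real) \<Rightarrow> (real \<Rightarrow> (real \<Rightarrow> complex^'n) \<Rightarrow> (real \<Rightarrow> complex^'n)) \<Rightarrow> bool" where
  "C0_semigroup N T \<longleftrightarrow>
     (\<forall>t\<ge>0. \<forall>x\<in>L2. T t x \<in> L2) \<and>
     (\<forall>t\<ge>0. \<forall>x\<in>L2. \<forall>y\<in>L2. \<forall>a b. AE \<zeta> in unit_measure.
        T t (\<lambda>\<zeta>. a *s x \<zeta> + b *s y \<zeta>) \<zeta> = a *s T t x \<zeta> + b *s T t y \<zeta>) \<and>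
     (\<forall>t\<ge>0. \<exists>C. \<forall>x\<in>L2. N (T t x) \<le> C * N x) \<and>
     (\<forall>x\<in>L2. AE \<zeta> in unit_measure. T 0 x \<zeta> = x \<zeta>) \<and>
     (\<forall>s\<ge>0. \<forall>t\<ge>0. \<forall>x\<in>L2. AE \<zeta> in unit_measure. T (s + t) x \<zeta> = T s (T t x) \<zeta>) \<and>
     (\<forall>x\<in>L2. ((\<lambda>t. N (\<lambda>\<zeta>. T t x \<zeta> - x \<zeta>)) \<longlongrightarrow> 0) (at_right 0))"

definition generator_limit ::
  "((real \<Rightarrow> complex^'n) \<Rightarrow> real) \<Rightarrow> (real \<Rightarrow> (real \<Rightarrow> complex^'n) \<Rightarrow> (real \<Rightarrow> complex^'n)) \<Rightarrow>
   (real \<Rightarrow> complex^'n) \<Rightarrow> (real \<Rightarrow> complex^'n) \<Rightarrow> bool" where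
  "generator_limit N T x z \<longleftrightarrow> z \<in> L2 \<and>
     ((\<lambda>h. N (\<lambda>\<zeta>. (1 / h) *\<^sub>R (T h x \<zeta> - x \<zeta>) - z \<zeta>)) \<longlongrightarrow> 0) (at_right 0)"

text \<open>The operator \<open>A\<close> with domain \<open>D\<close> is the infinitesimal generator of \<open>T\<close>.\<close>

definition generates_C0_semigroup ::
  "((real \<Rightarrow> complex^'n) \<Rightarrow> real) \<Rightarrow> (real \<Rightarrow> complex^'n) set \<Rightarrow>
   ((real \<Rightarrow> complex^'n) \<Rightarrow> (real \<Rightarrow> complex^'n)) \<Rightarrow>
   (real \<Rightarrow> (real \<Rightarrow> complex^'n) \<Rightarrow> (real \<Rightarrow> complex^'n)) \<Rightarrow> bool" where
  "generates_C0_semigroup N D A T \<longleftrightarrow> C0_semigroup N T \<and>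
     D = {x \<in> L2. \<exists>z. generator_limit N T x z} \<and>
     (\<forall>x\<in>D. generator_limit N T x (A x))"

definition strongly_stable ::
  "((real \<Rightarrow> complex^'n) \<Rightarrow> real) \<Rightarrow> (real \<Rightarrow> (real \<Rightarrow> complex^'n) \<Rightarrow> (real \<Rightarrow> complex^'n)) \<Rightarrow> bool" where
  "strongly_stable N T \<longleftrightarrow> (\<forall>x\<in>L2. ((\<lambda>t. N (T t x)) \<longlongrightarrow> 0) at_top)"


section \<open>Port-Hamiltonian systems\<close>

definition ham :: "(real \<Rightarrow> complex^'n^'n) \<Rightarrow> (real \<Rightarrow> complex^'n) \<Rightarrow> real \<Rightarrow> complex^'n" where
  "ham \<H> x = (\<lambda>\<zeta>. \<H> \<zeta> *v x \<zeta>)"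

definition energy_norm :: "(real \<Rightarrow> complex^'n^'n) \<Rightarrow> (real \<Rightarrow> complex^'n) \<Rightarrow> real" where
  "energy_norm \<H> x = sqrt (Re (L2_inner x (ham \<H> x)))"

definition boundary_trace :: "(real \<Rightarrow> complex^'n) \<Rightarrow> complex^('n + 'n)" where
  "boundary_trace f = stack_vec (ac_rep f 1) (ac_rep f 0)"

definition phs_domain ::
  "(real \<Rightarrow> complex^'n^'n) \<Rightarrow> complex^('n + 'n)^'n \<Rightarrow> (real \<Rightarrow> complex^'n) set" where
  "phs_domain \<H> W\<^sub>B = {x \<in> L2. ham \<H> x \<in> H1 \<and> W\<^sub>B *v boundary_trace (ham \<H> x) = 0}"

definition phs_operator ::
  "complex^'n^'n \<Rightarrow> complex^'n^'n \<Rightarrow> (real \<Rightarrow> complex^'n^'n) \<Rightarrow>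
   (real \<Rightarrow> complex^'n) \<Rightarrow> real \<Rightarrow> complex^'n" where
  "phs_operator P\<^sub>1 G\<^sub>0 \<H> x = (\<lambda>\<zeta>. P\<^sub>1 *v H1_deriv (ham \<H> x) \<zeta> + G\<^sub>0 *v ham \<H> x \<zeta>)"

text \<open>The output of the classical solution \<open>t \<mapsto> T t x\<^sub>0\<close> for \<open>x\<^sub>0\<close> in the domain.\<close>

definition phs_output ::
  "(real \<Rightarrow> complex^'n^'n) \<Rightarrow> complex^('n + 'n)^'n \<Rightarrow>
   (real \<Rightarrow> (real \<Rightarrow> complex^'n) \<Rightarrow> (real \<Rightarrow> complex^'n)) \<Rightarrow>
   (real \<Rightarrow> complex^'n) \<Rightarrow> real \<Rightarrow> complex^'n" where
  "phs_output \<H> W\<^sub>C T x\<^sub>0 t = W\<^sub>C *v boundary_trace (ham \<H> (T t x\<^sub>0))"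

end

theory Submission
  imports Defs
begin

text \<open>
  Multiplier method. Along a classical solution \<open>x(t)\<close> put \<open>g = \<H> x(t)\<close>. Since \<open>Re G\<^sub>0 = 0\<close>, the energy
  \<open>E(t) = \<langle>x, \<H> x\<rangle>\<close> changes only through the boundary, \<open>E' = [g\<^sup>* P\<^sub>1 g]\<^sub>0\<^sup>1\<close>; as \<open>\<W>\<^sub>B\<^sub>C\<close> is invertible and
  \<open>W\<^sub>B\<close> annihilates the boundary trace, this is bounded by a multiple of \<open>|y|\<^sup>2\<close>. The functional
  \<open>q = \<langle>x, m \<H> P\<^sub>1 \<H> x\<rangle>\<close> with the weight \<open>m(\<zeta>) = exp (k \<zeta>)\<close> satisfies \<open>|q| \<le> d E\<close> and, for large \<open>k\<close>,
  \<open>q' \<le> b |y|\<^sup>2 - c E\<close>. Integrating both relations over a time interval of length \<open>(2 d + 1) / c\<close> bounds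
  \<open>E(0)\<close> by the integral of \<open>|y|\<^sup>2\<close>. That orbits are continuous and
  differentiable from both sides rests on the uniform boundedness principle, for which \<open>L\<^sup>2\<close> has
  to be a complete normed space: hence the quotient type of functions modulo equality almost everywhere.
\<close>

section \<open>Absolutely continuous functions on the unit interval\<close>

text \<open>The multiplier must be differentiated in \<zeta>, while \<H> itself is only measurable.
  The diagonalization supplies the regularity: \<H> agrees almost everywhere with
  \<open>P\<^sub>1^-1 S^-1 \<Delta> S\<close>, which is C1. In the derivative of
  \<open>m <P g, \<H> P g>\<close> the weight contributes \<open>k m <P g, \<H> P g>\<close>; since
  \<H> is uniformly positive and \<open>P\<^sub>1\<close> is invertible, this controls a multiple of
  \<open>k |g|^2\<close> and absorbs the contributions of \<open>G\<^sub>0\<close> and of the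
  derivative of \<H>. The boundary form has no known sign, so \<open>E\<close> may grow or decay;
  its change is therefore bounded in both directions by the integral of \<open>|y|^2\<close>. The
  length \<open>(2 d + 1) / c\<close> leaves exactly one copy of \<open>E(0)\<close> after both end
  values of \<open>q\<close> are charged to the energy. The output consists of point values of
  \<open>g\<close>, which the norm of \<open>x\<close> does not control. The norms of
  \<open>x\<close> and \<open>A x\<close> together do, and both \<open>T t x\<close> and
  \<open>A (T t x) = T t (A x)\<close> are continuous in \<open>t\<close>. Only real parts of the
  complex forms occur, so the state space is treated as a real Hilbert space.\<close>

definition has_AC_derivative :: "(real \<Rightarrow> 'a::euclidean_space) \<Rightarrow> (real \<Rightarrow> 'a) \<Rightarrow> bool" where
  "has_AC_derivative u u' \<longleftrightarrow> integrable (lebesgue_on {0..1}) u' \<and>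
     (\<forall>s\<in>{0..1}. u s = u 0 + (LINT r|lebesgue_on {0..s}. u' r))"

lemma has_AC_derivativeD:
  assumes "has_AC_derivative u u'"
  shows "integrable (lebesgue_on {0..1}) u'"
    and "s \<in> {0..1} \<Longrightarrow> u s = u 0 + (LINT r|lebesgue_on {0..s}. u' r)"
  using assms unfolding has_AC_derivative_def by blast+

lemma integrable_lebesgue_on_subinterval:
  fixes f :: "real \<Rightarrow> 'a::euclidean_space"
  assumes "integrable (lebesgue_on {0..1}) f" "b \<in> {0..1}"
  shows "integrable (lebesgue_on {0..b}) f"
  by (rule integrable_subinterval[OF assms(1)]) (use assms(2) in auto)

lemma has_AC_derivative_continuous_on:
  assumes "has_AC_derivative u u'"
  shows "continuous_on {0..1} u"
proof -
  have i: "integrable (lebesgue_on {0..1}) u'"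
    using assms has_AC_derivativeD(1) by blast
  have c: "continuous_on {0..1} (\<lambda>s. u 0 + integral {0..s} u')"
    by (intro continuous_intros indefinite_integral_continuous_1 integrable_on_lebesgue_on[OF i]) auto
  have e: "u s = u 0 + integral {0..s} u'" if "s \<in> {0..1}" for s
  proof -
    have "u s = u 0 + (LINT r|lebesgue_on {0..s}. u' r)"
      using has_AC_derivativeD(2)[OF assms that] .
    then show ?thesis
      using lebesgue_integral_eq_integral[OF integrable_lebesgue_on_subinterval[OF i that]] by simp
  qed
  show ?thesis by (rule continuous_on_eq[OF c e[symmetric]])
qed

lemma AE_lebesgue_on_neq:
  fixes s :: real
  assumes "S \<in> sets lebesgue"
  shows "AE r in lebesgue_on S. r \<noteq> s"
proof -
  have "AE r in lebesgue. r \<noteq> s" by (rule AE_completion[OF AE_lborel_singleton])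
  then show ?thesis using assms by (auto simp: AE_restrict_space_iff elim!: eventually_mono)
qed
 
lemma borel_measurable_bounded_bilinear:
  fixes prod :: "'a::euclidean_space \<Rightarrow> 'b::euclidean_space \<Rightarrow> 'c::euclidean_space"
  assumes "bounded_bilinear prod" "f \<in> borel_measurable N" "g \<in> borel_measurable N"
  shows "(\<lambda>x. prod (f x) (g x)) \<in> borel_measurable N"
proof (rule borel_measurable_continuous_Pair[OF assms(2,3)])
  show "continuous_on UNIV (\<lambda>x. prod (fst x) (snd x))"
    using bounded_bilinear.continuous_on[OF assms(1) continuous_on_fst[OF continuous_on_id] continuous_on_snd[OF continuous_on_id]] .
qed

text \<open>Turns a variable upper limit into an indicator weight, so that all integrals live on one
  fixed measure. Fubini needs this, and so does the subtraction of two integrals with different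
  limits.\<close>

lemma integral_lebesgue_on_subinterval:
  fixes f :: "real \<Rightarrow> 'a::euclidean_space"
  assumes "s \<in> {0..b}"
  shows "(LINT r|lebesgue_on {0..s}. f r) = (LINT r|lebesgue_on {0..b}. indicator {0..s} r *\<^sub>R f r)"
proof -
  have "lebesgue_on {0..s} = restrict_space (lebesgue_on {0..b}) {0..s}"
    using assms by (subst restrict_restrict_space) (auto simp: min_def max_def intro!: arg_cong[where f="restrict_space _"])
  then show ?thesis
    using assms by (simp add: integral_restrict_space sets_restrict_space_iff)
qed

text \<open>Fubini: the product of the two integrals splits into integrals over \<open>r \<le> s\<close> and \<open>s \<le> r\<close>.\<close>

lemma integral_by_parts_AC:
  fixes u :: "real \<Rightarrow> 'a::euclidean_space" and v :: "real \<Rightarrow> 'b::euclidean_space"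
    and prod :: "'a \<Rightarrow> 'b \<Rightarrow> 'c::euclidean_space"
  assumes "bounded_bilinear prod" "0 \<le> b"
    and iu: "integrable (lebesgue_on {0..b}) u'" and iv: "integrable (lebesgue_on {0..b}) v'"
    and u: "\<And>s. s \<in> {0..b} \<Longrightarrow> u s = u 0 + (LINT r|lebesgue_on {0..s}. u' r)"
    and v: "\<And>s. s \<in> {0..b} \<Longrightarrow> v s = v 0 + (LINT r|lebesgue_on {0..s}. v' r)"
  shows "prod (u b) (v b) =
    prod (u 0) (v 0) + ((LINT s|lebesgue_on {0..b}. prod (u' s) (v s)) + (LINT s|lebesgue_on {0..b}. prod (u s) (v' s)))"
proof -
  interpret p: bounded_bilinear prod by fact
  define M where "M = lebesgue_on {0..b}"
  interpret fM: finite_measure M unfolding M_def by (rule finite_measure_lebesgue_on) auto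
  interpret MM: pair_sigma_finite M M ..
  have iu[simp]: "integrable M u'" and iv[simp]: "integrable M v'"
    using iu iv by (auto simp: M_def)
  have mu[measurable]: "u' \<in> borel_measurable M" and mv[measurable]: "v' \<in> borel_measurable M"
    by (rule borel_measurable_integrable, simp)+
  have idm[measurable]: "(\<lambda>x. x) \<in> borel_measurable M"
    using id_borel_measurable_lebesgue_on[of "{0..b}"] by (auto simp: M_def id_def)
  have sp: "space M = {0..b}" by (simp add: M_def)
  define F where "F = (\<lambda>s r. prod (u' s) (v' r))"
  obtain K where K: "\<And>x y. norm (prod x y) \<le> norm x * norm y * K" using p.bounded by blast
  have pm: "(\<lambda>x. prod (f x) (g x)) \<in> borel_measurable N"
    if "f \<in> borel_measurable N" "g \<in> borel_measurable N" for f g and N :: "'z measure"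
    by (rule borel_measurable_bounded_bilinear[OF assms(1) that])
  have Fm[measurable]: "case_prod F \<in> borel_measurable (M \<Otimes>\<^sub>M M)"
    unfolding F_def split_def by (rule pm) measurable
  have iN: "integrable (M \<Otimes>\<^sub>M M) (\<lambda>(s,r). norm (u' s) * norm (v' r) * K)"
  proof (rule MM.Fubini_integrable)
    show "(\<lambda>(s,r). norm (u' s) * norm (v' r) * K) \<in> borel_measurable (M \<Otimes>\<^sub>M M)" by measurable
  qed (auto simp: abs_mult mult.assoc)
  have iF: "integrable (M \<Otimes>\<^sub>M M) (case_prod F)"
    by (rule Bochner_Integration.integrable_bound[OF iN Fm])
       (use order_trans[OF K abs_ge_self] in \<open>simp add: F_def split_def\<close>)
  \<comment> \<open>\<open>A\<close> and \<open>B\<close> carry the kernel on the two triangles.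
    Integrating \<open>A\<close> over \<open>r\<close> first produces \<open>v s - v 0\<close>, and
    integrating \<open>B\<close> over \<open>s\<close> first produces \<open>u r - u 0\<close>; up
    to initial values these give the two integrands of the formula.\<close>
  define A where "A = (\<lambda>s r. indicator {0..s} r *\<^sub>R F s r)"
  define B where "B = (\<lambda>s r. indicator {0..r} s *\<^sub>R F s r)"
  have i1: "(\<lambda>x. indicator {0..fst x} (snd x) :: real) \<in> borel_measurable (M \<Otimes>\<^sub>M M)"
    unfolding indicator_def atLeastAtMost_iff by measurable
  have i2: "(\<lambda>x. indicator {0..snd x} (fst x) :: real) \<in> borel_measurable (M \<Otimes>\<^sub>M M)"
    unfolding indicator_def atLeastAtMost_iff by measurable
  have iA: "integrable (M \<Otimes>\<^sub>M M) (case_prod A)"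
    by (rule Bochner_Integration.integrable_bound[OF iF])
      (use i1 Fm in \<open>auto simp: A_def split_def indicator_def\<close>)
  have iB: "integrable (M \<Otimes>\<^sub>M M) (case_prod B)"
    by (rule Bochner_Integration.integrable_bound[OF iF])
      (use i2 Fm in \<open>auto simp: B_def split_def indicator_def\<close>)
  have ind: "integrable M (\<lambda>r. indicator {0..s} r *\<^sub>R v' r)" "integrable M (\<lambda>r. indicator {0..s} r *\<^sub>R u' r)"
    if "s \<in> {0..b}" for s
    by (rule integrable_mult_indicator; use that in \<open>simp add: M_def sets_restrict_space_iff\<close>; simp add: M_def[symmetric])+
  have Ain: "(LINT r|M. A s r) = prod (u' s) (v s - v 0)" if "s \<in> {0..b}" for s
  proof -
    have "(LINT r|M. A s r) = (LINT r|M. prod (u' s) (indicator {0..s} r *\<^sub>R v' r))"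
      by (simp add: A_def F_def p.scaleR_right)
    also have "\<dots> = prod (u' s) (LINT r|M. indicator {0..s} r *\<^sub>R v' r)"
      by (rule integral_bounded_linear[OF p.bounded_linear_right ind(1)[OF that]])
    finally show ?thesis using v[OF that] integral_lebesgue_on_subinterval[OF that, of v'] by (simp add: M_def)
  qed
  have Bin: "(LINT s|M. B s r) = prod (u r - u 0) (v' r)" if "r \<in> {0..b}" for r
  proof -
    have "(LINT s|M. B s r) = (LINT s|M. prod (indicator {0..r} s *\<^sub>R u' s) (v' r))"
      by (simp add: B_def F_def p.scaleR_left)
    also have "\<dots> = prod (LINT s|M. indicator {0..r} s *\<^sub>R u' s) (v' r)"
      by (rule integral_bounded_linear[OF p.bounded_linear_left ind(2)[OF that]])
    finally show ?thesis using u[OF that] integral_lebesgue_on_subinterval[OF that, of u'] by (simp add: M_def)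
  qed
  have jA: "integrable M (\<lambda>s. LINT r|M. A s r)" using MM.integrable_fst[OF iA] .
  have jB: "integrable M (\<lambda>s. LINT r|M. B s r)" using MM.integrable_fst[OF iB] .
  have jB': "integrable M (\<lambda>r. LINT s|M. B s r)" using MM.integrable_snd[OF iB] .
  have "(LINT s|M. prod (u' s) (v s)) = (LINT s|M. prod (u' s) (v 0) + (LINT r|M. A s r))"
    by (intro Bochner_Integration.integral_cong) (auto simp: sp Ain p.diff_right)
  also have "\<dots> = prod (LINT s|M. u' s) (v 0) + (LINT s|M. LINT r|M. A s r)"
    by (subst Bochner_Integration.integral_add)
       (auto simp: jA integral_bounded_linear[OF p.bounded_linear_left] integrable_bounded_linear[OF p.bounded_linear_left])
  finally have e1: "(LINT s|M. prod (u' s) (v s)) = prod (LINT s|M. u' s) (v 0) + (LINT s|M. LINT r|M. A s r)" .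
  have "(LINT r|M. prod (u r) (v' r)) = (LINT r|M. prod (u 0) (v' r) + (LINT s|M. B s r))"
    by (intro Bochner_Integration.integral_cong) (auto simp: sp Bin p.diff_left)
  also have "\<dots> = prod (u 0) (LINT s|M. v' s) + (LINT r|M. LINT s|M. B s r)"
    by (subst Bochner_Integration.integral_add)
       (auto simp: jB' integral_bounded_linear[OF p.bounded_linear_right] integrable_bounded_linear[OF p.bounded_linear_right])
  also have "(LINT r|M. LINT s|M. B s r) = (LINT s|M. LINT r|M. B s r)"
    by (rule MM.Fubini_integral[OF iB])
  finally have e2: "(LINT r|M. prod (u r) (v' r)) = prod (u 0) (LINT s|M. v' s) + (LINT s|M. LINT r|M. B s r)" .
  have iAs: "AE s in M. integrable M (A s)" using MM.AE_integrable_fst[OF iA] by simp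
  have iBs: "AE s in M. integrable M (B s)" using MM.AE_integrable_fst[OF iB] by simp
  have "(LINT s|M. LINT r|M. A s r) + (LINT s|M. LINT r|M. B s r) = (LINT s|M. (LINT r|M. A s r) + (LINT r|M. B s r))"
    by (rule Bochner_Integration.integral_add[symmetric, OF jA jB])
  also have "\<dots> = (LINT s|M. (LINT r|M. F s r))"
  proof (rule integral_cong_AE)
    show "AE s in M. (LINT r|M. A s r) + (LINT r|M. B s r) = (LINT r|M. F s r)"
      using iAs iBs AE_space
    proof eventually_elim
      case (elim s)
      then have "(LINT r|M. A s r) + (LINT r|M. B s r) = (LINT r|M. A s r + B s r)" by simp
      also have "\<dots> = (LINT r|M. F s r)"
      proof (rule integral_cong_AE)
        \<comment> \<open>The diagonal lies in both triangles and is counted twice by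
          \<open>A + B\<close>, but for fixed \<open>s\<close> it is a single point.\<close>
        have "AE r in M. r \<noteq> s" unfolding M_def by (rule AE_lebesgue_on_neq) simp
        then show "AE r in M. A s r + B s r = F s r"
          using AE_space by eventually_elim (use elim in \<open>auto simp: A_def B_def sp indicator_def\<close>)
        show "F s \<in> borel_measurable M" unfolding F_def by (rule pm) auto
        show "(\<lambda>r. A s r + B s r) \<in> borel_measurable M"
          using elim by (intro borel_measurable_add) auto
      qed
      finally show ?case .
    qed
    show "(\<lambda>s. (LINT r|M. A s r) + (LINT r|M. B s r)) \<in> borel_measurable M" using jA jB by auto
    show "(\<lambda>s. (LINT r|M. F s r)) \<in> borel_measurable M" using MM.integrable_fst[OF iF] by auto
  qed
  also have "\<dots> = prod (LINT s|M. u' s) (LINT r|M. v' r)"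
    by (simp add: F_def integral_bounded_linear[OF p.bounded_linear_left] integral_bounded_linear[OF p.bounded_linear_right])
  finally have e3: "(LINT s|M. LINT r|M. A s r) + (LINT s|M. LINT r|M. B s r) = prod (LINT s|M. u' s) (LINT r|M. v' r)" .
  have "u b = u 0 + (LINT s|M. u' s)" "v b = v 0 + (LINT s|M. v' s)"
    using u[of b] v[of b] \<open>0 \<le> b\<close> by (auto simp: M_def)
  then have "prod (u b) (v b) = prod (u 0) (v 0) + (prod (LINT s|M. u' s) (v 0) + prod (u 0) (LINT s|M. v' s)
      + prod (LINT s|M. u' s) (LINT r|M. v' r))"
    by (simp add: p.add_left p.add_right)
  then show ?thesis
    unfolding M_def[symmetric] e1 e2 e3[symmetric] by (simp add: algebra_simps)
qed

text \<open>The product is an arbitrary bounded bilinear map, so that one proof serves inner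
  products and matrix-vector products. The derivative is integrable because in each summand one
  factor is continuous, hence bounded on the compact interval.\<close>

lemma has_AC_derivative_prod:
  fixes u :: "real \<Rightarrow> 'a::euclidean_space" and v :: "real \<Rightarrow> 'b::euclidean_space"
    and prod :: "'a \<Rightarrow> 'b \<Rightarrow> 'c::euclidean_space"
  assumes "bounded_bilinear prod" "has_AC_derivative u u'" "has_AC_derivative v v'"
  shows "has_AC_derivative (\<lambda>s. prod (u s) (v s)) (\<lambda>s. prod (u' s) (v s) + prod (u s) (v' s))"
proof -
  interpret p: bounded_bilinear prod by fact
  obtain K where K: "\<And>x y. norm (prod x y) \<le> norm x * norm y * K" "K > 0" using p.pos_bounded by blast
  have iu: "integrable unit_measure u'" and iv: "integrable unit_measure v'"
    by (rule has_AC_derivativeD(1)[OF assms(2)], rule has_AC_derivativeD(1)[OF assms(3)])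
  have cu: "continuous_on {0..1} u" and cv: "continuous_on {0..1} v"
    using assms has_AC_derivative_continuous_on by blast+
  have mm: "u \<in> borel_measurable unit_measure" "v \<in> borel_measurable unit_measure"
    using cu cv by (auto intro!: continuous_imp_measurable_on_sets_lebesgue)
  have pm: "(\<lambda>x. prod (f x) (g x)) \<in> borel_measurable unit_measure"
    if "f \<in> borel_measurable unit_measure" "g \<in> borel_measurable unit_measure" for f g
    by (rule borel_measurable_bounded_bilinear[OF assms(1) that])
  obtain Cu where Cu: "\<And>s. s \<in> {0..1} \<Longrightarrow> norm (u s) \<le> Cu"
    using compact_imp_bounded[OF compact_continuous_image[OF cu compact_Icc]] unfolding bounded_iff by blast
  obtain Cv where Cv: "\<And>s. s \<in> {0..1} \<Longrightarrow> norm (v s) \<le> Cv"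
    using compact_imp_bounded[OF compact_continuous_image[OF cv compact_Icc]] unfolding bounded_iff by blast
  have i1: "integrable unit_measure (\<lambda>s. prod (u' s) (v s))"
  proof (rule Bochner_Integration.integrable_bound)
    show "integrable unit_measure (\<lambda>s. norm (u' s) * (Cv * K))" using iu by auto
    show "AE s in unit_measure. norm (prod (u' s) (v s)) \<le> norm (norm (u' s) * (Cv * K))"
    proof (rule AE_I2)
      fix s assume s: "s \<in> space unit_measure"
      have "norm (prod (u' s) (v s)) \<le> norm (u' s) * norm (v s) * K" by (rule K)
      also have "\<dots> \<le> norm (u' s) * Cv * K" using Cv[of s] s K(2) by (intro mult_mono mult_left_mono mult_right_mono) auto
      finally show "norm (prod (u' s) (v s)) \<le> norm (norm (u' s) * (Cv * K))" by (simp add: mult.assoc)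
    qed
  qed (use pm mm iu in auto)
  have i2: "integrable unit_measure (\<lambda>s. prod (u s) (v' s))"
  proof (rule Bochner_Integration.integrable_bound)
    show "integrable unit_measure (\<lambda>s. norm (v' s) * (Cu * K))" using iv by auto
    show "AE s in unit_measure. norm (prod (u s) (v' s)) \<le> norm (norm (v' s) * (Cu * K))"
    proof (rule AE_I2)
      fix s assume s: "s \<in> space unit_measure"
      have "norm (prod (u s) (v' s)) \<le> norm (u s) * norm (v' s) * K" by (rule K)
      also have "\<dots> \<le> Cu * norm (v' s) * K" using Cu[of s] s K(2) by (intro mult_mono mult_left_mono mult_right_mono) auto
      finally show "norm (prod (u s) (v' s)) \<le> norm (norm (v' s) * (Cu * K))" by (simp add: algebra_simps)
    qed
  qed (use pm mm iv in auto)
  show ?thesis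
    unfolding has_AC_derivative_def
  proof (intro conjI ballI)
    show "integrable unit_measure (\<lambda>s. prod (u' s) (v s) + prod (u s) (v' s))" using i1 i2 by simp
    fix b :: real assume b: "b \<in> {0..1}"
    note sub = integrable_lebesgue_on_subinterval[OF _ b]
    have sub01: "s \<in> {0..1}" if "s \<in> {0..b}" for s using that b by auto
    show "prod (u b) (v b) = prod (u 0) (v 0) + (LINT s|lebesgue_on {0..b}. prod (u' s) (v s) + prod (u s) (v' s))"
      unfolding Bochner_Integration.integral_add[OF sub[OF i1] sub[OF i2]]
    proof (rule integral_by_parts_AC[OF assms(1) _ sub[OF iu] sub[OF iv]])
      show "0 \<le> b" using b by simp
    qed (rule has_AC_derivativeD(2)[OF assms(2) sub01] has_AC_derivativeD(2)[OF assms(3) sub01]; assumption)+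
  qed
qed

lemma has_AC_derivative_linear:
  fixes u :: "real \<Rightarrow> 'a::euclidean_space" and L :: "'a \<Rightarrow> 'b::euclidean_space"
  assumes "bounded_linear L" "has_AC_derivative u u'"
  shows "has_AC_derivative (\<lambda>s. L (u s)) (\<lambda>s. L (u' s))"
  unfolding has_AC_derivative_def
proof (intro conjI ballI)
  have i: "integrable unit_measure u'" using assms has_AC_derivativeD(1) by blast
  show "integrable unit_measure (\<lambda>s. L (u' s))" by (rule integrable_bounded_linear[OF assms(1) i])
  fix s :: real assume s: "s \<in> {0..1}"
  interpret bounded_linear L by fact
  have "L (u s) = L (u 0 + (LINT r|lebesgue_on {0..s}. u' r))" using has_AC_derivativeD(2)[OF assms(2) s] by simp
  then show "L (u s) = L (u 0) + (LINT r|lebesgue_on {0..s}. L (u' r))"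
    by (simp add: add integral_bounded_linear[OF assms(1) integrable_lebesgue_on_subinterval[OF i s]])
qed

lemma C1_imp_has_AC_derivative:
  fixes u :: "real \<Rightarrow> 'a::euclidean_space"
  assumes "continuous_on {0..1} u'"
    and "\<And>s. s \<in> {0..1} \<Longrightarrow> (u has_vector_derivative u' s) (at s within {0..1})"
  shows "has_AC_derivative u u'"
  unfolding has_AC_derivative_def
proof (intro conjI ballI)
  show i: "integrable unit_measure u'"
    by (rule continuous_imp_integrable_real[OF assms(1)])
  fix s :: real assume s: "s \<in> {0..1}"
  have "(u' has_integral (u s - u 0)) {0..s}"
    by (rule fundamental_theorem_of_calculus)
       (use s in \<open>auto intro!: has_vector_derivative_within_subset[OF assms(2)]\<close>)
  then show "u s = u 0 + (LINT r|lebesgue_on {0..s}. u' r)"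
    using lebesgue_integral_eq_integral[OF integrable_lebesgue_on_subinterval[OF i s]]
    by (auto simp: has_integral_iff)
qed

section \<open>Strongly continuous semigroups on a Banach space\<close>

text \<open>Baire category: the closed sets on which all \<open>F n\<close> are bounded by
  \<open>m\<close> cover the space, so one of them contains a ball. Subtracting the centre moves the
  bound to a ball around 0, and scaling extends it to all vectors.\<close>

theorem uniform_boundedness_principle:
  fixes F :: "nat \<Rightarrow> 'a::banach \<Rightarrow> 'b::real_normed_vector"
  assumes lin: "\<And>n. bounded_linear (F n)" and bdd: "\<And>x. bounded (range (\<lambda>n. F n x))"
  shows "\<exists>M. \<forall>n x. norm (F n x) \<le> M * norm x"
proof -
  define E where "E m = {x. \<forall>n. norm (F n x) \<le> real m}" for m
  have clE: "closed (E m)" for m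
  proof -
    have "E m = (\<Inter>n. {x. norm (F n x) \<le> real m})" by (auto simp: E_def)
    moreover have "closed {x. norm (F n x) \<le> real m}" for n
      by (intro closed_Collect_le continuous_intros linear_continuous_on lin)
    ultimately show ?thesis by auto
  qed
  have cover: "(\<Union>m. E m) = UNIV"
  proof (intro equalityI subsetI UNIV_I)
    fix x
    obtain B where B: "\<And>n. norm (F n x) \<le> B" using bdd[of x] unfolding bounded_iff by auto
    obtain m :: nat where "B \<le> real m" using real_arch_simple by blast
    then have "x \<in> E m" using order_trans[OF B] by (auto simp: E_def)
    then show "x \<in> (\<Union>m. E m)" by blast
  qed
  have "\<exists>m. interior (E m) \<noteq> {}"
  proof (rule ccontr)
    assume "\<not> ?thesis"
    then have "Met_TC.mtopology interior_of (\<Union>(range E)) = {}"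
      using clE by (intro Met_TC.metric_Baire_category_alt) auto
    then show False using cover by simp
  qed
  then obtain m x0 r where r: "r > 0" and ball: "ball x0 r \<subseteq> E m"
    by (meson ex_in_conv mem_interior)
  have small: "norm (F n y) \<le> 2 * real m" if "norm y < r" for n y
  proof -
    interpret bounded_linear "F n" by (rule lin)
    have "x0 + y \<in> E m" "x0 \<in> E m" using ball r that by (auto simp: dist_norm)
    then have "norm (F n (x0 + y)) \<le> real m" "norm (F n x0) \<le> real m" by (auto simp: E_def)
    moreover have "F n y = F n (x0 + y) - F n x0" by (simp add: add)
    ultimately show ?thesis using norm_triangle_ineq4[of "F n (x0 + y)" "F n x0"] by simp
  qed
  have "norm (F n x) \<le> (4 * real m / r) * norm x" for n x
  proof (cases "x = 0")
    case True
    interpret bounded_linear "F n" by (rule lin)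
    show ?thesis using True by (simp add: zero)
  next
    case False
    interpret bounded_linear "F n" by (rule lin)
    \<comment> \<open>Rescales \<open>x\<close> to norm \<open>r / 2\<close>, strictly inside the
      ball. The bound \<open>2 m\<close> there becomes \<open>4 m / r\<close> times the
      norm.\<close>
    define c where "c = r / (2 * norm x)"
    have c: "c > 0" using False r by (simp add: c_def)
    have "norm (F n (c *\<^sub>R x)) \<le> 2 * real m" using False r by (intro small) (simp add: c_def)
    then have "c * norm (F n x) \<le> 2 * real m" using c by (simp add: scaleR)
    then show ?thesis using False r by (simp add: c_def field_simps)
  qed
  then show ?thesis by blast
qed

locale banach_C0_semigroup =
  fixes U :: "real \<Rightarrow> 'a::banach \<Rightarrow> 'a"
  assumes bounded_linear_U: "0 \<le> t \<Longrightarrow> bounded_linear (U t)"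
    and U_zero: "U 0 x = x"
    and U_add: "0 \<le> s \<Longrightarrow> 0 \<le> t \<Longrightarrow> U (s + t) x = U s (U t x)"
    and U_tendsto: "((\<lambda>t. U t x) \<longlongrightarrow> x) (at_right 0)"
begin

text \<open>If no bound held near 0, there would be times \<open>h n\<close> tending to 0 along
  which the operator norms exceed every multiple. Strong continuity at 0 keeps every orbit bounded
  along these times, which contradicts uniform boundedness.\<close>

lemma U_bounded_near_zero: "\<exists>M\<ge>1. \<exists>d>0. \<forall>h\<in>{0..d}. \<forall>x. norm (U h x) \<le> M * norm x"
proof (rule ccontr)
  assume contra: "\<not> ?thesis"
  have "\<exists>h\<in>{0..1 / real (Suc n)}. \<exists>x. norm (U h x) > real (Suc n) * norm x" for n
  proof (rule ccontr)
    assume "\<not> (\<exists>h\<in>{0..1 / real (Suc n)}. \<exists>x. norm (U h x) > real (Suc n) * norm x)"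
    then have "\<forall>h\<in>{0..1 / real (Suc n)}. \<forall>x. norm (U h x) \<le> real (Suc n) * norm x" by (meson not_le)
    moreover have "real (Suc n) \<ge> 1" "1 / real (Suc n) > 0" by auto
    ultimately show False using contra by blast
  qed
  then obtain h x where h: "\<And>n. h n \<in> {0..1 / real (Suc n)}" and x: "\<And>n. norm (U (h n) (x n)) > real (Suc n) * norm (x n)"
    by metis
  have "bounded (range (\<lambda>n. U (h n) y))" for y
  proof -
    obtain b where b: "b > 0" "\<And>t. 0 < t \<Longrightarrow> t < b \<Longrightarrow> dist (U t y) y < 1"
      using tendstoD[OF U_tendsto[of y], of 1] by (auto simp: eventually_at_right_field)
    obtain N where N: "1 / real (Suc N) < b" using b(1) nat_approx_posE by blast
    have "norm (U (h n) y) \<le> norm y + 1" if "n \<ge> N" for n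
    proof -
      have "h n \<le> 1 / real (Suc n)" "0 \<le> h n" using h[of n] by auto
      moreover have "1 / real (Suc n) \<le> 1 / real (Suc N)" using that by (simp add: field_simps)
      \<comment> \<open>The right limit at 0 says nothing about \<open>h n = 0\<close>; there the
        distance is 0 by \<open>U_zero\<close>.\<close>
      ultimately have "dist (U (h n) y) y < 1" using b N by (cases "h n = 0") (auto simp: U_zero)
      then show ?thesis using norm_triangle_sub[of "U (h n) y" y] by (simp add: dist_norm)
    qed
    then have "bounded ((\<lambda>n. U (h n) y) ` {N..})" unfolding bounded_iff by auto
    moreover have "bounded ((\<lambda>n. U (h n) y) ` {..<N})" by (simp add: finite_imp_bounded)
    moreover have "range (\<lambda>n. U (h n) y) = (\<lambda>n. U (h n) y) ` {N..} \<union> (\<lambda>n. U (h n) y) ` {..<N}"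
      by (auto simp: image_Un[symmetric] intro!: arg_cong[where f="image _"])
    ultimately show ?thesis by simp
  qed
  then obtain M where M: "\<And>n y. norm (U (h n) y) \<le> M * norm y"
    using uniform_boundedness_principle[of "\<lambda>n. U (h n)"] bounded_linear_U h by (metis atLeastAtMost_iff)
  obtain n :: nat where "M \<le> real n" using real_arch_simple by blast
  then have "M * norm (x n) \<le> real (Suc n) * norm (x n)" by (intro mult_right_mono) auto
  then show False using M[of n "x n"] x[of n] by linarith
qed

text \<open>Peels off steps of length \<open>d\<close> by the semigroup law: a time up to
  \<open>Suc n * d\<close> costs at most \<open>Suc n\<close> factors \<open>M\<close>. As
  \<open>M \<ge> 1\<close>, the highest power also serves for shorter times.\<close>

lemma U_locally_bounded: "\<exists>M\<ge>0. \<forall>t\<in>{0..b}. \<forall>x. norm (U t x) \<le> M * norm x"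
proof -
  obtain M d where M: "M \<ge> 1" and d: "d > 0" and bd: "\<And>h x. h \<in> {0..d} \<Longrightarrow> norm (U h x) \<le> M * norm x"
    using U_bounded_near_zero by blast
  have iter: "norm (U t x) \<le> M ^ Suc n * norm x" if "t \<in> {0..real (Suc n) * d}" for n t x
    using that
  proof (induction n arbitrary: t)
    case 0
    then show ?case using bd by simp
  next
    case (Suc n)
    show ?case
    proof (cases "t \<le> d")
      case True
      then have "norm (U t x) \<le> M * norm x" using bd Suc.prems by auto
      also have "\<dots> \<le> M ^ Suc (Suc n) * norm x"
        using power_increasing[of 1 "Suc (Suc n)" M] M by (intro mult_right_mono) auto
      finally show ?thesis .
    next
      case False
      then have t: "t - d \<in> {0..real (Suc n) * d}" using Suc.prems by (auto simp: algebra_simps)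
      have "U t x = U d (U (t - d) x)" using U_add[of d "t - d"] d False by simp
      then have "norm (U t x) \<le> M * norm (U (t - d) x)" using bd[of d] d by simp
      also have "\<dots> \<le> M * (M ^ Suc n * norm x)" using Suc.IH[OF t] M by (intro mult_left_mono) auto
      finally show ?thesis by (simp add: mult.assoc)
    qed
  qed
  obtain n :: nat where "b / d \<le> real n" using real_arch_simple by blast
  then have "b \<le> real (Suc n) * d" using d by (simp add: field_simps)
  then have "\<forall>t\<in>{0..b}. \<forall>x. norm (U t x) \<le> M ^ Suc n * norm x" using iter[of _ n] by auto
  moreover have "M ^ Suc n \<ge> 0" using M by simp
  ultimately show ?thesis by blast
qed

text \<open>Factoring out the earlier of the two times reduces increments to the left and to the
  right of \<open>t\<close> to an increment at time 0, the only place where the axioms give a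
  limit.\<close>

lemma U_min_diff:
  assumes "0 \<le> s" "0 \<le> t"
  shows "U (max s t) x - U (min s t) x = U (min s t) (U \<bar>s - t\<bar> x - x)"
proof -
  interpret bounded_linear "U (min s t)" using assms by (intro bounded_linear_U) auto
  have "max s t = min s t + \<bar>s - t\<bar>" by auto
  then show ?thesis using U_add[of "min s t" "\<bar>s - t\<bar>" x] assms by (simp add: diff)
qed

lemma tendsto_abs_diff_at_right:
  "filterlim (\<lambda>s. \<bar>s - t\<bar>) (at_right 0) (at t within S)" for t :: real
proof -
  have "((\<lambda>s. \<bar>s - t\<bar>) \<longlongrightarrow> \<bar>t - t\<bar>) (at t within S)" by (intro tendsto_intros)
  then show ?thesis
    by (auto simp: filterlim_at eventually_at_filter)
qed

lemma U_continuous: "continuous_on {0..} (\<lambda>t. U t x)"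
  unfolding continuous_on_def
proof
  fix t :: real assume "t \<in> {0..}"
  then have t: "0 \<le> t" by simp
  obtain M where M: "M \<ge> 0" "\<And>s x. s \<in> {0..t + 1} \<Longrightarrow> norm (U s x) \<le> M * norm x"
    using U_locally_bounded by blast
  have lim: "((\<lambda>s. M * norm (U \<bar>s - t\<bar> x - x)) \<longlongrightarrow> M * norm (x - x)) (at t within {0..})"
    by (intro tendsto_intros filterlim_compose[OF U_tendsto tendsto_abs_diff_at_right])
  have ev: "\<forall>\<^sub>F s in at t within {0..}. norm (U s x - U t x) \<le> M * norm (U \<bar>s - t\<bar> x - x)"
    unfolding eventually_at
  proof (intro exI[of _ 1] conjI ballI impI)
    fix s assume "s \<in> {0..}" "s \<noteq> t \<and> dist s t < 1"
    then have s: "0 \<le> s" "min s t \<in> {0..t + 1}" using t by (auto simp: dist_real_def)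
    have "norm (U s x - U t x) = norm (U (max s t) x - U (min s t) x)"
      by (cases "s \<le> t") (auto simp: max_def min_def norm_minus_commute)
    then show "norm (U s x - U t x) \<le> M * norm (U \<bar>s - t\<bar> x - x)"
      using U_min_diff[OF s(1) t] M(2)[OF s(2)] by simp
  qed simp
  have "((\<lambda>s. U s x - U t x) \<longlongrightarrow> 0) (at t within {0..})"
    using Lim_null_comparison[OF ev] lim by simp
  then show "((\<lambda>s. U s x) \<longlongrightarrow> U t x) (at t within {0..})" by (rule LIM_zero_cancel)
qed

text \<open>The generator only provides a right derivative at 0. The left quotient at
  \<open>t\<close> is \<open>U (min s t)\<close> applied to a forward quotient at 0; it converges
  because these operators are uniformly bounded near \<open>t\<close> and
  \<open>U (min s t) z\<close> tends to \<open>U t z\<close>.\<close>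

lemma U_has_vector_derivative:
  assumes z: "((\<lambda>h. (1 / h) *\<^sub>R (U h x - x)) \<longlongrightarrow> z) (at_right 0)" and t: "0 \<le> t"
  shows "((\<lambda>t. U t x) has_vector_derivative U t z) (at t within {0..})"
proof -
  let ?D = "\<lambda>h. (1 / h) *\<^sub>R (U h x - x)"
  obtain M where M: "M \<ge> 0" "\<And>s x. s \<in> {0..t + 1} \<Longrightarrow> norm (U s x) \<le> M * norm x"
    using U_locally_bounded by blast
  have "((\<lambda>s. min s t) \<longlongrightarrow> min t t) (at t within {0..})" by (intro tendsto_min tendsto_ident_at tendsto_const)
  then have "((\<lambda>s. U (min s t) z) \<longlongrightarrow> U (min t t) z) (at t within {0..})"
    by (rule continuous_on_tendsto_compose[OF U_continuous]) (use t in \<open>auto simp: eventually_at_filter\<close>)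
  then have "((\<lambda>s. M * norm (?D \<bar>s - t\<bar> - z) + norm (U (min s t) z - U t z)) \<longlongrightarrow> M * norm (z - z) + norm (U t z - U t z)) (at t within {0..})"
    by (intro tendsto_intros filterlim_compose[OF z tendsto_abs_diff_at_right]) simp
  then have lim: "((\<lambda>s. M * norm (?D \<bar>s - t\<bar> - z) + norm (U (min s t) z - U t z)) \<longlongrightarrow> 0) (at t within {0..})"
    by simp
  have ev: "\<forall>\<^sub>F s in at t within {0..}.
      norm ((1 / norm (s - t)) *\<^sub>R (U s x - (U t x + (s - t) *\<^sub>R U t z))) \<le>
      M * norm (?D \<bar>s - t\<bar> - z) + norm (U (min s t) z - U t z)"
    unfolding eventually_at
  proof (intro exI[of _ 1] conjI ballI impI)
    fix s assume "s \<in> {0..}" and st: "s \<noteq> t \<and> dist s t < 1"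
    then have s: "0 \<le> s" "min s t \<in> {0..t + 1}" using t by (auto simp: dist_real_def)
    interpret bounded_linear "U (min s t)" using s by (intro bounded_linear_U) auto
    have e: "(1 / norm (s - t)) *\<^sub>R (U (max s t) x - U (min s t) x) = U (min s t) (?D \<bar>s - t\<bar>)"
      unfolding U_min_diff[OF s(1) t] by (simp add: scaleR)
    \<comment> \<open>The sign restores the orientation lost by ordering the times, so that the
      cases \<open>s < t\<close> and \<open>s > t\<close> share the rest of the computation.\<close>
    have sg: "U s x - U t x = sgn (s - t) *\<^sub>R (U (max s t) x - U (min s t) x)"
      by (cases "s < t") (use st in \<open>auto simp: max_def min_def\<close>)
    have "(1 / norm (s - t)) *\<^sub>R (U s x - (U t x + (s - t) *\<^sub>R U t z)) =
        sgn (s - t) *\<^sub>R ((1 / norm (s - t)) *\<^sub>R (U (max s t) x - U (min s t) x)) - ((s - t) / norm (s - t)) *\<^sub>R U t z"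
      unfolding diff_diff_eq[symmetric] sg by (simp add: scaleR_diff_right ac_simps)
    also have "(s - t) / norm (s - t) = sgn (s - t)" by (simp add: sgn_div_norm divide_inverse mult.commute)
    finally have "(1 / norm (s - t)) *\<^sub>R (U s x - (U t x + (s - t) *\<^sub>R U t z)) =
        sgn (s - t) *\<^sub>R (U (min s t) (?D \<bar>s - t\<bar>) - U t z)"
      unfolding e by (simp add: scaleR_diff_right)
    then have "norm ((1 / norm (s - t)) *\<^sub>R (U s x - (U t x + (s - t) *\<^sub>R U t z))) = norm (U (min s t) (?D \<bar>s - t\<bar>) - U t z)"
      using st by (simp add: abs_sgn_eq)
    also have "U (min s t) (?D \<bar>s - t\<bar>) - U t z = U (min s t) (?D \<bar>s - t\<bar> - z) + (U (min s t) z - U t z)"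
      by (simp add: diff)
    also have "norm \<dots> \<le> M * norm (?D \<bar>s - t\<bar> - z) + norm (U (min s t) z - U t z)"
      using M(2)[OF s(2)] by (intro norm_triangle_le add_mono) auto
    finally show "norm ((1 / norm (s - t)) *\<^sub>R (U s x - (U t x + (s - t) *\<^sub>R U t z))) \<le>
      M * norm (?D \<bar>s - t\<bar> - z) + norm (U (min s t) z - U t z)" .
  qed simp
  show ?thesis
    unfolding has_vector_derivative_def has_derivative_within
    using Lim_null_comparison[OF ev lim] by (simp add: bounded_linear_scaleR_left)
qed

text \<open>\<open>U t\<close> is continuous and commutes with the difference quotient. This is the
  abstract form of the invariance of the generator's domain under the semigroup.\<close>

lemma U_invariant_derivative:
  assumes z: "((\<lambda>h. (1 / h) *\<^sub>R (U h x - x)) \<longlongrightarrow> z) (at_right 0)" and t: "0 \<le> t"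
  shows "((\<lambda>h. (1 / h) *\<^sub>R (U h (U t x) - U t x)) \<longlongrightarrow> U t z) (at_right 0)"
proof -
  interpret bounded_linear "U t" using t by (rule bounded_linear_U)
  have "((\<lambda>h. U t ((1 / h) *\<^sub>R (U h x - x))) \<longlongrightarrow> U t z) (at_right 0)"
    by (rule tendsto[OF z])
  moreover have "\<forall>\<^sub>F h in at_right 0. U t ((1 / h) *\<^sub>R (U h x - x)) = (1 / h) *\<^sub>R (U h (U t x) - U t x)"
    unfolding eventually_at_filter
  proof (intro always_eventually allI impI)
    fix h :: real assume "h \<in> {0<..}"
    then have h: "0 \<le> h" by simp
    have "U h (U t x) = U t (U h x)" using U_add[OF h t] U_add[OF t h] by (simp add: add.commute)
    then show "U t ((1 / h) *\<^sub>R (U h x - x)) = (1 / h) *\<^sub>R (U h (U t x) - U t x)"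
      by (simp add: scaleR diff)
  qed
  ultimately show ?thesis by (rule Lim_transform_eventually)
qed

end

section \<open>The Hilbert space of square integrable functions\<close>

lemma L2_iff: "x \<in> L2 \<longleftrightarrow> x \<in> borel_measurable unit_measure \<and> integrable unit_measure (\<lambda>\<zeta>. (norm (x \<zeta>))\<^sup>2)"
  by (simp add: L2_def)

lemma L2_borel_measurable: "x \<in> L2 \<Longrightarrow> x \<in> borel_measurable unit_measure"
  and L2_integrable_norm_sq: "x \<in> L2 \<Longrightarrow> integrable unit_measure (\<lambda>\<zeta>. (norm (x \<zeta>))\<^sup>2)"
  by (simp_all add: L2_iff)

lemma L2_bound:
  assumes "x \<in> L2" "y \<in> borel_measurable unit_measure" "AE \<zeta> in unit_measure. norm (y \<zeta>) \<le> C * norm (x \<zeta>)"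
  shows "y \<in> L2"
  unfolding L2_iff
proof
  show "integrable unit_measure (\<lambda>\<zeta>. (norm (y \<zeta>))\<^sup>2)"
  proof (rule Bochner_Integration.integrable_bound)
    show "integrable unit_measure (\<lambda>\<zeta>. C\<^sup>2 * (norm (x \<zeta>))\<^sup>2)" using L2_integrable_norm_sq[OF assms(1)] by simp
    show "AE \<zeta> in unit_measure. norm ((norm (y \<zeta>))\<^sup>2) \<le> norm (C\<^sup>2 * (norm (x \<zeta>))\<^sup>2)"
      using assms(3)
    proof eventually_elim
      case (elim \<zeta>)
      then have "(norm (y \<zeta>))\<^sup>2 \<le> (C * norm (x \<zeta>))\<^sup>2" by (intro power_mono) auto
      then show ?case by (simp add: power_mult_distrib)
    qed
  qed (use assms in measurable)
qed (rule assms)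

lemma L2_zero: "(\<lambda>_. 0) \<in> L2"
  by (simp add: L2_iff)

lemma L2_add:
  assumes "x \<in> L2" "y \<in> L2"
  shows "(\<lambda>\<zeta>. x \<zeta> + y \<zeta>) \<in> L2"
  unfolding L2_iff
proof
  note [measurable] = assms[THEN L2_borel_measurable]
  show "(\<lambda>\<zeta>. x \<zeta> + y \<zeta>) \<in> borel_measurable unit_measure" by measurable
  show "integrable unit_measure (\<lambda>\<zeta>. (norm (x \<zeta> + y \<zeta>))\<^sup>2)"
  proof (rule Bochner_Integration.integrable_bound)
    show "integrable unit_measure (\<lambda>\<zeta>. 2 * (norm (x \<zeta>))\<^sup>2 + 2 * (norm (y \<zeta>))\<^sup>2)"
      using assms[THEN L2_integrable_norm_sq] by simp
    have "(norm (x \<zeta> + y \<zeta>))\<^sup>2 \<le> 2 * (norm (x \<zeta>))\<^sup>2 + 2 * (norm (y \<zeta>))\<^sup>2" for \<zeta>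
    proof -
      have "(norm (x \<zeta> + y \<zeta>))\<^sup>2 \<le> (norm (x \<zeta>) + norm (y \<zeta>))\<^sup>2" by (intro power_mono norm_triangle_ineq) auto
      also have "\<dots> \<le> 2 * (norm (x \<zeta>))\<^sup>2 + 2 * (norm (y \<zeta>))\<^sup>2"
        using sum_squares_bound[of "norm (x \<zeta>)" "norm (y \<zeta>)"] by (simp add: power2_sum)
      finally show ?thesis .
    qed
    then show "AE \<zeta> in unit_measure. norm ((norm (x \<zeta> + y \<zeta>))\<^sup>2) \<le> norm (2 * (norm (x \<zeta>))\<^sup>2 + 2 * (norm (y \<zeta>))\<^sup>2)"
      by simp
  qed measurable
qed

lemma L2_scaleR: "x \<in> L2 \<Longrightarrow> (\<lambda>\<zeta>. c *\<^sub>R x \<zeta>) \<in> L2"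
  by (rule L2_bound[where C = "\<bar>c\<bar>"]) (auto dest: L2_borel_measurable)

lemma L2_uminus: "x \<in> L2 \<Longrightarrow> (\<lambda>\<zeta>. - x \<zeta>) \<in> L2"
  using L2_scaleR[of x "-1"] by simp

lemma L2_diff: "x \<in> L2 \<Longrightarrow> y \<in> L2 \<Longrightarrow> (\<lambda>\<zeta>. x \<zeta> - y \<zeta>) \<in> L2"
  using L2_add[OF _ L2_uminus] by simp

lemma L2_integrable_inner:
  assumes "x \<in> L2" "y \<in> L2"
  shows "integrable unit_measure (\<lambda>\<zeta>. inner (x \<zeta>) (y \<zeta>))"
proof (rule Bochner_Integration.integrable_bound)
  note [measurable] = assms[THEN L2_borel_measurable]
  show "integrable unit_measure (\<lambda>\<zeta>. (norm (x \<zeta>))\<^sup>2 + (norm (y \<zeta>))\<^sup>2)"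
    using assms[THEN L2_integrable_norm_sq] by simp
  have "\<bar>inner (x \<zeta>) (y \<zeta>)\<bar> \<le> (norm (x \<zeta>))\<^sup>2 + (norm (y \<zeta>))\<^sup>2" for \<zeta>
    using Cauchy_Schwarz_ineq2[of "x \<zeta>" "y \<zeta>"] sum_squares_bound[of "norm (x \<zeta>)" "norm (y \<zeta>)"]
      mult_nonneg_nonneg[OF norm_ge_zero norm_ge_zero, of "x \<zeta>" "y \<zeta>"] by linarith
  then show "AE \<zeta> in unit_measure. norm (inner (x \<zeta>) (y \<zeta>)) \<le> norm ((norm (x \<zeta>))\<^sup>2 + (norm (y \<zeta>))\<^sup>2)"
    by simp
  show "(\<lambda>\<zeta>. inner (x \<zeta>) (y \<zeta>)) \<in> borel_measurable unit_measure" by measurable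
qed

quotient_type 'n l2 = "real \<Rightarrow> complex^'n::finite" / partial:
  "\<lambda>x y. x \<in> L2 \<and> y \<in> L2 \<and> (AE \<zeta> in unit_measure. x \<zeta> = y \<zeta>)"
proof (rule part_equivpI)
  show "\<exists>x::real \<Rightarrow> complex^'n. x \<in> L2 \<and> x \<in> L2 \<and> (AE \<zeta> in unit_measure. x \<zeta> = x \<zeta>)"
    using L2_zero by auto
  show "symp (\<lambda>x y::real \<Rightarrow> complex^'n. x \<in> L2 \<and> y \<in> L2 \<and> (AE \<zeta> in unit_measure. x \<zeta> = y \<zeta>))"
    by (rule sympI) (auto elim: eventually_mono)
  show "transp (\<lambda>x y::real \<Rightarrow> complex^'n. x \<in> L2 \<and> y \<in> L2 \<and> (AE \<zeta> in unit_measure. x \<zeta> = y \<zeta>))"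
    by (rule transpI) (auto elim: eventually_elim2)
qed

lemma abs_l2_eq_iff:
  assumes "x \<in> L2" "y \<in> L2"
  shows "abs_l2 x = abs_l2 y \<longleftrightarrow> (AE \<zeta> in unit_measure. x \<zeta> = y \<zeta>)"
  using Quotient_rel[OF Quotient_l2, of x y] assms by auto

lemma rep_l2_L2: "rep_l2 u \<in> L2"
  using Quotient_rep_reflp[OF Quotient_l2, of u] by simp

lemma abs_rep_l2: "abs_l2 (rep_l2 u) = u"
  by (rule Quotient_abs_rep[OF Quotient_l2])

lemma rep_abs_l2:
  assumes "x \<in> L2"
  shows "AE \<zeta> in unit_measure. rep_l2 (abs_l2 x) \<zeta> = x \<zeta>"
  using abs_l2_eq_iff[OF rep_l2_L2[of "abs_l2 x"] assms] abs_rep_l2[of "abs_l2 x"] by simp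

lemma l2_cases: obtains x where "x \<in> L2" "u = abs_l2 x"
  using rep_l2_L2[of u] abs_rep_l2[of u] by metis

text \<open>The real structure suffices: \<open>inner\<close> on complex vectors is the real part of
  the Hermitian product, and the energy and the multiplier functional are real quadratic
  forms.\<close>

instantiation l2 :: (finite) real_inner
begin

lift_definition zero_l2 :: "'a l2" is "\<lambda>_. 0" by (simp add: L2_zero)
lift_definition plus_l2 :: "'a l2 \<Rightarrow> 'a l2 \<Rightarrow> 'a l2" is "\<lambda>x y \<zeta>. x \<zeta> + y \<zeta>"
  by (auto simp: L2_add elim: eventually_elim2)
lift_definition uminus_l2 :: "'a l2 \<Rightarrow> 'a l2" is "\<lambda>x \<zeta>. - x \<zeta>"
  by (auto simp: L2_uminus elim: eventually_mono)
lift_definition minus_l2 :: "'a l2 \<Rightarrow> 'a l2 \<Rightarrow> 'a l2" is "\<lambda>x y \<zeta>. x \<zeta> - y \<zeta>"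
  by (auto simp: L2_diff elim: eventually_elim2)
lift_definition scaleR_l2 :: "real \<Rightarrow> 'a l2 \<Rightarrow> 'a l2" is "\<lambda>c x \<zeta>. c *\<^sub>R x \<zeta>"
  by (auto simp: L2_scaleR elim: eventually_mono)
lift_definition inner_l2 :: "'a l2 \<Rightarrow> 'a l2 \<Rightarrow> real" is "\<lambda>x y. LINT \<zeta>|unit_measure. inner (x \<zeta>) (y \<zeta>)"
  by (rule integral_cong_AE)
     (auto intro!: borel_measurable_inner simp: L2_borel_measurable elim: eventually_elim2)

definition norm_l2 :: "'a l2 \<Rightarrow> real" where "norm_l2 u = sqrt (inner u u)"
definition dist_l2 :: "'a l2 \<Rightarrow> 'a l2 \<Rightarrow> real" where "dist_l2 u v = norm (u - v)"
definition sgn_l2 :: "'a l2 \<Rightarrow> 'a l2" where "sgn_l2 u = scaleR (inverse (norm u)) u"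
definition uniformity_l2 :: "('a l2 \<times> 'a l2) filter"
  where "uniformity_l2 = (INF e\<in>{0 <..}. principal {(x, y). dist x y < e})"
definition open_l2 :: "'a l2 set \<Rightarrow> bool"
  where "open_l2 S \<longleftrightarrow> (\<forall>x\<in>S. \<forall>\<^sub>F (x', y) in uniformity. x' = x \<longrightarrow> y \<in> S)"

instance
proof
  fix a b c :: "'a l2" and r s :: real
  show "a + b + c = a + (b + c)" "a + b = b + a" "0 + a = a" "- a + a = 0" "a - b = a + - b"
    "r *\<^sub>R (a + b) = r *\<^sub>R a + r *\<^sub>R b" "(r + s) *\<^sub>R a = r *\<^sub>R a + s *\<^sub>R a"
    "r *\<^sub>R s *\<^sub>R a = (r * s) *\<^sub>R a" "1 *\<^sub>R a = a"
    by (transfer; simp add: L2_add L2_zero L2_uminus L2_diff L2_scaleR algebra_simps; fail)+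
  show "inner a b = inner b a" by transfer (simp add: inner_commute)
  show "inner (a + b) c = inner a c + inner b c"
    by transfer (simp add: inner_add_left L2_integrable_inner)
  show "inner (r *\<^sub>R a) b = r * inner a b" by transfer simp
  show "0 \<le> inner a a" by transfer simp
  show "(inner a a = 0) = (a = 0)"
  proof transfer
    fix a :: "real \<Rightarrow> complex^'a"
    assume a: "a \<in> L2 \<and> a \<in> L2 \<and> (AE \<zeta> in unit_measure. a \<zeta> = a \<zeta>)"
    then have "((LINT \<zeta>|unit_measure. inner (a \<zeta>) (a \<zeta>)) = 0) = (AE \<zeta> in unit_measure. inner (a \<zeta>) (a \<zeta>) = 0)"
      by (intro integral_nonneg_eq_0_iff_AE L2_integrable_inner) auto
    then show "((LINT \<zeta>|unit_measure. inner (a \<zeta>) (a \<zeta>)) = 0) = (a \<in> L2 \<and> (\<lambda>_. 0) \<in> L2 \<and> (AE \<zeta> in unit_measure. a \<zeta> = 0))"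
      using a by (simp add: L2_zero)
  qed
qed (fact norm_l2_def dist_l2_def sgn_l2_def uniformity_l2_def open_l2_def)+

end

lemma abs_l2_add: "x \<in> L2 \<Longrightarrow> y \<in> L2 \<Longrightarrow> abs_l2 x + abs_l2 y = abs_l2 (\<lambda>\<zeta>. x \<zeta> + y \<zeta>)"
  by (rule plus_l2.abs_eq) auto

lemma abs_l2_diff: "x \<in> L2 \<Longrightarrow> y \<in> L2 \<Longrightarrow> abs_l2 x - abs_l2 y = abs_l2 (\<lambda>\<zeta>. x \<zeta> - y \<zeta>)"
  by (rule minus_l2.abs_eq) auto

lemma abs_l2_scaleR: "x \<in> L2 \<Longrightarrow> c *\<^sub>R abs_l2 x = abs_l2 (\<lambda>\<zeta>. c *\<^sub>R x \<zeta>)"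
  by (rule scaleR_l2.abs_eq) auto

lemma inner_abs_l2: "x \<in> L2 \<Longrightarrow> y \<in> L2 \<Longrightarrow> inner (abs_l2 x) (abs_l2 y) = (LINT \<zeta>|unit_measure. inner (x \<zeta>) (y \<zeta>))"
  by (rule inner_l2.abs_eq) auto

lemma norm_abs_l2_sq: "x \<in> L2 \<Longrightarrow> (norm (abs_l2 x))\<^sup>2 = (LINT \<zeta>|unit_measure. (norm (x \<zeta>))\<^sup>2)"
  by (simp add: power2_norm_eq_inner inner_abs_l2)

lemma nn_integral_norm_sq_L2:
  "x \<in> L2 \<Longrightarrow> (\<integral>\<^sup>+\<zeta>. ennreal ((norm (x \<zeta>))\<^sup>2) \<partial>unit_measure) = ennreal ((norm (abs_l2 x))\<^sup>2)"
  by (simp add: norm_abs_l2_sq nn_integral_eq_integral L2_integrable_norm_sq)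

section \<open>Completeness of the space of classes (Riesz-Fischer)\<close>

lemma L2_I_nn_integral:
  assumes "x \<in> borel_measurable unit_measure" "(\<integral>\<^sup>+\<zeta>. ennreal ((norm (x \<zeta>))\<^sup>2) \<partial>unit_measure) \<le> ennreal B"
  shows "x \<in> L2"
  unfolding L2_iff
proof
  note [measurable] = assms(1)
  show "integrable unit_measure (\<lambda>\<zeta>. (norm (x \<zeta>))\<^sup>2)"
    by (rule integrableI_bounded) (use assms(2) in \<open>auto simp: top.extremum_strict intro: le_less_trans\<close>)
qed (rule assms)

text \<open>Square integrability of the increments \<open>u k\<close> does not by itself give
  pointwise absolute summability. The weight \<open>2 ^ k\<close> repairs this: the integrals
  \<open>2 ^ k * (1/4) ^ k\<close> are still summable, so the weighted sum of squares is finite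
  almost everywhere and dominates the norms up to a geometric series.\<close>

lemma fast_Cauchy_AE_convergent:
  fixes f :: "nat \<Rightarrow> real \<Rightarrow> complex^'n"
  assumes f: "\<And>k. f k \<in> L2" and fast: "\<And>k. norm (abs_l2 (f (Suc k)) - abs_l2 (f k)) \<le> (1/2) ^ k"
  shows "AE \<zeta> in unit_measure. convergent (\<lambda>k. f k \<zeta>)"
proof -
  note [measurable] = f[THEN L2_borel_measurable]
  define u where "u k = (\<lambda>\<zeta>. f (Suc k) \<zeta> - f k \<zeta>)" for k
  have u: "u k \<in> L2" for k unfolding u_def by (rule L2_diff[OF f f])
  note [measurable] = u[THEN L2_borel_measurable]
  have un: "(norm (abs_l2 (u k)))\<^sup>2 \<le> (1/4) ^ k" for k
  proof -
    have "norm (abs_l2 (u k)) \<le> (1/2) ^ k" using fast[of k] by (simp add: abs_l2_diff f u_def)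
    then have "(norm (abs_l2 (u k)))\<^sup>2 \<le> ((1/2) ^ k)\<^sup>2" by (intro power_mono) auto
    then show ?thesis by (simp add: power2_eq_square power_mult_distrib[symmetric])
  qed
  have "(\<integral>\<^sup>+\<zeta>. (\<Sum>k. ennreal (2 ^ k * (norm (u k \<zeta>))\<^sup>2)) \<partial>unit_measure)
      = (\<Sum>k. \<integral>\<^sup>+\<zeta>. ennreal (2 ^ k * (norm (u k \<zeta>))\<^sup>2) \<partial>unit_measure)"
    by (rule nn_integral_suminf) measurable
  also have "\<dots> \<le> (\<Sum>k. ennreal ((1/2) ^ k))"
  proof (intro suminf_le summableI)
    fix k
    have "(\<integral>\<^sup>+\<zeta>. ennreal (2 ^ k * (norm (u k \<zeta>))\<^sup>2) \<partial>unit_measure) = ennreal (2 ^ k) * ennreal ((norm (abs_l2 (u k)))\<^sup>2)"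
      by (simp add: ennreal_mult nn_integral_cmult nn_integral_norm_sq_L2[OF u])
    also have "\<dots> \<le> ennreal (2 ^ k) * ennreal ((1/4) ^ k)" by (intro mult_left_mono ennreal_leI un) auto
    also have "\<dots> = ennreal ((1/2) ^ k)" by (simp add: ennreal_mult[symmetric] power_mult_distrib[symmetric])
    finally show "(\<integral>\<^sup>+\<zeta>. ennreal (2 ^ k * (norm (u k \<zeta>))\<^sup>2) \<partial>unit_measure) \<le> ennreal ((1/2) ^ k)" .
  qed
  also have "\<dots> = ennreal (\<Sum>k. (1/2) ^ k)" by (rule suminf_ennreal2) (auto simp: summable_geometric)
  also have "\<dots> < \<infinity>" by simp
  finally have "(\<integral>\<^sup>+\<zeta>. (\<Sum>k. ennreal (2 ^ k * (norm (u k \<zeta>))\<^sup>2)) \<partial>unit_measure) \<noteq> \<infinity>" by simp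
  then have "AE \<zeta> in unit_measure. (\<Sum>k. ennreal (2 ^ k * (norm (u k \<zeta>))\<^sup>2)) \<noteq> \<infinity>"
    by (intro nn_integral_PInf_AE) measurable
  then show ?thesis
  proof eventually_elim
    case (elim \<zeta>)
    have s1: "summable (\<lambda>k. 2 ^ k * (norm (u k \<zeta>))\<^sup>2)"
      by (rule summable_suminf_not_top) (use elim in \<open>auto simp: infinity_ennreal_def\<close>)
    have "summable (\<lambda>k. norm (u k \<zeta>))"
    proof (rule summable_comparison_test')
      show "summable (\<lambda>k. (1/2) ^ k + 2 ^ k * (norm (u k \<zeta>))\<^sup>2 :: real)"
        by (intro summable_add s1) (simp add: summable_geometric)
      fix k :: nat
      define a :: real where "a = 2 ^ k"
      have a: "a > 0" by (simp add: a_def)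
      define n where "n = norm (u k \<zeta>)"
      \<comment> \<open>Arithmetic-geometric mean inequality with weight \<open>a = 2 ^ k\<close>;
        it trades the norm for its weighted square plus \<open>1 / a\<close>.\<close>
      have "0 \<le> (1 - a * n)\<^sup>2" by simp
      then have "2 * (a * n) \<le> 1 + a * (a * n\<^sup>2)" by (simp add: power2_eq_square algebra_simps)
      then have "2 * n \<le> 1 / a + a * n\<^sup>2" using a by (simp add: field_simps power2_eq_square)
      moreover have "n \<ge> 0" by (simp add: n_def)
      ultimately have "n \<le> 1 / a + a * n\<^sup>2" by linarith
      then show "norm (norm (u k \<zeta>)) \<le> (1/2) ^ k + 2 ^ k * (norm (u k \<zeta>))\<^sup>2"
        by (simp add: a_def n_def power_one_over)
    qed
    then have "summable (\<lambda>k. u k \<zeta>)" by (rule summable_norm_cancel)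
    then have "convergent (\<lambda>n. f 0 \<zeta> + (\<Sum>k<n. u k \<zeta>))"
      by (intro convergent_add) (auto simp: summable_iff_convergent convergent_const)
    moreover have "f 0 \<zeta> + (\<Sum>k<n. u k \<zeta>) = f n \<zeta>" for n
      unfolding u_def by (induction n) (simp_all add: add.assoc[symmetric])
    ultimately show ?case by simp
  qed
qed

text \<open>A rapidly converging subsequence has a pointwise limit almost everywhere. Fatou's lemma
  bounds the distance of that limit to the subsequence, which gives both its membership in
  \<open>L2\<close> and convergence in norm.\<close>

instance l2 :: (finite) banach
proof
  fix X :: "nat \<Rightarrow> 'a l2"
  assume C: "Cauchy X"
  have "\<exists>N. \<forall>m\<ge>N. \<forall>n\<ge>N. norm (X m - X n) < (1/2) ^ k" for k :: nat
    using CauchyD[OF C, of "(1/2) ^ k"] by auto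
  then obtain N where N: "\<And>k m n. m \<ge> N k \<Longrightarrow> n \<ge> N k \<Longrightarrow> norm (X m - X n) < (1/2) ^ k" by metis
  \<comment> \<open>The sum of the thresholds lies beyond each of \<open>N 0, ..., N k\<close>, so
    that consecutive indices of the subsequence satisfy the same estimate.\<close>
  define r where "r k = (\<Sum>i\<le>k. N i)" for k :: nat
  have rN: "r m \<ge> N k" if "m \<ge> k" for m k
    unfolding r_def using that by (intro member_le_sum) auto
  define f where "f k = rep_l2 (X (r k))" for k
  have f: "f k \<in> L2" and af: "abs_l2 (f k) = X (r k)" for k by (auto simp: f_def rep_l2_L2 abs_rep_l2)
  note fm [measurable] = f[THEN L2_borel_measurable]
  have conv: "AE \<zeta> in unit_measure. convergent (\<lambda>k. f k \<zeta>)"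
    by (rule fast_Cauchy_AE_convergent[OF f]) (use N rN in \<open>auto simp: af less_imp_le\<close>)
  define g where "g \<zeta> = lim (\<lambda>k. f k \<zeta>)" for \<zeta>
  have [measurable]: "g \<in> borel_measurable unit_measure" unfolding g_def by measurable
  have gf: "(\<integral>\<^sup>+\<zeta>. ennreal ((norm (g \<zeta> - f k \<zeta>))\<^sup>2) \<partial>unit_measure) \<le> ennreal (((1/2) ^ k)\<^sup>2)" for k
  proof -
    have "(\<integral>\<^sup>+\<zeta>. ennreal ((norm (g \<zeta> - f k \<zeta>))\<^sup>2) \<partial>unit_measure)
        = (\<integral>\<^sup>+\<zeta>. liminf (\<lambda>m. ennreal ((norm (f m \<zeta> - f k \<zeta>))\<^sup>2)) \<partial>unit_measure)"
    proof (rule nn_integral_cong_AE)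
      show "AE \<zeta> in unit_measure. ennreal ((norm (g \<zeta> - f k \<zeta>))\<^sup>2) = liminf (\<lambda>m. ennreal ((norm (f m \<zeta> - f k \<zeta>))\<^sup>2))"
        using conv
      proof eventually_elim
        case (elim \<zeta>)
        then have "(\<lambda>m. f m \<zeta>) \<longlonglongrightarrow> g \<zeta>" by (simp add: g_def convergent_LIMSEQ_iff)
        then have "(\<lambda>m. ennreal ((norm (f m \<zeta> - f k \<zeta>))\<^sup>2)) \<longlonglongrightarrow> ennreal ((norm (g \<zeta> - f k \<zeta>))\<^sup>2)"
          by (intro tendsto_ennrealI tendsto_intros)
        then show ?case by (rule lim_imp_Liminf[OF sequentially_bot, symmetric])
      qed
    qed
    also have "\<dots> \<le> liminf (\<lambda>m. \<integral>\<^sup>+\<zeta>. ennreal ((norm (f m \<zeta> - f k \<zeta>))\<^sup>2) \<partial>unit_measure)"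
      by (rule nn_integral_liminf) measurable
    also have "\<dots> \<le> liminf (\<lambda>m::nat. ennreal (((1/2) ^ k)\<^sup>2))"
    proof (rule Liminf_mono, rule eventually_sequentiallyI[of k])
      fix m assume "k \<le> m"
      then have "norm (abs_l2 (\<lambda>\<zeta>. f m \<zeta> - f k \<zeta>)) \<le> (1/2) ^ k"
        using N[of k "r m" "r k"] rN by (simp add: abs_l2_diff[symmetric] f af less_imp_le)
      then have "(norm (abs_l2 (\<lambda>\<zeta>. f m \<zeta> - f k \<zeta>)))\<^sup>2 \<le> ((1/2) ^ k)\<^sup>2" by (intro power_mono) auto
      then show "(\<integral>\<^sup>+\<zeta>. ennreal ((norm (f m \<zeta> - f k \<zeta>))\<^sup>2) \<partial>unit_measure) \<le> ennreal (((1/2) ^ k)\<^sup>2)"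
        unfolding nn_integral_norm_sq_L2[OF L2_diff[OF f f]] by (rule ennreal_leI)
    qed
    also have "\<dots> = ennreal (((1/2) ^ k)\<^sup>2)" by (simp add: Liminf_const)
    finally show ?thesis .
  qed
  have gfL: "(\<lambda>\<zeta>. g \<zeta> - f k \<zeta>) \<in> L2" for k by (rule L2_I_nn_integral[OF _ gf]) measurable
  have g: "g \<in> L2" using L2_add[OF gfL[of 0] f[of 0]] by simp
  have close: "norm (abs_l2 g - X (r k)) \<le> (1/2) ^ k" for k
  proof -
    have "(norm (abs_l2 (\<lambda>\<zeta>. g \<zeta> - f k \<zeta>)))\<^sup>2 \<le> ((1/2) ^ k)\<^sup>2"
      using gf[of k] unfolding nn_integral_norm_sq_L2[OF gfL] by (simp add: ennreal_le_iff)
    then have "norm (abs_l2 (\<lambda>\<zeta>. g \<zeta> - f k \<zeta>)) \<le> (1/2) ^ k" by (rule power2_le_imp_le) simp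
    then show ?thesis by (simp add: abs_l2_diff[symmetric] g f af)
  qed
  have "X \<longlonglongrightarrow> abs_l2 g"
  proof (rule LIMSEQ_I)
    fix e :: real assume "0 < e"
    then obtain k where k: "(1/2) ^ k < e / 2" using real_arch_pow_inv[of "e/2" "1/2"] by auto
    have "norm (X n - abs_l2 g) < e" if "n \<ge> N k" for n
    proof -
      have "norm (X n - abs_l2 g) \<le> norm (X n - X (r k)) + norm (abs_l2 g - X (r k))"
        using norm_triangle_ineq4[of "X n - X (r k)" "abs_l2 g - X (r k)"] by simp
      then show ?thesis using N[OF that rN[OF order_refl]] close[of k] k by linarith
    qed
    then show "\<exists>no. \<forall>n\<ge>no. norm (X n - abs_l2 g) < e" by blast
  qed
  then show "convergent X" by (auto simp: convergent_def)
qed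

section \<open>Complex matrices acting on a real inner product space\<close>

lemma bounded_bilinear_matrix_vector_mult:
  "bounded_bilinear (\<lambda>(A::complex^'n^'m) x. A *v x)"
proof -
  have "linear (\<lambda>x. A *v x)" for A :: "complex^'n^'m"
    by (rule linearI) (simp_all add: vec_eq_iff matrix_vector_mult_def scaleR_sum_right sum.distrib distrib_left)
  moreover have "linear (\<lambda>A::complex^'n^'m. A *v x)" for x
    by (rule linearI) (simp_all add: vec_eq_iff matrix_vector_mult_def scaleR_sum_right sum.distrib distrib_right)
  ultimately show ?thesis
    unfolding bilinear_conv_bounded_bilinear[symmetric] bilinear_def by blast
qed

lemma bounded_bilinear_matrix_mult:
  "bounded_bilinear (\<lambda>(A::complex^'n^'m) (B::complex^'k^'n). A ** B)"
proof -
  have "linear (\<lambda>B::complex^'k^'n. A ** B)" for A :: "complex^'n^'m"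
    by (rule linearI) (simp_all add: vec_eq_iff matrix_matrix_mult_def scaleR_sum_right sum.distrib distrib_left)
  moreover have "linear (\<lambda>A::complex^'n^'m. A ** B)" for B :: "complex^'k^'n"
    by (rule linearI) (simp_all add: vec_eq_iff matrix_matrix_mult_def scaleR_sum_right sum.distrib distrib_right)
  ultimately show ?thesis
    unfolding bilinear_conv_bounded_bilinear[symmetric] bilinear_def by blast
qed

lemmas bounded_linear_matrix_vector_mult = bounded_bilinear.bounded_linear_right[OF bounded_bilinear_matrix_vector_mult]

lemma matrix_vector_mult_scaleR_left: "(c *\<^sub>R A) *v x = c *\<^sub>R (A *v x)" for A :: "complex^'n^'m"
  by (rule bounded_bilinear.scaleR_left[OF bounded_bilinear_matrix_vector_mult])

lemma matrix_vector_mult_scaleR_right: "A *v (c *\<^sub>R x) = c *\<^sub>R (A *v x)" for A :: "complex^'n^'m"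
  by (rule bounded_bilinear.scaleR_right[OF bounded_bilinear_matrix_vector_mult])

lemma norm_matrix_vector_mult_le:
  obtains K where "K > 0" "\<And>(A::complex^'n^'m) x. norm (A *v x) \<le> K * norm A * norm x"
proof -
  obtain K where "K > 0" "\<And>(A::complex^'n^'m) x. norm (A *v x) \<le> norm A * norm x * K"
    using bounded_bilinear.pos_bounded[OF bounded_bilinear_matrix_vector_mult] by blast
  then show ?thesis using that by (simp add: ac_simps)
qed

lemma matrix_vector_mult_bounded:
  fixes A :: "complex^'n^'m"
  obtains K where "K > 0" "\<And>x. norm (A *v x) \<le> K * norm x"
  using bounded_linear.pos_bounded[OF bounded_linear_matrix_vector_mult, of A] by (auto simp: mult.commute)

lemma matrix_left_inverse_bound:
  fixes A :: "complex^'n^'m" and B :: "complex^'m^'n"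
  assumes "B ** A = mat 1"
  obtains K where "K > 0" "\<And>x. norm x \<le> K * norm (A *v x)"
proof -
  obtain K where K: "K > 0" "\<And>x. norm (B *v x) \<le> K * norm x" by (rule matrix_vector_mult_bounded[of B]) blast
  have "B *v (A *v x) = x" for x using assms by (simp add: matrix_vector_mul_assoc)
  then show ?thesis using that K by metis
qed

lemma Re_cinner: "Re (cinner u v) = inner u v"
  by (simp add: cinner_def inner_vec_def inner_complex_def)

lemma inner_adjoint_matrix: "inner (M *v u) v = inner u (adjoint_matrix M *v v)"
proof -
  have "cinner (M *v u) v = cinner u (adjoint_matrix M *v v)"
    unfolding cinner_def matrix_vector_mult_def adjoint_matrix_def
    by (simp add: sum_distrib_left sum_distrib_right) (subst sum.swap, simp add: ac_simps)
  then show ?thesis unfolding Re_cinner[symmetric] by simp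
qed

lemma hermitian_inner: "hermitian M \<Longrightarrow> inner (M *v u) v = inner u (M *v v)"
  by (simp add: inner_adjoint_matrix hermitian_def)

text \<open>A vanishing real part means that the adjoint of \<open>G\<close> is \<open>- G\<close>,
  so the complex form is purely imaginary and its real part, which is \<open>inner\<close>,
  vanishes.\<close>

lemma inner_skew_eq_0:
  assumes "re_part G = 0"
  shows "inner (G *v u) u = 0"
proof -
  have "adjoint_matrix G = - G"
    using assms by (simp add: re_part_def add_eq_0_iff)
  then have "inner (G *v u) u = - inner u (G *v u)"
    using inner_adjoint_matrix[of G u u] bounded_bilinear.minus_left[OF bounded_bilinear_matrix_vector_mult, of G u] by simp
  then show ?thesis by (simp add: inner_commute)
qed

text \<open>Expanding \<open>\<langle>M (v - s M v), v - s M v\<rangle> \<ge> 0\<close> with \<open>s = 1 / C\<close>.\<close>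

lemma positive_hermitian_norm_sq_le:
  assumes "positive_hermitian M" "C > 0" "\<And>v. norm (M *v v) \<le> C * norm v"
  shows "(norm (M *v v))\<^sup>2 \<le> C * inner v (M *v v)"
proof -
  define a where "a = M *v v"
  have h: "hermitian M" using assms(1) by (simp add: positive_hermitian_def)
  have pos: "0 \<le> inner (M *v w) w" for w
    using assms(1) by (cases "w = 0") (auto simp: positive_hermitian_def Re_cinner less_imp_le)
  interpret L: bounded_linear "\<lambda>x. M *v x" by (rule bounded_linear_matrix_vector_mult)
  have "0 \<le> inner (M *v (v - (1 / C) *\<^sub>R a)) (v - (1 / C) *\<^sub>R a)" by (rule pos)
  also have "\<dots> = inner v a - 2 / C * inner a a + (1 / C)\<^sup>2 * inner (M *v a) a"
    unfolding L.diff L.scaleR using hermitian_inner[OF h, of a v]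
    by (simp add: a_def inner_diff_left inner_diff_right inner_commute power2_eq_square algebra_simps)
  also have "\<dots> \<le> inner v a - 2 / C * inner a a + (1 / C)\<^sup>2 * (C * inner a a)"
  proof -
    have "inner (M *v a) a \<le> norm (M *v a) * norm a" by (rule norm_cauchy_schwarz)
    also have "\<dots> \<le> C * norm a * norm a" using assms(3)[of a] by (intro mult_right_mono) auto
    finally have "inner (M *v a) a \<le> C * inner a a" by (simp add: dot_square_norm power2_eq_square)
    then show ?thesis by (intro add_left_mono mult_left_mono) auto
  qed
  also have "\<dots> = inner v a - inner a a / C" using assms(2) by (simp add: power2_eq_square field_simps)
  finally have "inner a a / C \<le> inner v a" by simp
  then show ?thesis using assms(2) by (simp add: a_def[symmetric] dot_square_norm field_simps)
qed

lemma matrix_inv_left: "invertible M \<Longrightarrow> matrix_inv M ** M = mat 1"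
  unfolding invertible_def matrix_inv_def by (rule someI2_ex) auto

text \<open>A nonzero kernel vector would annihilate the quadratic form, and a square matrix with
  trivial kernel is invertible.\<close>

lemma positive_hermitian_invertible:
  assumes "positive_hermitian M"
  shows "matrix_inv M ** M = mat 1"
proof -
  have "\<exists>B. B ** M = mat 1"
    unfolding matrix_left_invertible_ker
    using assms by (force simp: positive_hermitian_def cinner_def)
  then have "invertible M" by (simp add: invertible_left_inverse)
  then show ?thesis by (rule matrix_inv_left)
qed

lemma norm_stack_vec_sq:
  fixes u :: "'a::real_normed_vector^'n" and v :: "'a^'m"
  shows "(norm (stack_vec u v))\<^sup>2 = (norm u)\<^sup>2 + (norm v)\<^sup>2"
  using sum.Plus[OF finite finite, of "\<lambda>i. (norm (stack_vec u v $ i))\<^sup>2" UNIV UNIV]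
  by (simp add: norm_vec_def L2_set_def sum_nonneg stack_vec_def)

lemma column_block_mult:
  "column_block A B *v x = stack_vec (A *v x) (B *v x)" for A :: "complex^'k^'n"
  by (auto simp: vec_eq_iff column_block_def stack_vec_def matrix_vector_mult_def split: sum.split)

lemma C1_unit_mult:
  fixes A :: "real \<Rightarrow> complex^'n^'m" and B :: "real \<Rightarrow> complex^'k^'n"
  assumes "C1_unit A" "C1_unit B"
  shows "C1_unit (\<lambda>\<zeta>. A \<zeta> ** B \<zeta>)"
proof -
  obtain A' B' where A: "continuous_on {0..1} A'" "\<And>\<zeta>. \<zeta> \<in> {0..1} \<Longrightarrow> (A has_vector_derivative A' \<zeta>) (at \<zeta> within {0..1})"
    and B: "continuous_on {0..1} B'" "\<And>\<zeta>. \<zeta> \<in> {0..1} \<Longrightarrow> (B has_vector_derivative B' \<zeta>) (at \<zeta> within {0..1})"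
    using assms unfolding C1_unit_def by blast
  have c: "continuous_on {0..1} A" "continuous_on {0..1} B"
    using A(2) B(2) has_vector_derivative_continuous continuous_on_eq_continuous_within by blast+
  show ?thesis
    unfolding C1_unit_def
  proof (intro exI[of _ "\<lambda>\<zeta>. A \<zeta> ** B' \<zeta> + A' \<zeta> ** B \<zeta>"] conjI ballI)
    show "continuous_on {0..1} (\<lambda>\<zeta>. A \<zeta> ** B' \<zeta> + A' \<zeta> ** B \<zeta>)"
      by (intro continuous_on_add bounded_bilinear.continuous_on[OF bounded_bilinear_matrix_mult] A B c)
    show "((\<lambda>\<zeta>. A \<zeta> ** B \<zeta>) has_vector_derivative A \<zeta> ** B' \<zeta> + A' \<zeta> ** B \<zeta>) (at \<zeta> within {0..1})"
      if "\<zeta> \<in> {0..1}" for \<zeta>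
      by (rule bounded_bilinear.has_vector_derivative[OF bounded_bilinear_matrix_mult A(2)[OF that] B(2)[OF that]])
  qed
qed

lemma C1_unit_const: "C1_unit (\<lambda>_. A)"
  unfolding C1_unit_def by (intro exI[of _ "\<lambda>_. 0"]) (auto intro: has_vector_derivative_const)

section \<open>Traces of absolutely continuous functions\<close>

lemma emeasure_unit: "measure unit_measure {0..1} = 1"
  by (simp add: measure_restrict_space)

lemma finite_measure_unit: "finite_measure unit_measure"
  by (rule finite_measure_lebesgue_on) auto

lemma integral_unit_const: "(LINT r|unit_measure. c) = (c::real)"
  using emeasure_unit by simp

lemma integrable_unit_const: "integrable unit_measure (\<lambda>_. c::real)"
  by (rule finite_measure.integrable_const[OF finite_measure_unit])

lemma L2_integrable_norm:
  assumes "x \<in> L2"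
  shows "integrable unit_measure (\<lambda>\<zeta>. norm (x \<zeta>))"
proof (rule Bochner_Integration.integrable_bound)
  note [measurable] = L2_borel_measurable[OF assms]
  show "integrable unit_measure (\<lambda>\<zeta>. 1 + (norm (x \<zeta>))\<^sup>2)"
    using L2_integrable_norm_sq[OF assms] integrable_unit_const by (rule Bochner_Integration.integrable_add[rotated])
  have "norm (x \<zeta>) \<le> 1 + (norm (x \<zeta>))\<^sup>2" for \<zeta>
    using zero_le_power2[of "norm (x \<zeta>) - 1"] norm_ge_zero[of "x \<zeta>"] unfolding power2_diff by (simp del: norm_ge_zero)
  then show "AE \<zeta> in unit_measure. norm (norm (x \<zeta>)) \<le> norm (1 + (norm (x \<zeta>))\<^sup>2)" by simp
  show "(\<lambda>\<zeta>. norm (x \<zeta>)) \<in> borel_measurable unit_measure" by measurable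
qed

text \<open>The unit interval is a probability space, and the variance of the norm is
  nonnegative.\<close>

lemma integral_norm_sq_le:
  assumes "x \<in> L2"
  shows "(LINT \<zeta>|unit_measure. norm (x \<zeta>))\<^sup>2 \<le> (LINT \<zeta>|unit_measure. (norm (x \<zeta>))\<^sup>2)"
proof -
  define c where "c = (LINT \<zeta>|unit_measure. norm (x \<zeta>))"
  note i = L2_integrable_norm[OF assms] L2_integrable_norm_sq[OF assms] integrable_unit_const
  have "0 \<le> (LINT \<zeta>|unit_measure. (norm (x \<zeta>) - c)\<^sup>2)" by simp
  also have "\<dots> = (LINT \<zeta>|unit_measure. (norm (x \<zeta>))\<^sup>2 - (2 * c) * norm (x \<zeta>) + c\<^sup>2)"
    by (simp add: power2_diff algebra_simps)
  also have "\<dots> = (LINT \<zeta>|unit_measure. (norm (x \<zeta>))\<^sup>2) - (2 * c) * c + c\<^sup>2"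
    using i by (simp add: emeasure_unit c_def[symmetric])
  finally show ?thesis by (simp add: c_def[symmetric] power2_eq_square)
qed

lemma integral_norm_le_norm_l2:
  assumes "x \<in> L2"
  shows "(LINT \<zeta>|unit_measure. norm (x \<zeta>)) \<le> norm (abs_l2 x)"
  using integral_norm_sq_le[OF assms] unfolding norm_abs_l2_sq[OF assms, symmetric]
  by (rule power2_le_imp_le) simp

text \<open>One-dimensional Sobolev embedding with constant 1: point values are controlled by the
  \<open>L2\<close> norms of the function and of its derivative. This makes the boundary values
  depend continuously on the state in the graph norm.\<close>

lemma has_AC_derivative_trace_bound:
  fixes u :: "real \<Rightarrow> complex^'n"
  assumes AC: "has_AC_derivative u u'" and "u \<in> L2" "u' \<in> L2" and s: "s \<in> {0..1}"
  shows "norm (u s) \<le> norm (abs_l2 u) + norm (abs_l2 u')"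
proof -
  have i: "integrable unit_measure (\<lambda>r. norm (u' r))" by (rule L2_integrable_norm) fact
  have step: "norm (u s) \<le> norm (u r) + (LINT r|unit_measure. norm (u' r))" if r: "r \<in> {0..1}" for r
  proof -
    have iu: "integrable unit_measure u'" using AC by (rule has_AC_derivativeD)
    have ind: "integrable unit_measure (\<lambda>t. indicator {0..a} t *\<^sub>R u' t)" if "a \<in> {0..1}" for a
      using that iu by (intro integrable_mult_indicator) (auto simp: sets_restrict_space_iff)
    have "u s - u r = (LINT t|unit_measure. indicator {0..s} t *\<^sub>R u' t) - (LINT t|unit_measure. indicator {0..r} t *\<^sub>R u' t)"
      unfolding has_AC_derivativeD(2)[OF AC s] has_AC_derivativeD(2)[OF AC r]
        integral_lebesgue_on_subinterval[OF s] integral_lebesgue_on_subinterval[OF r] by simp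
    also have "\<dots> = (LINT t|unit_measure. indicator {0..s} t *\<^sub>R u' t - indicator {0..r} t *\<^sub>R u' t)"
      by (rule Bochner_Integration.integral_diff[symmetric, OF ind[OF s] ind[OF r]])
    also have "norm \<dots> \<le> (LINT t|unit_measure. norm (u' t))"
      by (rule Bochner_Integration.integral_norm_bound_integral
            [OF Bochner_Integration.integrable_diff[OF ind[OF s] ind[OF r]] i]) (auto simp: indicator_def)
    finally show ?thesis using norm_triangle_sub[of "u s" "u r"] by linarith
  qed
  \<comment> \<open>Averages the estimate by \<open>u r\<close> over all \<open>r\<close>; the
    interval has length 1, so the left side is unchanged and an unknown value \<open>u r\<close>
    becomes an integral.\<close>
  have "norm (u s) = (LINT r|unit_measure. norm (u s))" by (rule integral_unit_const[symmetric])
  also have "\<dots> \<le> (LINT r|unit_measure. norm (u r) + (LINT r|unit_measure. norm (u' r)))"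
    by (rule integral_mono) (use step L2_integrable_norm[OF assms(2)] integrable_unit_const in auto)
  also have "\<dots> = (LINT r|unit_measure. norm (u r)) + (LINT r|unit_measure. norm (u' r))"
    using L2_integrable_norm[OF assms(2)] integrable_unit_const by (simp add: emeasure_unit)
  also have "\<dots> \<le> norm (abs_l2 u) + norm (abs_l2 u')"
    using assms(2,3)[THEN integral_norm_le_norm_l2] by (rule add_mono)
  finally show ?thesis .
qed

section \<open>Uniqueness of the absolutely continuous representative\<close>

lemma continuous_AE_eq_imp_eq:
  fixes g h :: "real \<Rightarrow> 'a::euclidean_space"
  assumes "continuous_on {0..1} g" "continuous_on {0..1} h" "AE \<zeta> in unit_measure. g \<zeta> = h \<zeta>" "\<zeta> \<in> {0..1}"
  shows "g \<zeta> = h \<zeta>"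
proof -
  define f where "f r = norm (g r - h r)" for r
  have c: "continuous_on {0..1} f" unfolding f_def by (intro continuous_intros assms)
  have f0: "f r \<ge> 0" for r by (simp add: f_def)
  have i: "integrable unit_measure f" by (rule continuous_imp_integrable_real[OF c])
  have "(LINT r|unit_measure. f r) = 0"
    by (rule integral_eq_zero_AE) (use assms(3) in \<open>auto simp: f_def elim: eventually_mono\<close>)
  then have "integral {0..1} f = 0" using lebesgue_integral_eq_integral[OF i] by simp
  then have "f \<zeta> = 0"
    using integral_eq_0_iff[OF c] assms(4) f0 by simp
  then show ?thesis by (simp add: f_def)
qed

lemma H1_rep_has_AC_derivative:
  assumes "H1_rep f g g'"
  shows "has_AC_derivative g g'"
  unfolding has_AC_derivative_def
proof (intro conjI)
  have g': "g' \<in> L2" using assms by (simp add: H1_rep_def)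
  show "integrable unit_measure g'"
    using L2_integrable_norm[OF g'] L2_borel_measurable[OF g'] by (simp add: integrable_norm_iff)
  show "\<forall>s\<in>{0..1}. g s = g 0 + (LINT r|lebesgue_on {0..s}. g' r)" using assms unfolding H1_rep_def by blast
qed

text \<open>\<open>ac_rep\<close> and \<open>H1_deriv\<close> are chosen independently, each with
  its own unknown partner. Two continuous representatives agree everywhere on the interval, so the
  chosen derivative also belongs to the chosen representative.\<close>

lemma H1_rep_choice:
  assumes "f \<in> H1"
  shows "H1_rep f (ac_rep f) (H1_deriv f)"
proof -
  have e: "\<exists>g g'. H1_rep f g g'" using assms by (simp add: H1_def)
  then obtain g' where 1: "H1_rep f (ac_rep f) g'"
    unfolding ac_rep_def using someI_ex[OF e] by blast
  have e': "\<exists>g' g. H1_rep f g g'" using e by blast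
  obtain g where 2: "H1_rep f g (H1_deriv f)"
    unfolding H1_deriv_def using someI_ex[OF e'] by blast
  have "AE \<zeta> in unit_measure. ac_rep f \<zeta> = g \<zeta>"
    using 1 2 unfolding H1_rep_def by (auto elim: eventually_elim2)
  then have eq: "ac_rep f \<zeta> = g \<zeta>" if "\<zeta> \<in> {0..1}" for \<zeta>
    using 1 2 that by (intro continuous_AE_eq_imp_eq has_AC_derivative_continuous_on H1_rep_has_AC_derivative)
  show ?thesis
    unfolding H1_rep_def
  proof (intro conjI ballI)
    show "AE \<zeta> in unit_measure. f \<zeta> = ac_rep f \<zeta>" "H1_deriv f \<in> L2"
      using 1 2 by (auto simp: H1_rep_def)
    fix \<zeta> :: real assume \<zeta>: "\<zeta> \<in> {0..1}"
    have "g \<zeta> = g 0 + (LINT s|lebesgue_on {0..\<zeta>}. H1_deriv f s)" using 2 \<zeta> unfolding H1_rep_def by blast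
    then show "ac_rep f \<zeta> = ac_rep f 0 + (LINT s|lebesgue_on {0..\<zeta>}. H1_deriv f s)"
      using eq[OF \<zeta>] eq[of 0] by simp
  qed
qed

section \<open>The integrated differential inequalities\<close>

lemma has_derivative_nonneg_imp_le:
  fixes f :: "real \<Rightarrow> real"
  assumes "0 \<le> b" "\<And>t. 0 \<le> t \<Longrightarrow> (f has_real_derivative f' t) (at t within {0..})"
    and "\<And>t. 0 \<le> t \<Longrightarrow> t \<le> b \<Longrightarrow> 0 \<le> f' t"
  shows "f 0 \<le> f b"
proof (rule DERIV_nonneg_imp_increasing_open[OF assms(1)])
  fix t :: real assume t: "0 < t" "t < b"
  have "at t within {0..} = at t" by (rule at_within_interior) (use t in simp)
  then have "DERIV f t :> f' t" using assms(2)[of t] t by simp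
  then show "\<exists>y. DERIV f t :> y \<and> 0 \<le> y" using assms(3)[of t] t by auto
next
  show "continuous_on {0..b} f"
    by (rule continuous_on_subset[of "{0..}"])
       (auto simp: continuous_on_eq_continuous_within intro!: DERIV_continuous[OF assms(2)])
qed

text \<open>With \<open>R\<close> the integral of \<open>r\<close>, the energy stays above
  \<open>E 0 - a * R \<tau>\<close> on the whole interval, and \<open>E \<tau>\<close> is at most
  \<open>E 0 + a * R \<tau>\<close>. Integrating \<open>q'\<close> thus costs at least
  \<open>c * \<tau>\<close> copies of the lower bound, while the end values of \<open>q\<close> pay
  for at most about \<open>2 * d\<close> copies of \<open>E 0\<close>; the surplus is covered by
  \<open>R \<tau>\<close>.\<close>

lemma observability_of_differential_inequalities:
  fixes E q r :: "real \<Rightarrow> real"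
  assumes r: "continuous_on {0..} r" "\<And>t. 0 \<le> t \<Longrightarrow> 0 \<le> r t"
    and E: "\<And>t. 0 \<le> t \<Longrightarrow> (E has_real_derivative E' t) (at t within {0..})"
    and E': "\<And>t. 0 \<le> t \<Longrightarrow> \<bar>E' t\<bar> \<le> a * r t"
    and q: "\<And>t. 0 \<le> t \<Longrightarrow> (q has_real_derivative q' t) (at t within {0..})"
    and q': "\<And>t. 0 \<le> t \<Longrightarrow> q' t \<le> b * r t - c * E t"
    and qE: "\<And>t. 0 \<le> t \<Longrightarrow> \<bar>q t\<bar> \<le> d * E t"
    and pos: "0 \<le> a" "0 < c" "0 \<le> d"
    and \<tau>: "\<tau> = (2 * d + 1) / c"
  shows "E 0 \<le> (b + a * (c * \<tau>) + d * a) * (LINT t|lebesgue_on {0..\<tau>}. r t)"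
proof -
  have \<tau>0: "\<tau> > 0" unfolding \<tau> using pos by (intro divide_pos_pos) auto
  define R where "R t = integral {0..t} r" for t
  have R': "(R has_real_derivative r t) (at t within {0..})" if t: "0 \<le> t" for t
  proof -
    \<comment> \<open>The fundamental theorem is applied on a compact interval. Its right end
      \<open>t + 1\<close> keeps \<open>t\<close> away from the end, so that near \<open>t\<close>
      the interval looks like the half-line.\<close>
    have "((\<lambda>u. integral {0..u} r) has_vector_derivative r t) (at t within {0..t + 1})"
      by (rule integral_has_vector_derivative) (use t in \<open>auto intro: continuous_on_subset[OF r(1)]\<close>)
    moreover have "at t within {0..t + 1} = at t within {0..}"
      by (rule at_within_nhd[of _ "{..<t+1}"]) auto
    ultimately show ?thesis unfolding R_def has_real_derivative_iff_has_vector_derivative by simp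
  qed
  have mono: "f 0 \<le> f t" if "0 \<le> t" "\<And>t. 0 \<le> t \<Longrightarrow> (f has_real_derivative f' t) (at t within {0..})"
    "\<And>t. 0 \<le> t \<Longrightarrow> 0 \<le> f' t" for f f' :: "real \<Rightarrow> real" and t
    using has_derivative_nonneg_imp_le[of t f f'] that by blast
  have R0: "R 0 = 0" by (simp add: R_def)
  have Rmono: "R t \<le> R \<tau>" if "0 \<le> t" "t \<le> \<tau>" for t
    unfolding R_def
  proof (rule integral_subset_le)
    show "{0..t} \<subseteq> {0..\<tau>}" using that by simp
    show "r integrable_on {0..t}" "r integrable_on {0..\<tau>}"
      by (rule integrable_continuous_real[OF continuous_on_subset[OF r(1)]], simp)+
    show "\<forall>u\<in>{0..\<tau>}. 0 \<le> r u" using r(2) by simp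
  qed
  have lower: "E 0 - a * R \<tau> \<le> E t" if t: "0 \<le> t" "t \<le> \<tau>" for t
  proof -
    have "0 \<le> E' s + a * r s" if "0 \<le> s" for s using E'[OF that] by linarith
    then have "E 0 + a * R 0 \<le> E t + a * R t"
      by (intro mono[where f = "\<lambda>t. E t + a * R t" and f' = "\<lambda>t. E' t + a * r t", OF t(1)]
            DERIV_add DERIV_cmult E R')
    moreover have "a * R t \<le> a * R \<tau>" by (rule mult_left_mono[OF Rmono[OF t] pos(1)])
    ultimately show ?thesis by (simp add: R0)
  qed
  have "0 \<le> a * r s - E' s" if "0 \<le> s" for s using E'[OF that] by linarith
  then have "a * R 0 - E 0 \<le> a * R \<tau> - E \<tau>"
    by (intro mono[where f = "\<lambda>t. a * R t - E t" and f' = "\<lambda>t. a * r t - E' t", OF less_imp_le[OF \<tau>0]]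
          DERIV_diff DERIV_cmult E R')
  then have upper: "E \<tau> \<le> E 0 + a * R \<tau>" by (simp add: R0)
  \<comment> \<open>A constant lower bound of \<open>c * E t\<close> on the interval; with it the
    inequality for \<open>q'\<close> integrates to one that is linear in time.\<close>
  define e where "e = c * (E 0 - a * R \<tau>)"
  have "b * R 0 - q 0 - e * 0 \<le> b * R \<tau> - q \<tau> - e * \<tau>"
  proof (rule has_derivative_nonneg_imp_le[where f' = "\<lambda>t. b * r t - q' t - e"])
    show "0 \<le> \<tau>" using \<tau>0 by simp
    show "((\<lambda>t. b * R t - q t - e * t) has_real_derivative b * r t - q' t - e) (at t within {0..})" if "0 \<le> t" for t
      using DERIV_diff[OF DERIV_diff[OF DERIV_cmult[OF R'[OF that]] q[OF that]] DERIV_cmult_Id[of e]] by simp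
    show "0 \<le> b * r t - q' t - e" if t: "0 \<le> t" "t \<le> \<tau>" for t
    proof -
      have "e \<le> c * E t" unfolding e_def using lower[OF t] pos(2) by (intro mult_left_mono) auto
      then show ?thesis using q'[OF t(1)] by linarith
    qed
  qed
  then have "e * \<tau> \<le> b * R \<tau> + q 0 - q \<tau>" by (simp add: R0)
  also have "\<dots> \<le> b * R \<tau> + d * E 0 + d * E \<tau>" using qE[of 0] qE[of \<tau>] \<tau>0 by linarith
  also have "\<dots> \<le> b * R \<tau> + d * E 0 + d * (E 0 + a * R \<tau>)" using mult_left_mono[OF upper pos(3)] by simp
  finally have "(c * \<tau> - 2 * d) * E 0 \<le> (b + a * (c * \<tau>) + d * a) * R \<tau>"
    unfolding e_def by (simp add: algebra_simps)
  \<comment> \<open>The choice of \<tau> serves exactly this normalization.\<close>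
  moreover have "c * \<tau> - 2 * d = 1" unfolding \<tau> using pos by simp
  moreover have "R \<tau> = (LINT t|lebesgue_on {0..\<tau>}. r t)"
    unfolding R_def by (rule lebesgue_integral_eq_integral[symmetric])
      (rule continuous_imp_integrable_real[OF continuous_on_subset[OF r(1)]], simp_all)
  ultimately show ?thesis by simp
qed

section \<open>Multiplication operators\<close>

lemma L2_matrix_mult:
  assumes "B \<in> borel_measurable unit_measure" "AE \<zeta> in unit_measure. \<forall>v. norm (B \<zeta> *v v) \<le> C * norm v" "x \<in> L2"
  shows "(\<lambda>\<zeta>. B \<zeta> *v x \<zeta>) \<in> L2"
proof (rule L2_bound[OF assms(3)])
  show "(\<lambda>\<zeta>. B \<zeta> *v x \<zeta>) \<in> borel_measurable unit_measure"
    by (rule borel_measurable_bounded_bilinear[OF bounded_bilinear_matrix_vector_mult assms(1) L2_borel_measurable[OF assms(3)]])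
  show "AE \<zeta> in unit_measure. norm (B \<zeta> *v x \<zeta>) \<le> C * norm (x \<zeta>)" using assms(2) by eventually_elim auto
qed

lemma norm_abs_l2_mono:
  assumes "x \<in> L2" "y \<in> L2" "0 \<le> C" "AE \<zeta> in unit_measure. norm (y \<zeta>) \<le> C * norm (x \<zeta>)"
  shows "norm (abs_l2 y) \<le> C * norm (abs_l2 x)"
proof (rule power2_le_imp_le)
  have "(norm (abs_l2 y))\<^sup>2 \<le> (LINT \<zeta>|unit_measure. C\<^sup>2 * (norm (x \<zeta>))\<^sup>2)"
    unfolding norm_abs_l2_sq[OF assms(2)]
  proof (rule integral_mono_AE)
    show "AE \<zeta> in unit_measure. (norm (y \<zeta>))\<^sup>2 \<le> C\<^sup>2 * (norm (x \<zeta>))\<^sup>2"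
      using assms(4) by eventually_elim (metis norm_ge_zero power_mono power_mult_distrib)
  qed (use assms L2_integrable_norm_sq in auto)
  then show "(norm (abs_l2 y))\<^sup>2 \<le> (C * norm (abs_l2 x))\<^sup>2"
    by (simp add: power_mult_distrib norm_abs_l2_sq[OF assms(1)])
qed (use assms in simp)

text \<open>Defined through representatives and not by lifting, since for an unbounded
  \<open>B\<close> the product may leave \<open>L2\<close>. Independence of the representative is
  proved below under a bound on \<open>B\<close>.\<close>

definition mult_op :: "(real \<Rightarrow> complex^'n^'n) \<Rightarrow> 'n l2 \<Rightarrow> 'n l2" where
  "mult_op B u = abs_l2 (\<lambda>\<zeta>. B \<zeta> *v rep_l2 u \<zeta>)"

context
  fixes B :: "real \<Rightarrow> complex^'n^'n" and C :: real
  assumes B: "B \<in> borel_measurable unit_measure" "0 \<le> C" "AE \<zeta> in unit_measure. \<forall>v. norm (B \<zeta> *v v) \<le> C * norm v"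
begin

lemma mult_op_abs_l2:
  assumes "x \<in> L2"
  shows "mult_op B (abs_l2 x) = abs_l2 (\<lambda>\<zeta>. B \<zeta> *v x \<zeta>)"
  unfolding mult_op_def
  using rep_abs_l2[OF assms]
  by (subst abs_l2_eq_iff[OF L2_matrix_mult[OF B(1,3) rep_l2_L2] L2_matrix_mult[OF B(1,3) assms]]) (auto elim: eventually_mono)

lemma norm_mult_op_le: "norm (mult_op B u) \<le> C * norm u"
proof -
  obtain x where x: "x \<in> L2" "u = abs_l2 x" by (metis l2_cases)
  show ?thesis
    unfolding x(2) mult_op_abs_l2[OF x(1)]
    by (rule norm_abs_l2_mono[OF x(1) L2_matrix_mult[OF B(1,3) x(1)] B(2)]) (use B(3) in \<open>auto elim: eventually_mono\<close>)
qed

lemma bounded_linear_mult_op: "bounded_linear (mult_op B)"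
proof (rule bounded_linear_intro)
  fix u v :: "'n l2" and c :: real
  obtain x y where x: "x \<in> L2" "u = abs_l2 x" and y: "y \<in> L2" "v = abs_l2 y" by (metis l2_cases)
  note L = L2_matrix_mult[OF B(1,3)]
  show "mult_op B (u + v) = mult_op B u + mult_op B v"
    using x y by (simp add: abs_l2_add L2_add mult_op_abs_l2 L matrix_vector_right_distrib)
  show "mult_op B (c *\<^sub>R u) = c *\<^sub>R mult_op B u"
    using x by (simp add: abs_l2_scaleR L2_scaleR mult_op_abs_l2 L matrix_vector_mult_scaleR_right)
  show "norm (mult_op B u) \<le> norm u * C" using norm_mult_op_le[of u] by (simp add: mult.commute)
qed

lemma mult_op_symmetric:
  assumes "AE \<zeta> in unit_measure. \<forall>v w. inner (B \<zeta> *v v) w = inner v (B \<zeta> *v w)"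
  shows "inner (mult_op B u) v = inner u (mult_op B v)"
proof -
  obtain x y where x: "x \<in> L2" "u = abs_l2 x" and y: "y \<in> L2" "v = abs_l2 y" by (metis l2_cases)
  note L = L2_matrix_mult[OF B(1,3)]
  show ?thesis
    unfolding x(2) y(2) mult_op_abs_l2[OF x(1)] mult_op_abs_l2[OF y(1)] inner_abs_l2[OF L[OF x(1)] y(1)] inner_abs_l2[OF x(1) L[OF y(1)]]
  proof (rule integral_cong_AE)
    show "AE \<zeta> in unit_measure. inner (B \<zeta> *v x \<zeta>) (y \<zeta>) = inner (x \<zeta>) (B \<zeta> *v y \<zeta>)"
      using assms by (auto elim: eventually_mono)
  qed (intro borel_measurable_inner L2_borel_measurable L x y)+
qed

end

text \<open>Symmetry of \<open>L\<close> merges the two terms of the product rule. It is applied to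
  the energy and to the multiplier functional.\<close>

lemma quadratic_form_has_derivative:
  fixes X :: "real \<Rightarrow> 'a::real_inner"
  assumes "bounded_linear L" "\<And>u v. inner (L u) v = inner u (L v)" "(X has_vector_derivative Z) (at t within S)"
  shows "((\<lambda>t. inner (X t) (L (X t))) has_real_derivative 2 * inner Z (L (X t))) (at t within S)"
proof -
  have "((\<lambda>t. inner (X t) (L (X t))) has_vector_derivative inner (X t) (L Z) + inner Z (L (X t))) (at t within S)"
    by (rule bounded_bilinear.has_vector_derivative[OF bounded_bilinear_inner assms(3)
          bounded_linear.has_vector_derivative[OF assms(1,3)]])
  moreover have "inner (X t) (L Z) = inner Z (L (X t))"
    using assms(2)[of "X t" Z] by (simp add: inner_commute)
  ultimately show ?thesis by (simp add: has_real_derivative_iff_has_vector_derivative)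
qed

section \<open>Energy balance and multiplier estimate\<close>

text \<open>\<open>Hc\<close> is the continuously differentiable representative of \<open>H\<close>, and \<open>Hd\<close> its derivative.\<close>

locale phs_coefficients =
  fixes P G :: "complex^'n^'n" and H Hc Hd :: "real \<Rightarrow> complex^'n^'n" and p h l :: real
  assumes P_hermitian: "hermitian P"
    and P_lower: "0 < p" "\<And>v. norm v \<le> p * norm (P *v v)"
    and G_skew: "re_part G = 0"
    and H_measurable: "H \<in> borel_measurable unit_measure"
    and H_hermitian: "AE \<zeta> in unit_measure. hermitian (H \<zeta>)"
    and H_upper: "0 < h" "AE \<zeta> in unit_measure. \<forall>v. norm (H \<zeta> *v v) \<le> h * norm v"
    and H_lower: "0 < l" "AE \<zeta> in unit_measure. \<forall>v. l * (norm v)\<^sup>2 \<le> inner v (H \<zeta> *v v)"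
    and H_eq: "AE \<zeta> in unit_measure. H \<zeta> = Hc \<zeta>"
    and Hd_continuous: "continuous_on {0..1} Hd"
    and Hc_derivative: "\<And>\<zeta>. \<zeta> \<in> {0..1} \<Longrightarrow> (Hc has_vector_derivative Hd \<zeta>) (at \<zeta> within {0..1})"
begin

lemma ham_L2: "x \<in> L2 \<Longrightarrow> ham H x \<in> L2"
  unfolding ham_def by (rule L2_matrix_mult[OF H_measurable H_upper(2)])

lemma ham_mult_op: "x \<in> L2 \<Longrightarrow> mult_op H (abs_l2 x) = abs_l2 (ham H x)"
  unfolding ham_def by (rule mult_op_abs_l2[OF H_measurable less_imp_le[OF H_upper(1)] H_upper(2)])

lemmas H_op = bounded_linear_mult_op[OF H_measurable less_imp_le[OF H_upper(1)] H_upper(2)]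

lemma H_op_symmetric: "inner (mult_op H u) v = inner u (mult_op H v)"
  by (rule mult_op_symmetric[OF H_measurable less_imp_le[OF H_upper(1)] H_upper(2)])
     (use H_hermitian in \<open>auto simp: hermitian_inner elim: eventually_mono\<close>)

lemma H_op_lower: "l * (norm u)\<^sup>2 \<le> inner u (mult_op H u)"
proof -
  obtain x where x: "x \<in> L2" "u = abs_l2 x" by (metis l2_cases)
  have "(LINT \<zeta>|unit_measure. l * (norm (x \<zeta>))\<^sup>2) \<le> (LINT \<zeta>|unit_measure. inner (x \<zeta>) (ham H x \<zeta>))"
    by (rule integral_mono_AE)
      (use x H_lower L2_integrable_inner[OF x(1) ham_L2[OF x(1)]]
        in \<open>auto simp: L2_integrable_norm_sq ham_def elim: eventually_mono\<close>)
  then show ?thesis using x by (simp add: norm_abs_l2_sq ham_mult_op inner_abs_l2 ham_L2)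
qed

text \<open>Cauchy-Schwarz bounds the square of the energy by the product of the squared norms of
  \<open>u\<close> and of its image; \<open>H_op_lower\<close> replaces the first factor by the
  energy, and one factor cancels. This turns the gain \<open>- |H x|^2\<close> of the multiplier
  into a multiple of \<open>- E\<close>.\<close>

lemma H_op_energy_le: "l * inner u (mult_op H u) \<le> (norm (mult_op H u))\<^sup>2"
proof -
  define e where "e = inner u (mult_op H u)"
  have le: "l * (norm u)\<^sup>2 \<le> e" unfolding e_def by (rule H_op_lower)
  have e0: "0 \<le> e" using le H_lower(1) by (meson less_imp_le mult_nonneg_nonneg order_trans zero_le_power2)
  show ?thesis
  proof (cases "e = 0")
    case False
    then have e: "e > 0" using e0 by simp
    have "e\<^sup>2 \<le> (norm u * norm (mult_op H u))\<^sup>2"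
      unfolding e_def using e0 by (intro power_mono norm_cauchy_schwarz) (simp add: e_def)
    then have "l * e\<^sup>2 \<le> (l * (norm u)\<^sup>2) * (norm (mult_op H u))\<^sup>2"
      using H_lower(1) by (simp add: power_mult_distrib mult.assoc)
    also have "\<dots> \<le> e * (norm (mult_op H u))\<^sup>2" by (rule mult_right_mono[OF le]) simp
    finally have "e * (l * e) \<le> e * (norm (mult_op H u))\<^sup>2" by (simp add: power2_eq_square ac_simps)
    then show ?thesis using e unfolding e_def[symmetric] by simp
  qed (simp add: e_def[symmetric])
qed

abbreviation (input) "effort x \<equiv> ac_rep (ham H x)"
abbreviation (input) "effort_deriv x \<equiv> H1_deriv (ham H x)"
abbreviation (input) "gen x \<equiv> phs_operator P G H x"

context
  fixes x :: "real \<Rightarrow> complex^'n"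
  assumes x: "x \<in> L2" "ham H x \<in> H1"
begin

lemma ham_AE_eq_effort: "AE \<zeta> in unit_measure. ham H x \<zeta> = effort x \<zeta>"
  using H1_rep_choice[OF x(2)] by (simp add: H1_rep_def)

lemma effort_AC: "has_AC_derivative (effort x) (effort_deriv x)"
  by (rule H1_rep_has_AC_derivative[OF H1_rep_choice[OF x(2)]])

lemma effort_deriv_L2: "effort_deriv x \<in> L2"
  using H1_rep_choice[OF x(2)] by (simp add: H1_rep_def)

lemma effort_L2: "effort x \<in> L2"
proof (rule L2_bound[OF ham_L2[OF x(1)], where C = 1])
  show "effort x \<in> borel_measurable unit_measure"
    by (rule continuous_imp_measurable_on_sets_lebesgue[OF has_AC_derivative_continuous_on[OF effort_AC]]) simp
  show "AE \<zeta> in unit_measure. norm (effort x \<zeta>) \<le> 1 * norm (ham H x \<zeta>)"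
    using ham_AE_eq_effort by eventually_elim simp
qed

lemma abs_l2_effort: "abs_l2 (effort x) = abs_l2 (ham H x)"
  using ham_AE_eq_effort effort_L2 ham_L2[OF x(1)] by (auto simp: abs_l2_eq_iff elim: eventually_mono)

lemma L2_const_mult: "y \<in> L2 \<Longrightarrow> (\<lambda>\<zeta>. M *v y \<zeta>) \<in> L2" for M :: "complex^'n^'n"
proof -
  assume y: "y \<in> L2"
  obtain K where "\<And>v. norm (M *v v) \<le> K * norm v" by (rule matrix_vector_mult_bounded) blast
  then show ?thesis by (intro L2_matrix_mult[where C = K] y) auto
qed

lemma gen_L2: "gen x \<in> L2"
  unfolding phs_operator_def by (intro L2_add L2_const_mult effort_deriv_L2 ham_L2 x)

lemma gen_AE: "AE \<zeta> in unit_measure. gen x \<zeta> = P *v effort_deriv x \<zeta> + G *v effort x \<zeta>"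
  using ham_AE_eq_effort by eventually_elim (simp add: phs_operator_def)

lemma P_effort_AC: "has_AC_derivative (\<lambda>\<zeta>. P *v effort x \<zeta>) (\<lambda>\<zeta>. P *v effort_deriv x \<zeta>)"
  by (rule has_AC_derivative_linear[OF bounded_linear_matrix_vector_mult effort_AC])

text \<open>With \<open>g\<close> the effort, the \<open>G\<close> term drops out by skewness, and
  Hermitian \<open>P\<close> makes twice the \<open>P\<close> term the exact derivative of
  \<open>inner (P *v g) g\<close>; only the boundary values remain.\<close>

lemma energy_balance:
  "2 * inner (abs_l2 (gen x)) (mult_op H (abs_l2 x)) = inner (P *v effort x 1) (effort x 1) - inner (P *v effort x 0) (effort x 0)"
proof -
  have AC: "has_AC_derivative (\<lambda>\<zeta>. inner (P *v effort x \<zeta>) (effort x \<zeta>)) (\<lambda>\<zeta>. inner (P *v effort_deriv x \<zeta>) (effort x \<zeta>) + inner (P *v effort x \<zeta>) (effort_deriv x \<zeta>))"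
    by (rule has_AC_derivative_prod[OF bounded_bilinear_inner P_effort_AC effort_AC])
  have "2 * inner (abs_l2 (gen x)) (mult_op H (abs_l2 x)) = (LINT \<zeta>|unit_measure. 2 * inner (gen x \<zeta>) (effort x \<zeta>))"
    by (simp add: ham_mult_op x abs_l2_effort[symmetric] inner_abs_l2 gen_L2 effort_L2)
  also have "\<dots> = (LINT \<zeta>|unit_measure. inner (P *v effort_deriv x \<zeta>) (effort x \<zeta>) + inner (P *v effort x \<zeta>) (effort_deriv x \<zeta>))"
  proof (rule integral_cong_AE)
    show "AE \<zeta> in unit_measure. 2 * inner (gen x \<zeta>) (effort x \<zeta>) = inner (P *v effort_deriv x \<zeta>) (effort x \<zeta>) + inner (P *v effort x \<zeta>) (effort_deriv x \<zeta>)"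
      using gen_AE
    proof eventually_elim
      case (elim \<zeta>)
      have "inner (P *v effort x \<zeta>) (effort_deriv x \<zeta>) = inner (P *v effort_deriv x \<zeta>) (effort x \<zeta>)"
        using hermitian_inner[OF P_hermitian, of "effort x \<zeta>" "effort_deriv x \<zeta>"] by (simp add: inner_commute)
      then show ?case unfolding elim by (simp add: inner_add_left inner_skew_eq_0[OF G_skew])
    qed
    show "(\<lambda>\<zeta>. 2 * inner (gen x \<zeta>) (effort x \<zeta>)) \<in> borel_measurable unit_measure"
      using L2_borel_measurable[OF gen_L2] L2_borel_measurable[OF effort_L2] by measurable
    show "(\<lambda>\<zeta>. inner (P *v effort_deriv x \<zeta>) (effort x \<zeta>) + inner (P *v effort x \<zeta>) (effort_deriv x \<zeta>)) \<in> borel_measurable unit_measure"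
      using has_AC_derivativeD(1)[OF AC] by (rule borel_measurable_integrable)
  qed
  also have "\<dots> = inner (P *v effort x 1) (effort x 1) - inner (P *v effort x 0) (effort x 0)"
    using has_AC_derivativeD(2)[OF AC, of 1] by simp
  finally show ?thesis .
qed

end

section \<open>The exponential weight and the multiplier operator\<close>

lemma weighted_C1:
  assumes "\<zeta> \<in> {0..1}"
  shows "((\<lambda>\<zeta>. exp (k * \<zeta>) *\<^sub>R (Hc \<zeta> ** P)) has_vector_derivative exp (k * \<zeta>) *\<^sub>R ((k *\<^sub>R Hc \<zeta> + Hd \<zeta>) ** P))
    (at \<zeta> within {0..1})"
proof -
  note left = bounded_bilinear.bounded_linear_left[OF bounded_bilinear_matrix_mult, of P]
  interpret L: bounded_linear "\<lambda>A. A ** P" by (rule left)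
  have "((\<lambda>\<zeta>. exp (k * \<zeta>)) has_real_derivative k * exp (k * \<zeta>)) (at \<zeta> within {0..1})"
    by (auto intro!: derivative_eq_intros)
  from has_vector_derivative_scaleR[OF this bounded_linear.has_vector_derivative[OF left Hc_derivative[OF assms]]]
  show ?thesis by (simp add: L.add L.scaleR scaleR_add_right ac_simps)
qed

lemma weighted_AC:
  "has_AC_derivative (\<lambda>\<zeta>. exp (k * \<zeta>) *\<^sub>R (Hc \<zeta> ** P)) (\<lambda>\<zeta>. exp (k * \<zeta>) *\<^sub>R ((k *\<^sub>R Hc \<zeta> + Hd \<zeta>) ** P))"
proof (rule C1_imp_has_AC_derivative[OF _ weighted_C1])
  have "continuous_on {0..1} Hc"
    using Hc_derivative has_vector_derivative_continuous continuous_on_eq_continuous_within by blast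
  then show "continuous_on {0..1} (\<lambda>\<zeta>. exp (k * \<zeta>) *\<^sub>R ((k *\<^sub>R Hc \<zeta> + Hd \<zeta>) ** P))"
    by (intro continuous_intros bounded_bilinear.continuous_on[OF bounded_bilinear_matrix_mult] Hd_continuous)
qed

text \<open>All terms are quadratic in \<open>f\<close>. The one with factor \<open>k\<close> is
  bounded below through the positivity of \<open>H\<close> and the injectivity of \<open>P\<close>,
  uniformly in \<zeta>, so a large \<open>k\<close> outweighs the other two.\<close>

lemma multiplier_pointwise:
  obtains k where "0 \<le> k"
    "AE \<zeta> in unit_measure. \<forall>f. 2 * inner (G *v f) (H \<zeta> *v (P *v f))
        - inner (P *v f) ((k *\<^sub>R H \<zeta> + Hd \<zeta>) *v (P *v f)) \<le> - (norm f)\<^sup>2"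
proof -
  obtain \<gamma> where \<gamma>: "\<gamma> > 0" "\<And>v. norm (G *v v) \<le> \<gamma> * norm v" by (rule matrix_vector_mult_bounded[of G]) blast
  obtain \<pi> where \<pi>: "\<pi> > 0" "\<And>v. norm (P *v v) \<le> \<pi> * norm v" by (rule matrix_vector_mult_bounded[of P]) blast
  obtain K where K: "K > 0" "\<And>(A::complex^'n^'n) v. norm (A *v v) \<le> K * norm A * norm v"
    by (rule norm_matrix_vector_mult_le) blast
  obtain e where e: "\<And>\<zeta>. \<zeta> \<in> {0..1} \<Longrightarrow> norm (Hd \<zeta>) \<le> e"
    using compact_imp_bounded[OF compact_continuous_image[OF Hd_continuous compact_Icc]] unfolding bounded_iff by blast
  have e0: "0 \<le> e" by (rule order_trans[OF norm_ge_zero e[of 0]]) simp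
  \<comment> \<open>The first summand bounds the \<open>G\<close> term; the second bounds the
    \<open>Hd\<close> term, with \<open>e\<close> the maximum bound of \<open>Hd\<close> and
    \<open>K\<close> comparing the norm of a matrix with its action on vectors.\<close>
  define c where "c = 2 * \<gamma> * h * \<pi> + K * e * \<pi>\<^sup>2"
  have c0: "0 \<le> c" unfolding c_def using \<gamma> H_upper(1) \<pi> K e0 by simp
  \<comment> \<open>The factor \<open>p\<^sup>2 / l\<close> converts the energy of
    \<open>P *v f\<close> back into the squared norm of \<open>f\<close>. The extra 1 beyond
    \<open>c\<close> is the remaining gain.\<close>
  define k where "k = (c + 1) * p\<^sup>2 / l"
  have k0: "0 \<le> k" unfolding k_def using c0 H_lower(1) by simp
  have "AE \<zeta> in unit_measure. \<forall>f. 2 * inner (G *v f) (H \<zeta> *v (P *v f))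
        - inner (P *v f) ((k *\<^sub>R H \<zeta> + Hd \<zeta>) *v (P *v f)) \<le> - (norm f)\<^sup>2"
    using H_upper(2) H_lower(2) AE_space
  proof (eventually_elim, intro allI)
    fix \<zeta> f
    assume up: "\<forall>v. norm (H \<zeta> *v v) \<le> h * norm v" and low: "\<forall>v. l * (norm v)\<^sup>2 \<le> inner v (H \<zeta> *v v)"
      and \<zeta>: "\<zeta> \<in> space unit_measure"
    define a where "a = P *v f"
    have a: "norm a \<le> \<pi> * norm f" "norm f \<le> p * norm a" unfolding a_def using \<pi> P_lower by auto
    have "inner (G *v f) (H \<zeta> *v a) \<le> norm (G *v f) * norm (H \<zeta> *v a)" by (rule norm_cauchy_schwarz)
    also have "\<dots> \<le> (\<gamma> * norm f) * (h * (\<pi> * norm f))"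
      using \<gamma> up H_upper(1) a(1) by (intro mult_mono order_trans[OF up[rule_format]] mult_left_mono) auto
    finally have 1: "inner (G *v f) (H \<zeta> *v a) \<le> \<gamma> * h * \<pi> * (norm f)\<^sup>2" by (simp add: power2_eq_square ac_simps)
    have "- inner a (Hd \<zeta> *v a) \<le> norm a * norm (Hd \<zeta> *v a)"
      using Cauchy_Schwarz_ineq2[of a "Hd \<zeta> *v a"] by linarith
    also have "\<dots> \<le> norm a * (K * e * norm a)"
    proof (rule mult_left_mono)
      have "norm (Hd \<zeta> *v a) \<le> K * norm (Hd \<zeta>) * norm a" by (rule K)
      also have "\<dots> \<le> K * e * norm a" using e[of \<zeta>] \<zeta> K(1) by (intro mult_right_mono mult_left_mono) auto
      finally show "norm (Hd \<zeta> *v a) \<le> K * e * norm a" .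
    qed simp
    also have "\<dots> = K * e * (norm a)\<^sup>2" by (simp add: power2_eq_square)
    also have "\<dots> \<le> K * e * (\<pi> * norm f)\<^sup>2"
      using a(1) K e0 by (intro mult_left_mono power_mono) auto
    finally have 2: "- inner a (Hd \<zeta> *v a) \<le> K * e * \<pi>\<^sup>2 * (norm f)\<^sup>2" by (simp add: power_mult_distrib)
    have "(norm f)\<^sup>2 \<le> (p * norm a)\<^sup>2" using a(2) by (intro power_mono) auto
    then have "(c + 1) * (norm f)\<^sup>2 \<le> (c + 1) * (p\<^sup>2 * (norm a)\<^sup>2)"
      using c0 by (intro mult_left_mono) (auto simp: power_mult_distrib)
    also have "\<dots> = k * (l * (norm a)\<^sup>2)" unfolding k_def using H_lower(1) by simp
    also have "\<dots> \<le> k * inner a (H \<zeta> *v a)" using low k0 by (intro mult_left_mono) auto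
    finally have 3: "(c + 1) * (norm f)\<^sup>2 \<le> k * inner a (H \<zeta> *v a)" .
    have "2 * inner (G *v f) (H \<zeta> *v a) - inner a ((k *\<^sub>R H \<zeta> + Hd \<zeta>) *v a)
        = 2 * inner (G *v f) (H \<zeta> *v a) - k * inner a (H \<zeta> *v a) - inner a (Hd \<zeta> *v a)"
      by (simp add: matrix_vector_mult_add_rdistrib matrix_vector_mult_scaleR_left inner_add_right)
    also have "\<dots> \<le> 2 * (\<gamma> * h * \<pi> * (norm f)\<^sup>2) - (c + 1) * (norm f)\<^sup>2 + K * e * \<pi>\<^sup>2 * (norm f)\<^sup>2"
      using 1 2 3 by linarith
    also have "\<dots> = - (norm f)\<^sup>2" by (simp add: c_def algebra_simps)
    finally show "2 * inner (G *v f) (H \<zeta> *v (P *v f)) - inner (P *v f) ((k *\<^sub>R H \<zeta> + Hd \<zeta>) *v (P *v f)) \<le> - (norm f)\<^sup>2"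
      unfolding a_def .
  qed
  with k0 show ?thesis by (rule that)
qed

text \<open>The multiplier \<open>m H P H\<close> with \<open>m = e\<^sup>k\<^sup>\<zeta>\<close> turns \<open>2 \<langle>A x, m H P H x\<rangle>\<close> into the \<open>\<zeta>\<close>-derivative of
  \<open>m \<langle>P g, H P g\<rangle>\<close>, \<open>g = H x\<close>, up to terms quadratic in \<open>g\<close> that \<open>m' = k m\<close> dominates for large \<open>k\<close>.\<close>

lemma multiplier_estimate:
  obtains L b where "bounded_linear L" "\<And>u v. inner (L u) v = inner u (L v)" "0 \<le> b"
    "\<And>x. x \<in> L2 \<Longrightarrow> ham H x \<in> H1 \<Longrightarrow> 2 * inner (abs_l2 (phs_operator P G H x)) (L (abs_l2 x))
        \<le> b * ((norm (ac_rep (ham H x) 1))\<^sup>2 + (norm (ac_rep (ham H x) 0))\<^sup>2) - (norm (mult_op H (abs_l2 x)))\<^sup>2"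
proof -
  obtain \<pi> where \<pi>: "\<pi> > 0" "\<And>v. norm (P *v v) \<le> \<pi> * norm v" by (rule matrix_vector_mult_bounded[of P]) blast
  obtain k where k: "0 \<le> k" "AE \<zeta> in unit_measure. \<forall>f. 2 * inner (G *v f) (H \<zeta> *v (P *v f))
        - inner (P *v f) ((k *\<^sub>R H \<zeta> + Hd \<zeta>) *v (P *v f)) \<le> - (norm f)\<^sup>2"
    by (rule multiplier_pointwise)
  define m where "m \<zeta> = exp (k * \<zeta>)" for \<zeta> :: real
  have m_pos: "m \<zeta> > 0" for \<zeta> by (simp add: m_def)
  \<comment> \<open>\<open>N\<close> uses the smooth representative because it will be
    differentiated in \<zeta>. Almost everywhere the operator matrix \<open>B \<zeta>\<close>
    introduced below is \<open>N \<zeta> ** H \<zeta>\<close>.\<close>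
  define N where "N \<zeta> = m \<zeta> *\<^sub>R (Hc \<zeta> ** P)" for \<zeta>
  define Nd where "Nd \<zeta> = m \<zeta> *\<^sub>R ((k *\<^sub>R Hc \<zeta> + Hd \<zeta>) ** P)" for \<zeta>
  have N_AC: "has_AC_derivative N Nd" unfolding N_def Nd_def m_def by (rule weighted_AC)
  define B where "B \<zeta> = m \<zeta> *\<^sub>R (H \<zeta> ** (P ** H \<zeta>))" for \<zeta>
  have Bv: "B \<zeta> *v v = m \<zeta> *\<^sub>R (H \<zeta> *v (P *v (H \<zeta> *v v)))" for \<zeta> v
    by (simp add: B_def matrix_vector_mult_scaleR_left matrix_vector_mul_assoc)
  have B_measurable: "B \<in> borel_measurable unit_measure"
    unfolding B_def
  proof (intro borel_measurable_scaleR)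
    show "m \<in> borel_measurable unit_measure"
      unfolding m_def by (intro continuous_imp_measurable_on_sets_lebesgue continuous_intros) auto
    show "(\<lambda>\<zeta>. H \<zeta> ** (P ** H \<zeta>)) \<in> borel_measurable unit_measure"
      by (intro borel_measurable_bounded_bilinear[OF bounded_bilinear_matrix_mult] H_measurable borel_measurable_const)
  qed
  define C where "C = exp k * (h * (\<pi> * h))"
  have C0: "0 \<le> C" using \<pi>(1) H_upper(1) by (simp add: C_def)
  have B_bound: "AE \<zeta> in unit_measure. \<forall>v. norm (B \<zeta> *v v) \<le> C * norm v"
    using H_upper(2) AE_space
  proof (eventually_elim, intro allI)
    fix \<zeta> v assume up: "\<forall>v. norm (H \<zeta> *v v) \<le> h * norm v" and \<zeta>: "\<zeta> \<in> space unit_measure"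
    have "m \<zeta> \<le> exp k" using \<zeta> k(1) by (simp add: m_def mult_left_le)
    moreover have "norm (H \<zeta> *v (P *v (H \<zeta> *v v))) \<le> h * (\<pi> * (h * norm v))"
      using up \<pi> H_upper(1) by (intro order_trans[OF up[rule_format]] mult_left_mono order_trans[OF \<pi>(2)]) auto
    ultimately have "m \<zeta> * norm (H \<zeta> *v (P *v (H \<zeta> *v v))) \<le> exp k * (h * (\<pi> * (h * norm v)))"
      by (intro mult_mono) auto
    then show "norm (B \<zeta> *v v) \<le> C * norm v" using m_pos[of \<zeta>] by (simp add: Bv C_def ac_simps)
  qed
  have B_symmetric: "AE \<zeta> in unit_measure. \<forall>v w. inner (B \<zeta> *v v) w = inner v (B \<zeta> *v w)"
    using H_hermitian by eventually_elim (simp add: Bv hermitian_inner P_hermitian)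
  obtain n1 where n1: "n1 > 0" "\<And>v. norm (N 1 *v v) \<le> n1 * norm v" by (rule matrix_vector_mult_bounded[of "N 1"]) blast
  obtain n0 where n0: "n0 > 0" "\<And>v. norm (N 0 *v v) \<le> n0 * norm v" by (rule matrix_vector_mult_bounded[of "N 0"]) blast
  define b where "b = \<pi> * (n1 + n0)"
  have b0: "0 \<le> b" using \<pi>(1) n1(1) n0(1) by (simp add: b_def)
  show ?thesis
  proof (rule that[OF bounded_linear_mult_op[OF B_measurable C0 B_bound] mult_op_symmetric[OF B_measurable C0 B_bound B_symmetric] b0])
    fix x :: "real \<Rightarrow> complex^'n" assume x: "x \<in> L2" "ham H x \<in> H1"
    define g where "g = ac_rep (ham H x)"
    define g' where "g' = H1_deriv (ham H x)"
    define z where "z = phs_operator P G H x"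
    note facts = ham_AE_eq_effort[OF x] effort_AC[OF x] effort_L2[OF x] gen_L2[OF x] gen_AE[OF x] P_effort_AC[OF x] abs_l2_effort[OF x]
    note facts = facts[folded g_def g'_def z_def]
    define W where "W \<zeta> = inner (P *v g' \<zeta>) (N \<zeta> *v g \<zeta>) + inner (P *v g \<zeta>) (Nd \<zeta> *v g \<zeta> + N \<zeta> *v g' \<zeta>)" for \<zeta>
    have AC: "has_AC_derivative (\<lambda>\<zeta>. inner (P *v g \<zeta>) (N \<zeta> *v g \<zeta>)) W"
      unfolding W_def
      by (rule has_AC_derivative_prod[OF bounded_bilinear_inner facts(6)
            has_AC_derivative_prod[OF bounded_bilinear_matrix_vector_mult N_AC facts(2)]])
    have BL: "(\<lambda>\<zeta>. B \<zeta> *v x \<zeta>) \<in> L2" by (rule L2_matrix_mult[OF B_measurable B_bound x(1)])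
    have "2 * inner (abs_l2 z) (mult_op B (abs_l2 x)) = (LINT \<zeta>|unit_measure. 2 * inner (z \<zeta>) (B \<zeta> *v x \<zeta>))"
      by (simp add: mult_op_abs_l2[OF B_measurable C0 B_bound x(1)] inner_abs_l2 facts(4) BL)
    also have "\<dots> \<le> (LINT \<zeta>|unit_measure. W \<zeta> - (norm (g \<zeta>))\<^sup>2)"
    proof (rule integral_mono_AE)
      show "integrable unit_measure (\<lambda>\<zeta>. 2 * inner (z \<zeta>) (B \<zeta> *v x \<zeta>))"
        using L2_integrable_inner[OF facts(4) BL] by simp
      show "integrable unit_measure (\<lambda>\<zeta>. W \<zeta> - (norm (g \<zeta>))\<^sup>2)"
        by (intro Bochner_Integration.integrable_diff has_AC_derivativeD(1)[OF AC] L2_integrable_norm_sq facts(3))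
      show "AE \<zeta> in unit_measure. 2 * inner (z \<zeta>) (B \<zeta> *v x \<zeta>) \<le> W \<zeta> - (norm (g \<zeta>))\<^sup>2"
        using facts(1) facts(5) H_hermitian H_eq k(2) AE_space
      proof eventually_elim
        case (elim \<zeta>)
        define a where "a = P *v g \<zeta>"
        \<comment> \<open>What remains of the integrand, divided by the weight, once the exact
          derivative \<open>W\<close> is removed.\<close>
        define d where "d = 2 * inner (G *v g \<zeta>) (H \<zeta> *v a) - inner a ((k *\<^sub>R H \<zeta> + Hd \<zeta>) *v a)"
        have d: "d \<le> - (norm (g \<zeta>))\<^sup>2" unfolding d_def a_def using elim(5) by blast
        have m1: "1 \<le> m \<zeta>" using k(1) elim(6) by (simp add: m_def)
        have Hx: "H \<zeta> *v x \<zeta> = g \<zeta>" using elim(1) by (simp add: ham_def)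
        have N: "N \<zeta> *v v = m \<zeta> *\<^sub>R (H \<zeta> *v (P *v v))" for v
          by (simp add: N_def matrix_vector_mult_scaleR_left matrix_vector_mul_assoc elim(4))
        have Nd: "Nd \<zeta> *v v = m \<zeta> *\<^sub>R ((k *\<^sub>R H \<zeta> + Hd \<zeta>) *v (P *v v))" for v
          by (simp add: Nd_def matrix_vector_mult_scaleR_left matrix_vector_mul_assoc elim(4))
        have sym: "inner a (H \<zeta> *v (P *v g' \<zeta>)) = inner (P *v g' \<zeta>) (H \<zeta> *v a)"
          using hermitian_inner[OF elim(3), of a "P *v g' \<zeta>"] by (simp add: inner_commute)
        have "W \<zeta> = m \<zeta> * (2 * inner (P *v g' \<zeta>) (H \<zeta> *v a) + inner a ((k *\<^sub>R H \<zeta> + Hd \<zeta>) *v a))"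
          unfolding W_def N Nd a_def[symmetric] inner_add_right inner_scaleR_right sym by (simp add: algebra_simps)
        then have "2 * inner (z \<zeta>) (B \<zeta> *v x \<zeta>) = W \<zeta> + m \<zeta> * d"
          unfolding Bv Hx a_def[symmetric] elim(2) d_def inner_add_left inner_scaleR_right by (simp add: algebra_simps)
        also have "m \<zeta> * d \<le> 1 * d" using m1 d zero_le_power2[of "norm (g \<zeta>)"] by (intro mult_right_mono_neg) linarith+
        finally show ?case using d by simp
      qed
    qed
    also have "\<dots> = (LINT \<zeta>|unit_measure. W \<zeta>) - (norm (abs_l2 g))\<^sup>2"
      using has_AC_derivativeD(1)[OF AC] L2_integrable_norm_sq[OF facts(3)] by (simp add: norm_abs_l2_sq facts(3))
    also have "(LINT \<zeta>|unit_measure. W \<zeta>) = inner (P *v g 1) (N 1 *v g 1) - inner (P *v g 0) (N 0 *v g 0)"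
      using has_AC_derivativeD(2)[OF AC, of 1] by simp
    also have "\<dots> \<le> b * ((norm (g 1))\<^sup>2 + (norm (g 0))\<^sup>2)"
    proof -
      have "\<bar>inner (P *v v) (M *v v)\<bar> \<le> \<pi> * n * (norm v)\<^sup>2" if "\<And>v. norm (M *v v) \<le> n * norm v" for M :: "complex^'n^'n" and n v
      proof -
        have "\<bar>inner (P *v v) (M *v v)\<bar> \<le> norm (P *v v) * norm (M *v v)" by (rule Cauchy_Schwarz_ineq2)
        also have "\<dots> \<le> (\<pi> * norm v) * (n * norm v)" using \<pi> that by (intro mult_mono) auto
        finally show ?thesis by (simp add: power2_eq_square ac_simps)
      qed
      from this[OF n1(2), of "g 1"] this[OF n0(2), of "g 0"]
      have "inner (P *v g 1) (N 1 *v g 1) - inner (P *v g 0) (N 0 *v g 0) \<le> \<pi> * n1 * (norm (g 1))\<^sup>2 + \<pi> * n0 * (norm (g 0))\<^sup>2"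
        by linarith
      also have "\<dots> \<le> b * ((norm (g 1))\<^sup>2 + (norm (g 0))\<^sup>2)"
        using \<pi>(1) n1(1) n0(1) by (simp add: b_def algebra_simps)
      finally show ?thesis .
    qed
    finally show "2 * inner (abs_l2 (phs_operator P G H x)) (mult_op B (abs_l2 x))
        \<le> b * ((norm (ac_rep (ham H x) 1))\<^sup>2 + (norm (ac_rep (ham H x) 0))\<^sup>2) - (norm (mult_op H (abs_l2 x)))\<^sup>2"
      by (simp add: g_def z_def facts(7)[unfolded g_def] ham_mult_op x)
  qed
qed

end

section \<open>The semigroup on equivalence classes\<close>

lemma bounded_bilinear_cinner: "bounded_bilinear (cinner :: complex^'n \<Rightarrow> complex^'n \<Rightarrow> complex)"
proof -
  have "linear (\<lambda>v. cinner u v)" for u :: "complex^'n"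
    by (rule linearI) (simp_all add: cinner_def sum.distrib distrib_left scaleR_sum_right)
  moreover have "linear (\<lambda>u. cinner u v)" for v :: "complex^'n"
    by (rule linearI) (simp_all add: cinner_def sum.distrib distrib_right scaleR_sum_right)
  ultimately show ?thesis
    unfolding bilinear_conv_bounded_bilinear[symmetric] bilinear_def by blast
qed

text \<open>Integrability of the complex product is shown first, so that the real part may be moved
  through the integral.\<close>

lemma Re_L2_inner:
  assumes "x \<in> L2" "y \<in> L2"
  shows "Re (L2_inner x y) = inner (abs_l2 x) (abs_l2 y)"
proof -
  obtain K where K: "K > 0" "\<And>u v :: complex^'a. norm (cinner u v) \<le> norm u * norm v * K"
    using bounded_bilinear.pos_bounded[OF bounded_bilinear_cinner] by blast
  have "integrable unit_measure (\<lambda>\<zeta>. cinner (x \<zeta>) (y \<zeta>))"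
  proof (rule Bochner_Integration.integrable_bound)
    show "integrable unit_measure (\<lambda>\<zeta>. ((norm (x \<zeta>))\<^sup>2 + (norm (y \<zeta>))\<^sup>2) * K)"
      using assms[THEN L2_integrable_norm_sq] by simp
    show "(\<lambda>\<zeta>. cinner (x \<zeta>) (y \<zeta>)) \<in> borel_measurable unit_measure"
      by (rule borel_measurable_bounded_bilinear[OF bounded_bilinear_cinner assms[THEN L2_borel_measurable]])
    show "AE \<zeta> in unit_measure. norm (cinner (x \<zeta>) (y \<zeta>)) \<le> norm (((norm (x \<zeta>))\<^sup>2 + (norm (y \<zeta>))\<^sup>2) * K)"
    proof (rule AE_I2)
      fix \<zeta>
      have "norm (x \<zeta>) * norm (y \<zeta>) \<le> (norm (x \<zeta>))\<^sup>2 + (norm (y \<zeta>))\<^sup>2"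
        using sum_squares_bound[of "norm (x \<zeta>)" "norm (y \<zeta>)"]
          mult_nonneg_nonneg[OF norm_ge_zero norm_ge_zero, of "x \<zeta>" "y \<zeta>"] by linarith
      then have "norm (x \<zeta>) * norm (y \<zeta>) * K \<le> ((norm (x \<zeta>))\<^sup>2 + (norm (y \<zeta>))\<^sup>2) * K"
        using K(1) by (intro mult_right_mono) auto
      then show "norm (cinner (x \<zeta>) (y \<zeta>)) \<le> norm (((norm (x \<zeta>))\<^sup>2 + (norm (y \<zeta>))\<^sup>2) * K)"
        using order_trans[OF K(2)] K(1) by (simp add: abs_mult)
    qed
  qed
  then show ?thesis
    unfolding L2_inner_def inner_abs_l2[OF assms] Re_cinner[symmetric]
    by (rule integral_bounded_linear[OF bounded_linear_Re, symmetric])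
qed

lemma has_AC_derivative_diff:
  assumes "has_AC_derivative u u'" "has_AC_derivative v v'"
  shows "has_AC_derivative (\<lambda>s. u s - v s) (\<lambda>s. u' s - v' s)"
  unfolding has_AC_derivative_def
proof (intro conjI ballI)
  note i = assms[THEN has_AC_derivativeD(1)]
  show "integrable unit_measure (\<lambda>s. u' s - v' s)" using i by simp
  fix s :: real assume s: "s \<in> {0..1}"
  have "(LINT r|lebesgue_on {0..s}. u' r - v' r) = (LINT r|lebesgue_on {0..s}. u' r) - (LINT r|lebesgue_on {0..s}. v' r)"
    by (rule Bochner_Integration.integral_diff; rule integrable_lebesgue_on_subinterval[OF _ s]; rule i)
  then show "u s - v s = u 0 - v 0 + (LINT r|lebesgue_on {0..s}. u' r - v' r)"
    using assms[THEN has_AC_derivativeD(2), OF s] by (simp add: algebra_simps)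
qed

lemma smult_of_real: "complex_of_real c *s v = c *\<^sub>R (v :: complex^'n)"
  by (simp add: vec_eq_iff) (simp add: scaleR_conv_of_real)

definition l2_lift :: "((real \<Rightarrow> complex^'n) \<Rightarrow> (real \<Rightarrow> complex^'n)) \<Rightarrow> 'n l2 \<Rightarrow> 'n l2" where
  "l2_lift F u = abs_l2 (F (rep_l2 u))"

context phs_coefficients
begin

section \<open>Equivalence of the energy norm and the standard norm\<close>

lemma energy_norm_eq:
  assumes "x \<in> L2"
  shows "energy_norm H x = sqrt (inner (abs_l2 x) (mult_op H (abs_l2 x)))"
  by (simp add: energy_norm_def Re_L2_inner assms ham_L2 ham_mult_op)

lemma energy_nonneg: "0 \<le> inner u (mult_op H u)"
  using H_op_lower[of u] H_lower(1) by (meson less_imp_le mult_nonneg_nonneg order_trans zero_le_power2)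

lemma energy_norm_lower:
  assumes "x \<in> L2"
  shows "norm (abs_l2 x) \<le> energy_norm H x / sqrt l"
proof -
  have "sqrt (l * (norm (abs_l2 x))\<^sup>2) \<le> energy_norm H x"
    unfolding energy_norm_eq[OF assms] by (rule real_sqrt_le_mono[OF H_op_lower])
  then show ?thesis using H_lower(1) by (simp add: real_sqrt_mult field_simps)
qed

lemma energy_norm_upper:
  assumes "x \<in> L2"
  shows "energy_norm H x \<le> sqrt h * norm (abs_l2 x)"
proof -
  let ?u = "abs_l2 x"
  have "inner ?u (mult_op H ?u) \<le> norm ?u * norm (mult_op H ?u)" by (rule norm_cauchy_schwarz)
  also have "\<dots> \<le> norm ?u * (h * norm ?u)"
    by (intro mult_left_mono norm_mult_op_le[OF H_measurable less_imp_le[OF H_upper(1)] H_upper(2)]) simp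
  finally have "energy_norm H x \<le> sqrt (h * (norm ?u)\<^sup>2)"
    unfolding energy_norm_eq[OF assms] by (intro real_sqrt_le_mono) (simp add: power2_eq_square ac_simps)
  then show ?thesis by (simp add: real_sqrt_mult)
qed

lemma energy_norm_nonneg: "x \<in> L2 \<Longrightarrow> 0 \<le> energy_norm H x"
  by (simp add: energy_norm_eq energy_nonneg)

text \<open>Membership in \<open>L2\<close> is asked only on \<open>S\<close>, because orbits and
  their difference quotients are known to lie in \<open>L2\<close> only for nonnegative
  times.\<close>

lemma energy_norm_tendsto_iff:
  assumes "\<And>t. t \<in> S \<Longrightarrow> f t \<in> L2"
  shows "((\<lambda>t. energy_norm H (f t)) \<longlongrightarrow> 0) (at a within S) \<longleftrightarrow> ((\<lambda>t. abs_l2 (f t)) \<longlongrightarrow> 0) (at a within S)"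
proof
  assume "((\<lambda>t. energy_norm H (f t)) \<longlongrightarrow> 0) (at a within S)"
  then have "((\<lambda>t. energy_norm H (f t) / sqrt l) \<longlongrightarrow> 0) (at a within S)"
    using tendsto_divide_zero by blast
  then show "((\<lambda>t. abs_l2 (f t)) \<longlongrightarrow> 0) (at a within S)"
    by (rule Lim_null_comparison[rotated]) (auto simp: eventually_at_filter assms energy_norm_lower)
next
  assume "((\<lambda>t. abs_l2 (f t)) \<longlongrightarrow> 0) (at a within S)"
  then have "((\<lambda>t. sqrt h * norm (abs_l2 (f t))) \<longlongrightarrow> 0) (at a within S)"
    using tendsto_mult_right_zero tendsto_norm_zero by blast
  then show "((\<lambda>t. energy_norm H (f t)) \<longlongrightarrow> 0) (at a within S)"
    by (rule Lim_null_comparison[rotated])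
      (auto simp: eventually_at_filter assms energy_norm_upper energy_norm_nonneg)
qed

text \<open>Solving the operator equation for the derivative of the effort gives
  \<open>P u' = z - G u\<close>, and \<open>P\<close> is bounded below; so the state and its image
  under the operator bound the effort and its derivative, hence point values. Subtracting two
  efforts directly avoids asking whether the choice \<open>ac_rep\<close> is additive.\<close>

lemma trace_diff_bound:
  obtains K where "0 \<le> K"
    "\<And>x w s. x \<in> L2 \<Longrightarrow> ham H x \<in> H1 \<Longrightarrow> w \<in> L2 \<Longrightarrow> ham H w \<in> H1 \<Longrightarrow> s \<in> {0..1} \<Longrightarrow>
      norm (ac_rep (ham H x) s - ac_rep (ham H w) s) \<le>
        K * (norm (abs_l2 x - abs_l2 w) + norm (abs_l2 (phs_operator P G H x) - abs_l2 (phs_operator P G H w)))"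
proof -
  obtain \<gamma> where \<gamma>: "\<gamma> > 0" "\<And>v. norm (G *v v) \<le> \<gamma> * norm v" by (rule matrix_vector_mult_bounded[of G]) blast
  \<comment> \<open>\<open>h\<close> bounds the effort itself; the rest bounds its derivative, where
    \<open>P_lower\<close> costs \<open>p\<close> and the \<open>G\<close> term contributes
    \<open>\<gamma> * h\<close>.\<close>
  define K where "K = h + p * (1 + \<gamma> * h)"
  have K0: "0 \<le> K" unfolding K_def using H_upper(1) P_lower(1) \<gamma>(1) by simp
  show ?thesis
  proof (rule that[OF K0])
    fix x w :: "real \<Rightarrow> complex^'n" and s :: real
    assume x: "x \<in> L2" "ham H x \<in> H1" and w: "w \<in> L2" "ham H w \<in> H1" and s: "s \<in> {0..1}"
    define u where "u \<zeta> = ac_rep (ham H x) \<zeta> - ac_rep (ham H w) \<zeta>" for \<zeta>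
    define u' where "u' \<zeta> = H1_deriv (ham H x) \<zeta> - H1_deriv (ham H w) \<zeta>" for \<zeta>
    define z where "z \<zeta> = phs_operator P G H x \<zeta> - phs_operator P G H w \<zeta>" for \<zeta>
    have AC: "has_AC_derivative u u'"
      unfolding u_def u'_def by (rule has_AC_derivative_diff[OF effort_AC[OF x] effort_AC[OF w]])
    have L: "u \<in> L2" "u' \<in> L2" "z \<in> L2"
      unfolding u_def[abs_def] u'_def[abs_def] z_def[abs_def]
      by (intro L2_diff effort_L2 effort_deriv_L2 gen_L2 x w)+
    have PL: "(\<lambda>\<zeta>. P *v u' \<zeta>) \<in> L2" and GL: "(\<lambda>\<zeta>. G *v u \<zeta>) \<in> L2"
      by (intro L2_const_mult[OF x] L)+
    define X where "X = abs_l2 x - abs_l2 w"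
    define Z where "Z = abs_l2 (phs_operator P G H x) - abs_l2 (phs_operator P G H w)"
    have "abs_l2 u = abs_l2 (ham H x) - abs_l2 (ham H w)"
      unfolding u_def[abs_def] by (simp add: abs_l2_diff[symmetric] effort_L2 x w abs_l2_effort)
    also have "\<dots> = mult_op H X"
      unfolding X_def linear_diff[OF bounded_linear.linear[OF H_op]] by (simp add: ham_mult_op x w)
    finally have u: "norm (abs_l2 u) \<le> h * norm X"
      using norm_mult_op_le[OF H_measurable less_imp_le[OF H_upper(1)] H_upper(2), of X] by simp
    have "AE \<zeta> in unit_measure. P *v u' \<zeta> = z \<zeta> - G *v u \<zeta>"
      using gen_AE[OF x] gen_AE[OF w]
      by eventually_elim (simp add: u_def u'_def z_def matrix_vector_mult_diff_distrib)
    then have "abs_l2 (\<lambda>\<zeta>. P *v u' \<zeta>) = abs_l2 z - abs_l2 (\<lambda>\<zeta>. G *v u \<zeta>)"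
      by (simp add: abs_l2_diff L GL abs_l2_eq_iff PL L2_diff)
    also have "abs_l2 z = Z" unfolding z_def[abs_def] Z_def by (simp add: abs_l2_diff gen_L2 x w)
    finally have "norm (abs_l2 (\<lambda>\<zeta>. P *v u' \<zeta>)) \<le> norm Z + norm (abs_l2 (\<lambda>\<zeta>. G *v u \<zeta>))"
      by (simp add: norm_triangle_ineq4)
    moreover have "norm (abs_l2 (\<lambda>\<zeta>. G *v u \<zeta>)) \<le> \<gamma> * norm (abs_l2 u)"
      by (rule norm_abs_l2_mono[OF L(1) GL]) (use \<gamma> in auto)
    moreover have "\<gamma> * norm (abs_l2 u) \<le> \<gamma> * (h * norm X)" using u \<gamma>(1) by simp
    ultimately have Pu': "norm (abs_l2 (\<lambda>\<zeta>. P *v u' \<zeta>)) \<le> norm Z + \<gamma> * h * norm X" by simp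
    have "norm (abs_l2 u') \<le> p * norm (abs_l2 (\<lambda>\<zeta>. P *v u' \<zeta>))"
      by (rule norm_abs_l2_mono[OF PL L(2)]) (use P_lower in auto)
    also have "\<dots> \<le> p * (norm Z + \<gamma> * h * norm X)" using Pu' P_lower(1) by simp
    finally have "norm (u s) \<le> h * norm X + p * (norm Z + \<gamma> * h * norm X)"
      using has_AC_derivative_trace_bound[OF AC L(1,2) s] u by linarith
    also have "\<dots> = K * (norm X + norm Z) - h * norm Z - p * \<gamma> * h * norm Z - p * norm X"
      by (simp add: K_def algebra_simps)
    also have "\<dots> \<le> K * (norm X + norm Z)"
    proof -
      have "0 \<le> h * norm Z" "0 \<le> p * \<gamma> * h * norm Z" "0 \<le> p * norm X"
        using H_upper(1) P_lower(1) \<gamma>(1) by auto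
      then show ?thesis by linarith
    qed
    finally show "norm (ac_rep (ham H x) s - ac_rep (ham H w) s) \<le>
        K * (norm (abs_l2 x - abs_l2 w) + norm (abs_l2 (phs_operator P G H x) - abs_l2 (phs_operator P G H w)))"
      by (simp add: u_def X_def Z_def)
  qed
qed

end

locale phs_semigroup = phs_coefficients P G H Hc Hd p h l
  for P G :: "complex^'n^'n" and H Hc Hd :: "real \<Rightarrow> complex^'n^'n" and p h l :: real +
  fixes D :: "(real \<Rightarrow> complex^'n) set" and T :: "real \<Rightarrow> (real \<Rightarrow> complex^'n) \<Rightarrow> (real \<Rightarrow> complex^'n)"
  assumes generates: "generates_C0_semigroup (energy_norm H) D (phs_operator P G H) T"
begin

lemma C0: "C0_semigroup (energy_norm H) T"
  using generates by (simp add: generates_C0_semigroup_def)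

lemma T_L2: "0 \<le> t \<Longrightarrow> x \<in> L2 \<Longrightarrow> T t x \<in> L2"
  using C0 by (simp add: C0_semigroup_def)

lemma T_linear:
  assumes "0 \<le> t" "x \<in> L2" "y \<in> L2"
  shows "AE \<zeta> in unit_measure. T t (\<lambda>\<zeta>. a *\<^sub>R x \<zeta> + b *\<^sub>R y \<zeta>) \<zeta> = a *\<^sub>R T t x \<zeta> + b *\<^sub>R T t y \<zeta>"
proof -
  have "AE \<zeta> in unit_measure. T t (\<lambda>\<zeta>. complex_of_real a *s x \<zeta> + complex_of_real b *s y \<zeta>) \<zeta>
      = complex_of_real a *s T t x \<zeta> + complex_of_real b *s T t y \<zeta>"
    using C0 assms unfolding C0_semigroup_def by blast
  then show ?thesis by (simp add: smult_of_real)
qed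

lemma abs_T_linear:
  assumes "0 \<le> t" "x \<in> L2" "y \<in> L2"
  shows "abs_l2 (T t (\<lambda>\<zeta>. a *\<^sub>R x \<zeta> + b *\<^sub>R y \<zeta>)) = a *\<^sub>R abs_l2 (T t x) + b *\<^sub>R abs_l2 (T t y)"
  using T_linear[OF assms, of a b] assms
  by (simp add: abs_l2_add abs_l2_scaleR L2_add L2_scaleR T_L2 abs_l2_eq_iff)

lemma T_bounded:
  assumes "0 \<le> t"
  obtains C where "0 \<le> C" "\<And>x. x \<in> L2 \<Longrightarrow> norm (abs_l2 (T t x)) \<le> C * norm (abs_l2 x)"
proof -
  have "\<forall>t\<ge>0. \<exists>C. \<forall>x\<in>L2. energy_norm H (T t x) \<le> C * energy_norm H x"
    using C0 by (simp add: C0_semigroup_def)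
  then obtain C where C: "\<And>x. x \<in> L2 \<Longrightarrow> energy_norm H (T t x) \<le> C * energy_norm H x"
    using assms by meson
  have "norm (abs_l2 (T t x)) \<le> (\<bar>C\<bar> * sqrt h / sqrt l) * norm (abs_l2 x)" if x: "x \<in> L2" for x
  proof -
    have "energy_norm H (T t x) \<le> \<bar>C\<bar> * energy_norm H x"
      using C[OF x] mult_right_mono[OF abs_ge_self energy_norm_nonneg[OF x], of C] by linarith
    also have "\<dots> \<le> \<bar>C\<bar> * (sqrt h * norm (abs_l2 x))" by (intro mult_left_mono energy_norm_upper x) simp
    finally have "energy_norm H (T t x) / sqrt l \<le> \<bar>C\<bar> * (sqrt h * norm (abs_l2 x)) / sqrt l"
      using H_lower(1) by (intro divide_right_mono) auto
    then show ?thesis using energy_norm_lower[OF T_L2[OF assms x]] by (simp add: mult.assoc)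
  qed
  moreover have "0 \<le> \<bar>C\<bar> * sqrt h / sqrt l" using H_upper(1) H_lower(1) by simp
  ultimately show ?thesis using that by blast
qed

abbreviation U :: "real \<Rightarrow> 'n l2 \<Rightarrow> 'n l2" where "U t \<equiv> l2_lift (T t)"

text \<open>Compatibility of \<open>T t\<close> with equality almost everywhere is not an axiom. It
  follows from linearity and boundedness: the difference of two representatives has norm 0, and so
  has its image.\<close>

lemma U_abs_l2:
  assumes "0 \<le> t" "x \<in> L2"
  shows "U t (abs_l2 x) = abs_l2 (T t x)"
proof -
  define y where "y = rep_l2 (abs_l2 x)"
  have y: "y \<in> L2" "abs_l2 y = abs_l2 x" by (simp_all add: y_def rep_l2_L2 abs_rep_l2)
  obtain C where C: "\<And>x. x \<in> L2 \<Longrightarrow> norm (abs_l2 (T t x)) \<le> C * norm (abs_l2 x)"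
    using T_bounded[OF assms(1)] by blast
  \<comment> \<open>The difference is spelled as a linear combination to match the form of the
    linearity axiom.\<close>
  define d where "d = (\<lambda>\<zeta>. 1 *\<^sub>R y \<zeta> + (- 1) *\<^sub>R x \<zeta>)"
  have dL: "d \<in> L2" unfolding d_def by (intro L2_add L2_scaleR y assms)
  have "abs_l2 d = 1 *\<^sub>R abs_l2 y + (- 1) *\<^sub>R abs_l2 x"
    unfolding d_def by (simp only: abs_l2_add abs_l2_scaleR L2_scaleR y(1) assms(2))
  then have "abs_l2 d = 0" by (simp add: y)
  then have "abs_l2 (T t d) = 0" using C[OF dL] by simp
  then show ?thesis
    using abs_T_linear[OF assms(1) y(1) assms(2), of 1 "-1"] by (simp add: d_def l2_lift_def y_def[symmetric])
qed

sublocale banach_C0_semigroup U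
proof (rule banach_C0_semigroup.intro)
  fix t :: real assume t: "0 \<le> t"
  obtain C where C: "\<And>x. x \<in> L2 \<Longrightarrow> norm (abs_l2 (T t x)) \<le> C * norm (abs_l2 x)"
    using T_bounded[OF t] by blast
  show "bounded_linear (U t)"
  proof (rule bounded_linear_intro)
    fix u v :: "'n l2" and c :: real
    obtain x y where x: "x \<in> L2" "u = abs_l2 x" and y: "y \<in> L2" "v = abs_l2 y" by (metis l2_cases)
    show "U t (u + v) = U t u + U t v"
      using abs_T_linear[OF t x(1) y(1), of 1 1] by (simp add: x y abs_l2_add U_abs_l2 t L2_add)
    show "U t (c *\<^sub>R u) = c *\<^sub>R U t u"
      using abs_T_linear[OF t x(1) x(1), of c 0] by (simp add: x abs_l2_scaleR U_abs_l2 t L2_scaleR)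
    show "norm (U t u) \<le> norm u * C" using C[OF x(1)] by (simp add: x U_abs_l2 t mult.commute)
  qed
next
  fix u :: "'n l2"
  obtain x where x: "x \<in> L2" "u = abs_l2 x" by (metis l2_cases)
  have "AE \<zeta> in unit_measure. T 0 x \<zeta> = x \<zeta>" using C0 x(1) by (simp add: C0_semigroup_def)
  then show "U 0 u = u" by (simp add: x U_abs_l2 abs_l2_eq_iff T_L2)
  have lim: "((\<lambda>t. energy_norm H (\<lambda>\<zeta>. T t x \<zeta> - x \<zeta>)) \<longlongrightarrow> 0) (at_right 0)"
    using C0 x(1) by (simp add: C0_semigroup_def)
  have "((\<lambda>t. abs_l2 (\<lambda>\<zeta>. T t x \<zeta> - x \<zeta>)) \<longlongrightarrow> 0) (at_right 0)"
    using lim by (subst (asm) energy_norm_tendsto_iff) (auto intro!: L2_diff T_L2 x)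
  moreover have "\<forall>\<^sub>F t in at_right 0. abs_l2 (\<lambda>\<zeta>. T t x \<zeta> - x \<zeta>) = U t u - u"
    by (auto simp: eventually_at_filter x U_abs_l2 abs_l2_diff T_L2)
  ultimately have "((\<lambda>t. U t u - u) \<longlongrightarrow> 0) (at_right 0)" by (rule Lim_transform_eventually)
  then show "((\<lambda>t. U t u) \<longlongrightarrow> u) (at_right 0)" by (rule LIM_zero_cancel)
next
  fix s t :: real and u :: "'n l2" assume s: "0 \<le> s" and t: "0 \<le> t"
  obtain x where x: "x \<in> L2" "u = abs_l2 x" by (metis l2_cases)
  have "AE \<zeta> in unit_measure. T (s + t) x \<zeta> = T s (T t x) \<zeta>" using C0 s t x(1) by (simp add: C0_semigroup_def)
  then show "U (s + t) u = U s (U t u)" using s t by (simp add: x U_abs_l2 T_L2 abs_l2_eq_iff)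
qed

lemma generator_limit_iff:
  assumes "x \<in> L2" "z \<in> L2"
  shows "generator_limit (energy_norm H) T x z \<longleftrightarrow>
    ((\<lambda>h. (1 / h) *\<^sub>R (U h (abs_l2 x) - abs_l2 x)) \<longlongrightarrow> abs_l2 z) (at_right 0)"
proof -
  have L: "(\<lambda>\<zeta>. (1 / h) *\<^sub>R (T h x \<zeta> - x \<zeta>) - z \<zeta>) \<in> L2" if "h \<in> {0<..}" for h
    using that assms by (intro L2_diff L2_scaleR T_L2) auto
  have "generator_limit (energy_norm H) T x z \<longleftrightarrow>
      ((\<lambda>h. abs_l2 (\<lambda>\<zeta>. (1 / h) *\<^sub>R (T h x \<zeta> - x \<zeta>) - z \<zeta>)) \<longlongrightarrow> 0) (at_right 0)"
    using assms(2) energy_norm_tendsto_iff[of "{0<..}" "\<lambda>h \<zeta>. (1 / h) *\<^sub>R (T h x \<zeta> - x \<zeta>) - z \<zeta>" 0, OF L]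
    by (simp add: generator_limit_def)
  also have "\<dots> \<longleftrightarrow> ((\<lambda>h. (1 / h) *\<^sub>R (U h (abs_l2 x) - abs_l2 x) - abs_l2 z) \<longlongrightarrow> 0) (at_right 0)"
  proof (rule filterlim_cong[OF refl refl])
    show "\<forall>\<^sub>F h in at_right 0. abs_l2 (\<lambda>\<zeta>. (1 / h) *\<^sub>R (T h x \<zeta> - x \<zeta>) - z \<zeta>)
        = (1 / h) *\<^sub>R (U h (abs_l2 x) - abs_l2 x) - abs_l2 z"
      by (auto simp: eventually_at_filter assms U_abs_l2 abs_l2_diff abs_l2_scaleR T_L2 L2_diff L2_scaleR)
  qed
  also have "\<dots> \<longleftrightarrow> ((\<lambda>h. (1 / h) *\<^sub>R (U h (abs_l2 x) - abs_l2 x)) \<longlongrightarrow> abs_l2 z) (at_right 0)"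
    by (rule LIM_zero_iff)
  finally show ?thesis .
qed

lemma D_L2: "x \<in> D \<Longrightarrow> x \<in> L2"
  and D_generator_limit: "x \<in> D \<Longrightarrow> generator_limit (energy_norm H) T x (phs_operator P G H x)"
  using generates by (auto simp: generates_C0_semigroup_def)

lemma D_operator_L2: "x \<in> D \<Longrightarrow> phs_operator P G H x \<in> L2"
  using D_generator_limit by (auto simp: generator_limit_def)

lemma D_difference_quotient:
  assumes "x \<in> D"
  shows "((\<lambda>h. (1 / h) *\<^sub>R (U h (abs_l2 x) - abs_l2 x)) \<longlongrightarrow> abs_l2 (phs_operator P G H x)) (at_right 0)"
  using D_generator_limit[OF assms] generator_limit_iff[OF D_L2[OF assms] D_operator_L2[OF assms]] by blast

text \<open>The quotients at \<open>T t x\<close> converge to the image of \<open>A x\<close>, so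
  \<open>T t x\<close> lies in the domain. Uniqueness of limits then identifies
  \<open>A (T t x)\<close> with \<open>T t (A x)\<close>, as classes only.\<close>

lemma T_D:
  assumes "x \<in> D" "0 \<le> t"
  shows "T t x \<in> D" "abs_l2 (phs_operator P G H (T t x)) = U t (abs_l2 (phs_operator P G H x))"
proof -
  let ?z = "phs_operator P G H x"
  note L = D_L2[OF assms(1)] D_operator_L2[OF assms(1)]
  have lim: "((\<lambda>h. (1 / h) *\<^sub>R (U h (abs_l2 (T t x)) - abs_l2 (T t x))) \<longlongrightarrow> abs_l2 (T t ?z)) (at_right 0)"
    using U_invariant_derivative[OF D_difference_quotient[OF assms(1)] assms(2)] assms(2) L by (simp add: U_abs_l2)
  then have "generator_limit (energy_norm H) T (T t x) (T t ?z)"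
    by (simp add: generator_limit_iff T_L2 assms(2) L)
  moreover have "D = {x \<in> L2. \<exists>z. generator_limit (energy_norm H) T x z}"
    using generates by (simp add: generates_C0_semigroup_def)
  ultimately show D: "T t x \<in> D" using T_L2[OF assms(2) L(1)] by blast
  show "abs_l2 (phs_operator P G H (T t x)) = U t (abs_l2 ?z)"
    using tendsto_unique[OF _ D_difference_quotient[OF D] lim] assms(2) L by (simp add: U_abs_l2)
qed

end

section \<open>Exact observability\<close>

lemma norm_column_block_mult_sq:
  fixes A :: "complex^'k^'n" and B :: "complex^'k^'m"
  assumes "A *v w = 0"
  shows "(norm (column_block A B *v w))\<^sup>2 = (norm (B *v w))\<^sup>2"
  by (simp add: column_block_mult norm_stack_vec_sq assms)

lemma continuous_on_stack_vec:
  fixes a :: "'t::topological_space \<Rightarrow> complex^'n" and b :: "'t \<Rightarrow> complex^'m"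
  assumes "continuous_on S a" "continuous_on S b"
  shows "continuous_on S (\<lambda>t. stack_vec (a t) (b t))"
  unfolding stack_vec_def
proof (intro continuous_on_vec_lambda)
  fix i :: "'n + 'm"
  show "continuous_on S (\<lambda>t. case i of Inl k \<Rightarrow> a t $ k | Inr k \<Rightarrow> b t $ k)"
    using assms by (cases i) (auto intro: continuous_on_component)
qed

locale observed_phs_semigroup = phs_semigroup P G H Hc Hd p h l "phs_domain H W\<^sub>B" T
  for P G :: "complex^'n^'n" and H Hc Hd :: "real \<Rightarrow> complex^'n^'n" and p h l :: real
    and W\<^sub>B W\<^sub>C :: "complex^('n + 'n)^'n"
    and T :: "real \<Rightarrow> (real \<Rightarrow> complex^'n) \<Rightarrow> (real \<Rightarrow> complex^'n)" +
  assumes W_invertible: "invertible (column_block W\<^sub>B W\<^sub>C)"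
begin

lemma domain_H1: "x \<in> phs_domain H W\<^sub>B \<Longrightarrow> ham H x \<in> H1"
  and domain_boundary: "x \<in> phs_domain H W\<^sub>B \<Longrightarrow> W\<^sub>B *v boundary_trace (ham H x) = 0"
  by (simp_all add: phs_domain_def)

text \<open>On the domain the invertible block matrix sends the boundary trace to a vector whose
  first half is 0 and whose second half is the output, so no part of the trace is invisible.\<close>

lemma trace_le_output:
  obtains K where "0 \<le> K" "\<And>x. x \<in> phs_domain H W\<^sub>B \<Longrightarrow>
    (norm (ac_rep (ham H x) 1))\<^sup>2 + (norm (ac_rep (ham H x) 0))\<^sup>2 \<le> K * (norm (W\<^sub>C *v boundary_trace (ham H x)))\<^sup>2"
proof -
  obtain K where K: "K > 0" "\<And>w. norm w \<le> K * norm (column_block W\<^sub>B W\<^sub>C *v w)"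
    by (rule matrix_left_inverse_bound[OF matrix_inv_left[OF W_invertible]]) blast
  have "(norm (ac_rep (ham H x) 1))\<^sup>2 + (norm (ac_rep (ham H x) 0))\<^sup>2 \<le> K\<^sup>2 * (norm (W\<^sub>C *v boundary_trace (ham H x)))\<^sup>2"
    if x: "x \<in> phs_domain H W\<^sub>B" for x
  proof -
    define w where "w = boundary_trace (ham H x)"
    have "(norm w)\<^sup>2 \<le> (K * norm (column_block W\<^sub>B W\<^sub>C *v w))\<^sup>2" by (rule power_mono[OF K(2)]) simp
    also have "\<dots> = K\<^sup>2 * (norm (W\<^sub>C *v w))\<^sup>2"
      using norm_column_block_mult_sq[of W\<^sub>B w W\<^sub>C] domain_boundary[OF x] by (simp add: w_def power_mult_distrib)
    finally show ?thesis by (simp add: w_def boundary_trace_def norm_stack_vec_sq)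
  qed
  then show ?thesis using that[of "K\<^sup>2"] by simp
qed

text \<open>Continuity of the orbit in the state space is too weak for boundary values.
  \<open>trace_diff_bound\<close> asks for continuity of \<open>T t x\<close> and of its image under
  the operator; the latter is again an orbit, that of \<open>A x\<close>.\<close>

lemma output_continuous:
  assumes x0: "x\<^sub>0 \<in> phs_domain H W\<^sub>B"
  shows "continuous_on {0..} (phs_output H W\<^sub>C T x\<^sub>0)"
proof -
  define X where "X t = U t (abs_l2 x\<^sub>0)" for t
  define Z where "Z t = U t (abs_l2 (phs_operator P G H x\<^sub>0))" for t
  obtain K where K: "0 \<le> K"
    "\<And>x w s. x \<in> L2 \<Longrightarrow> ham H x \<in> H1 \<Longrightarrow> w \<in> L2 \<Longrightarrow> ham H w \<in> H1 \<Longrightarrow> s \<in> {0..1} \<Longrightarrow>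
      norm (ac_rep (ham H x) s - ac_rep (ham H w) s) \<le>
        K * (norm (abs_l2 x - abs_l2 w) + norm (abs_l2 (phs_operator P G H x) - abs_l2 (phs_operator P G H w)))"
    by (rule trace_diff_bound) blast
  have XZ: "abs_l2 (T t x\<^sub>0) = X t" "abs_l2 (phs_operator P G H (T t x\<^sub>0)) = Z t" if "0 \<le> t" for t
    using that x0 D_L2[OF x0] by (simp_all add: X_def Z_def U_abs_l2 T_D)
  have trace: "continuous_on {0..} (\<lambda>t. ac_rep (ham H (T t x\<^sub>0)) s)" if s: "s \<in> {0..1}" for s
    unfolding continuous_on_def
  proof
    fix t :: real assume t: "t \<in> {0..}"
    have "(X \<longlongrightarrow> X t) (at t within {0..})" "(Z \<longlongrightarrow> Z t) (at t within {0..})"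
      using U_continuous t unfolding X_def Z_def continuous_on_def by blast+
    then have "((\<lambda>r. K * (norm (X r - X t) + norm (Z r - Z t))) \<longlongrightarrow> K * (norm (X t - X t) + norm (Z t - Z t))) (at t within {0..})"
      by (intro tendsto_intros)
    then have lim: "((\<lambda>r. K * (norm (X r - X t) + norm (Z r - Z t))) \<longlongrightarrow> 0) (at t within {0..})" by simp
    have bound: "norm (ac_rep (ham H (T r x\<^sub>0)) s - ac_rep (ham H (T t x\<^sub>0)) s) \<le> K * (norm (X r - X t) + norm (Z r - Z t))"
      if r: "r \<in> {0..}" for r
    proof -
      have r0: "0 \<le> r" and t0: "0 \<le> t" using r t by auto
      note Dr = T_D(1)[OF x0 r0] and Dt = T_D(1)[OF x0 t0]
      show ?thesis
        using K(2)[OF D_L2[OF Dr] domain_H1[OF Dr] D_L2[OF Dt] domain_H1[OF Dt] s] XZ[OF r0] XZ[OF t0] by simp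
    qed
    have "((\<lambda>r. ac_rep (ham H (T r x\<^sub>0)) s - ac_rep (ham H (T t x\<^sub>0)) s) \<longlongrightarrow> 0) (at t within {0..})"
      by (rule Lim_null_comparison[OF _ lim]) (use bound in \<open>auto simp: eventually_at_filter\<close>)
    then show "((\<lambda>r. ac_rep (ham H (T r x\<^sub>0)) s) \<longlongrightarrow> ac_rep (ham H (T t x\<^sub>0)) s) (at t within {0..})"
      by (rule LIM_zero_cancel)
  qed
  have "continuous_on {0..} (\<lambda>t. W\<^sub>C *v stack_vec (ac_rep (ham H (T t x\<^sub>0)) 1) (ac_rep (ham H (T t x\<^sub>0)) 0))"
    by (intro bounded_linear.continuous_on[OF bounded_linear_matrix_vector_mult] continuous_on_stack_vec trace) auto
  then show ?thesis by (simp add: phs_output_def[abs_def] boundary_trace_def)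
qed

theorem exact_observability:
  "\<exists>t\<^sub>0>0. \<exists>\<delta>>0. \<forall>x\<^sub>0\<in>phs_domain H W\<^sub>B.
    (LINT t|lebesgue_on {0..t\<^sub>0}. (norm (phs_output H W\<^sub>C T x\<^sub>0 t))\<^sup>2) \<ge> \<delta> * (energy_norm H x\<^sub>0)\<^sup>2"
proof -
  obtain \<kappa> where \<kappa>: "0 \<le> \<kappa>" "\<And>x. x \<in> phs_domain H W\<^sub>B \<Longrightarrow>
    (norm (ac_rep (ham H x) 1))\<^sup>2 + (norm (ac_rep (ham H x) 0))\<^sup>2 \<le> \<kappa> * (norm (W\<^sub>C *v boundary_trace (ham H x)))\<^sup>2"
    by (rule trace_le_output) blast
  obtain \<pi> where \<pi>: "\<pi> > 0" "\<And>v. norm (P *v v) \<le> \<pi> * norm v" by (rule matrix_vector_mult_bounded[of P]) blast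
  obtain L b where L: "bounded_linear L" "\<And>u v. inner (L u) v = inner u (L v)" and b: "0 \<le> b"
    "\<And>x. x \<in> L2 \<Longrightarrow> ham H x \<in> H1 \<Longrightarrow> 2 * inner (abs_l2 (phs_operator P G H x)) (L (abs_l2 x))
        \<le> b * ((norm (ac_rep (ham H x) 1))\<^sup>2 + (norm (ac_rep (ham H x) 0))\<^sup>2) - (norm (mult_op H (abs_l2 x)))\<^sup>2"
    using multiplier_estimate by blast
  obtain \<Lambda> where \<Lambda>: "\<Lambda> > 0" "\<And>u. norm (L u) \<le> norm u * \<Lambda>" using bounded_linear.pos_bounded[OF L(1)] by blast
  \<comment> \<open>The functional \<open>q\<close> is at most \<Lambda> times the squared norm, and
    \<open>H_op_lower\<close> converts that norm into energy at the cost
    \<open>1 / l\<close>.\<close>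
  define d where "d = \<Lambda> / l"
  have d0: "0 \<le> d" using \<Lambda>(1) H_lower(1) by (simp add: d_def)
  define \<tau> where "\<tau> = (2 * d + 1) / l"
  have \<tau>0: "\<tau> > 0" unfolding \<tau>_def using d0 H_lower(1) by (intro divide_pos_pos) auto
  \<comment> \<open>The constant of \<open>observability_of_differential_inequalities\<close> for
    rate \<open>l\<close>, energy constant \<open>\<pi> * \<kappa>\<close> and multiplier constant
    \<open>b * \<kappa>\<close>; each factor \<kappa> comes from replacing the trace by the
    output.\<close>
  define M where "M = b * \<kappa> + (\<pi> * \<kappa>) * (l * \<tau>) + d * (\<pi> * \<kappa>)"
  have M0: "0 \<le> M" unfolding M_def using b(1) \<kappa>(1) \<pi>(1) H_lower(1) \<tau>0 d0 by (intro add_nonneg_nonneg mult_nonneg_nonneg) auto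
  have main: "(energy_norm H x\<^sub>0)\<^sup>2 \<le> M * (LINT t|lebesgue_on {0..\<tau>}. (norm (phs_output H W\<^sub>C T x\<^sub>0 t))\<^sup>2)"
    if x0: "x\<^sub>0 \<in> phs_domain H W\<^sub>B" for x\<^sub>0
  proof -
    define X where "X t = U t (abs_l2 x\<^sub>0)" for t
    define Z where "Z t = U t (abs_l2 (phs_operator P G H x\<^sub>0))" for t
    define E where "E t = inner (X t) (mult_op H (X t))" for t
    define q where "q t = inner (X t) (L (X t))" for t
    define r where "r t = (norm (phs_output H W\<^sub>C T x\<^sub>0 t))\<^sup>2" for t
    have X': "(X has_vector_derivative Z t) (at t within {0..})" if "0 \<le> t" for t
      unfolding X_def[abs_def] Z_def by (rule U_has_vector_derivative[OF D_difference_quotient[OF x0] that])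
    have "E 0 \<le> (b * \<kappa> + (\<pi> * \<kappa>) * (l * \<tau>) + d * (\<pi> * \<kappa>)) * (LINT t|lebesgue_on {0..\<tau>}. r t)"
    proof (rule observability_of_differential_inequalities
        [where q = q and E' = "\<lambda>t. 2 * inner (Z t) (mult_op H (X t))" and q' = "\<lambda>t. 2 * inner (Z t) (L (X t))"])
      show "continuous_on {0..} r"
        unfolding r_def[abs_def] by (intro continuous_intros output_continuous x0)
      show "0 \<le> \<pi> * \<kappa>" "0 < l" "0 \<le> d" "\<tau> = (2 * d + 1) / l"
        using \<pi>(1) \<kappa>(1) H_lower(1) d0 by (auto simp: \<tau>_def)
      fix t :: real assume t: "0 \<le> t"
      show "0 \<le> r t" by (simp add: r_def)
      show "(E has_real_derivative 2 * inner (Z t) (mult_op H (X t))) (at t within {0..})"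
        unfolding E_def[abs_def] by (rule quadratic_form_has_derivative[OF H_op H_op_symmetric X'[OF t]])
      show "(q has_real_derivative 2 * inner (Z t) (L (X t))) (at t within {0..})"
        unfolding q_def[abs_def] by (rule quadratic_form_has_derivative[OF L X'[OF t]])
      define x where "x = T t x\<^sub>0"
      have x: "x \<in> phs_domain H W\<^sub>B" unfolding x_def by (rule T_D[OF x0 t])
      note xL = D_L2[OF x] domain_H1[OF x]
      have Xt: "X t = abs_l2 x" and Zt: "Z t = abs_l2 (phs_operator P G H x)"
        using t x0 D_L2[OF x0] by (simp_all add: X_def Z_def x_def U_abs_l2 T_D)
      define g1 where "g1 = ac_rep (ham H x) 1"
      define g0 where "g0 = ac_rep (ham H x) 0"
      have trace: "(norm g1)\<^sup>2 + (norm g0)\<^sup>2 \<le> \<kappa> * r t"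
        using \<kappa>(2)[OF x] by (simp add: g1_def g0_def r_def phs_output_def x_def)
      have P_form: "\<bar>inner (P *v v) v\<bar> \<le> \<pi> * (norm v)\<^sup>2" for v
        using order_trans[OF Cauchy_Schwarz_ineq2 mult_right_mono[OF \<pi>(2)[of v] norm_ge_zero[of v]]]
        by (simp add: power2_eq_square mult.assoc)
      have "\<bar>2 * inner (Z t) (mult_op H (X t))\<bar> \<le> \<pi> * ((norm g1)\<^sup>2 + (norm g0)\<^sup>2)"
        unfolding Xt Zt energy_balance[OF xL] g1_def[symmetric] g0_def[symmetric]
        using P_form[of g1] P_form[of g0] by (simp add: distrib_left abs_le_iff)
      also have "\<dots> \<le> \<pi> * (\<kappa> * r t)" using trace \<pi>(1) by simp
      finally show "\<bar>2 * inner (Z t) (mult_op H (X t))\<bar> \<le> \<pi> * \<kappa> * r t" by simp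
      have "2 * inner (Z t) (L (X t)) \<le> b * ((norm g1)\<^sup>2 + (norm g0)\<^sup>2) - (norm (mult_op H (X t)))\<^sup>2"
        unfolding Xt Zt g1_def g0_def by (rule b(2)[OF xL])
      also have "\<dots> \<le> b * (\<kappa> * r t) - l * E t"
        unfolding E_def by (intro diff_mono mult_left_mono trace b(1) H_op_energy_le)
      finally show "2 * inner (Z t) (L (X t)) \<le> b * \<kappa> * r t - l * E t" by simp
      have "\<bar>q t\<bar> \<le> norm (X t) * norm (L (X t))" unfolding q_def by (rule Cauchy_Schwarz_ineq2)
      also have "\<dots> \<le> norm (X t) * (norm (X t) * \<Lambda>)" by (intro mult_left_mono \<Lambda>(2)) simp
      also have "\<dots> = d * (l * (norm (X t))\<^sup>2)" using H_lower(1) by (simp add: d_def power2_eq_square)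
      also have "\<dots> \<le> d * E t" unfolding E_def by (intro mult_left_mono H_op_lower d0)
      finally show "\<bar>q t\<bar> \<le> d * E t" .
    qed
    moreover have "E 0 = (energy_norm H x\<^sub>0)\<^sup>2"
      by (simp add: E_def X_def U_zero energy_norm_eq D_L2[OF x0] energy_nonneg)
    ultimately show ?thesis by (simp add: M_def r_def)
  qed
  show ?thesis
  \<comment> \<open>\<open>M\<close> is only known to be nonnegative; adding 1 makes the quotient
    positive in every case.\<close>
  proof (rule exI[of _ \<tau>], rule conjI[OF \<tau>0], rule exI[of _ "1 / (M + 1)"], intro conjI ballI)
    show "0 < 1 / (M + 1)" using M0 by simp
    fix x\<^sub>0 assume x0: "x\<^sub>0 \<in> phs_domain H W\<^sub>B"
    define I where "I = (LINT t|lebesgue_on {0..\<tau>}. (norm (phs_output H W\<^sub>C T x\<^sub>0 t))\<^sup>2)"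
    have I0: "0 \<le> I" unfolding I_def by (rule Bochner_Integration.integral_nonneg) simp
    have "(energy_norm H x\<^sub>0)\<^sup>2 \<le> (M + 1) * I" using main[OF x0] I0 unfolding I_def[symmetric] by (simp add: distrib_right)
    then show "1 / (M + 1) * (energy_norm H x\<^sub>0)\<^sup>2 \<le> (LINT t|lebesgue_on {0..\<tau>}. (norm (phs_output H W\<^sub>C T x\<^sub>0 t))\<^sup>2)"
      unfolding I_def[symmetric] using M0 by (simp add: field_simps)
  qed
qed

end

text \<open>The bound on the inverse gives a lower bound on the norm of \<open>H v\<close>, not yet
  on the quadratic form. \<open>positive_hermitian_norm_sq_le\<close> bridges the two, whence the
  constant \<open>1 / (k\<^sup>2 * h)\<close>.\<close>

lemma Hamiltonian_bounds:
  fixes H :: "real \<Rightarrow> complex^'n^'n"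
  assumes pos: "AE \<zeta> in unit_measure. positive_hermitian (H \<zeta>)"
    and "H \<in> Linfty" "(\<lambda>\<zeta>. matrix_inv (H \<zeta>)) \<in> Linfty"
  obtains h l where "0 < h" "AE \<zeta> in unit_measure. \<forall>v. norm (H \<zeta> *v v) \<le> h * norm v"
    "0 < l" "AE \<zeta> in unit_measure. \<forall>v. l * (norm v)\<^sup>2 \<le> inner v (H \<zeta> *v v)"
proof -
  obtain C where C: "AE \<zeta> in unit_measure. norm (H \<zeta>) \<le> C" using assms(2) by (auto simp: Linfty_def)
  obtain C' where C': "AE \<zeta> in unit_measure. norm (matrix_inv (H \<zeta>)) \<le> C'" using assms(3) by (auto simp: Linfty_def)
  obtain K where K: "K > 0" "\<And>(A::complex^'n^'n) v. norm (A *v v) \<le> K * norm A * norm v"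
    by (rule norm_matrix_vector_mult_le) blast
  have bound: "norm (A *v v) \<le> K * (\<bar>c\<bar> + 1) * norm v" if "norm A \<le> c" for A :: "complex^'n^'n" and c v
  proof -
    have "K * norm A \<le> K * (\<bar>c\<bar> + 1)" using that K(1) by (intro mult_left_mono) auto
    then show ?thesis using order_trans[OF K(2) mult_right_mono[OF _ norm_ge_zero]] by blast
  qed
  \<comment> \<open>The absolute value and the 1 make the constant positive whatever essential bound
    was obtained.\<close>
  define h where "h = K * (\<bar>C\<bar> + 1)"
  define k where "k = K * (\<bar>C'\<bar> + 1)"
  have h0: "0 < h" and k0: "0 < k" using K(1) by (auto simp: h_def k_def intro!: mult_pos_pos)
  have up: "AE \<zeta> in unit_measure. \<forall>v. norm (H \<zeta> *v v) \<le> h * norm v"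
    unfolding h_def using C by eventually_elim (blast intro: bound)
  have low: "AE \<zeta> in unit_measure. \<forall>v. 1 / (k\<^sup>2 * h) * (norm v)\<^sup>2 \<le> inner v (H \<zeta> *v v)"
    using pos up C'
  proof (eventually_elim, intro allI)
    fix \<zeta> v
    assume p: "positive_hermitian (H \<zeta>)" and u: "\<forall>v. norm (H \<zeta> *v v) \<le> h * norm v"
      and i: "norm (matrix_inv (H \<zeta>)) \<le> C'"
    have "norm v = norm (matrix_inv (H \<zeta>) *v (H \<zeta> *v v))"
      using positive_hermitian_invertible[OF p] by (simp add: matrix_vector_mul_assoc)
    also have "\<dots> \<le> k * norm (H \<zeta> *v v)" unfolding k_def by (rule bound[OF i])
    finally have "(norm v)\<^sup>2 \<le> (k * norm (H \<zeta> *v v))\<^sup>2" by (rule power_mono) simp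
    also have "\<dots> = k\<^sup>2 * (norm (H \<zeta> *v v))\<^sup>2" by (simp add: power_mult_distrib)
    also have "\<dots> \<le> k\<^sup>2 * (h * inner v (H \<zeta> *v v))"
      using positive_hermitian_norm_sq_le[OF p h0] u by (intro mult_left_mono) auto
    finally show "1 / (k\<^sup>2 * h) * (norm v)\<^sup>2 \<le> inner v (H \<zeta> *v v)"
      using h0 k0 by (simp add: field_simps)
  qed
  have "0 < 1 / (k\<^sup>2 * h)" using h0 k0 by simp
  with h0 up low show ?thesis by (intro that[of h "1 / (k\<^sup>2 * h)"])
qed

theorem mainTheorem1:
  fixes P\<^sub>1 G\<^sub>0 W\<^sub>B\<^sub>1 W\<^sub>B\<^sub>0 W\<^sub>C\<^sub>1 W\<^sub>C\<^sub>0 :: "complex^'n^'n"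
    and \<H> S \<Delta> :: "real \<Rightarrow> complex^'n^'n"
    and T :: "real \<Rightarrow> (real \<Rightarrow> complex^'n) \<Rightarrow> (real \<Rightarrow> complex^'n)"
  assumes "invertible P\<^sub>1" and "hermitian P\<^sub>1"
    and "full_row_rank (row_block W\<^sub>B\<^sub>1 W\<^sub>B\<^sub>0)"
    and "full_row_rank (row_block W\<^sub>C\<^sub>1 W\<^sub>C\<^sub>0)"
    and "AE \<zeta> in lebesgue_on {0..1}. positive_hermitian (\<H> \<zeta>)"
    and "\<H> \<in> Linfty" and "(\<lambda>\<zeta>. matrix_inv (\<H> \<zeta>)) \<in> Linfty"
    and "AE \<zeta> in lebesgue_on {0..1}. diagonal (\<Delta> \<zeta>) \<and> invertible (S \<zeta>) \<and>
           P\<^sub>1 ** \<H> \<zeta> = matrix_inv (S \<zeta>) ** \<Delta> \<zeta> ** S \<zeta>"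
    and "C1_unit (\<lambda>\<zeta>. matrix_inv (S \<zeta>))" and "C1_unit S" and "C1_unit \<Delta>"
    and "generates_C0_semigroup (energy_norm \<H>) (phs_domain \<H> (row_block W\<^sub>B\<^sub>1 W\<^sub>B\<^sub>0))
           (phs_operator P\<^sub>1 G\<^sub>0 \<H>) T"
    and "invertible (column_block (row_block W\<^sub>B\<^sub>1 W\<^sub>B\<^sub>0) (row_block W\<^sub>C\<^sub>1 W\<^sub>C\<^sub>0))"
    and "strongly_stable (energy_norm \<H>) T"
    and "re_part G\<^sub>0 = 0"
  shows "\<exists>t\<^sub>0>0. \<exists>\<delta>>0. \<forall>x\<^sub>0\<in>phs_domain \<H> (row_block W\<^sub>B\<^sub>1 W\<^sub>B\<^sub>0).
           (LINT t|lebesgue_on {0..t\<^sub>0}. (norm (phs_output \<H> (row_block W\<^sub>C\<^sub>1 W\<^sub>C\<^sub>0) T x\<^sub>0 t))\<^sup>2)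
             \<ge> \<delta> * (energy_norm \<H> x\<^sub>0)\<^sup>2"
proof -
  obtain p where p: "p > 0" "\<And>v. norm v \<le> p * norm (P\<^sub>1 *v v)"
    by (rule matrix_left_inverse_bound[OF matrix_inv_left[OF assms(1)]]) blast
  obtain h l where hl: "0 < h" "AE \<zeta> in unit_measure. \<forall>v. norm (\<H> \<zeta> *v v) \<le> h * norm v"
    "0 < l" "AE \<zeta> in unit_measure. \<forall>v. l * (norm v)\<^sup>2 \<le> inner v (\<H> \<zeta> *v v)"
    by (rule Hamiltonian_bounds[OF assms(5-7)])
  \<comment> \<open>The factorization of \<open>P\<^sub>1 ** \<H> \<zeta>\<close> solved for \<H>:
    every factor is C1, and the identity holds almost everywhere.\<close>
  define Hc where "Hc \<zeta> = matrix_inv P\<^sub>1 ** (matrix_inv (S \<zeta>) ** \<Delta> \<zeta> ** S \<zeta>)" for \<zeta>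
  have "C1_unit Hc"
    unfolding Hc_def[abs_def] by (intro C1_unit_mult C1_unit_const assms(9-11))
  then obtain Hd where Hd: "continuous_on {0..1} Hd"
    "\<And>\<zeta>. \<zeta> \<in> {0..1} \<Longrightarrow> (Hc has_vector_derivative Hd \<zeta>) (at \<zeta> within {0..1})"
    unfolding C1_unit_def by blast
  have eq: "AE \<zeta> in unit_measure. \<H> \<zeta> = Hc \<zeta>"
    using assms(8)
  proof eventually_elim
    case (elim \<zeta>)
    then have "matrix_inv P\<^sub>1 ** (P\<^sub>1 ** \<H> \<zeta>) = Hc \<zeta>" by (simp add: Hc_def)
    then show ?case by (simp add: matrix_mul_assoc matrix_inv_left[OF assms(1)])
  qed
  interpret observed_phs_semigroup P\<^sub>1 G\<^sub>0 \<H> Hc Hd p h l "row_block W\<^sub>B\<^sub>1 W\<^sub>B\<^sub>0" "row_block W\<^sub>C\<^sub>1 W\<^sub>C\<^sub>0" T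
  proof (intro observed_phs_semigroup.intro phs_semigroup.intro phs_coefficients.intro
      phs_semigroup_axioms.intro observed_phs_semigroup_axioms.intro)
    show "\<H> \<in> borel_measurable unit_measure" using assms(6) by (simp add: Linfty_def)
    show "AE \<zeta> in unit_measure. hermitian (\<H> \<zeta>)"
      using assms(5) by eventually_elim (simp add: positive_hermitian_def)
  qed (fact assms p hl Hd eq)+
  show ?thesis by (rule exact_observability)
qed

end
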